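(* Let $p,q\in\mathbb{Z}_{\geq 2}$ (arbitrary, possibly equal) and let $G=G_{p,q}=\langle x,y\mid x^p=y^q\rangle$. For $g \in G$ let $\iota_g$ denote conjugation $h\mapsto ghg^{-1}$, and let $\tau$ be the automorphism of $G$ with $\tau(x)=x^{-1}$, $\tau(y)=y^{-1}$. The fixed subgroups of the non-trivial automorphisms in the outer automorphism classes $[\mathrm{id}]$ and $[\tau]$ are as follows. (A) Class $[\mathrm{id}]$. Let $g\in G$ with $\iota_g\neq \mathrm{id}$. 1. If $\iota_g$ has finite order, then $\mathrm{Fix}(\iota_g)=\langle|g|\rangle\cong\mathbb{Z}$. 2. If $\iota_g$ has infinite order, then we may assume that $g$ acts directly (that is, there is $g'\in G$ acting directly with $\iota_{g'}=\iota_g$), and if $g$ acts directly then $\mathrm{Fix}(\iota_g)=\langle|g|\rangle\times\langle x^p\rangle\cong\mathbb{Z}^2$ (internal direct product). (B) Class $[\tau]$. Let $g\in G$. 1. If $\iota_g\tau$ has finite order, then there exist $h\in G$, $r\in\mathbb{Z}$ and $w\in\{x,y\}$ such that $g=hw^r\tau(h)^{-1}$. For such $h,r,w$: (a) if $p$, $q$ and $r$ are all even, then $\mathrm{Fix}(\iota_g\tau)=\langle h w^{r/2}x^{p/2}y^{-q/2}w^{-r/2}h^{-1}\rangle\cong\mathbb{Z}$; (b) if $p$, $q$ and $r$ are not all even, then $\mathrm{Fix}(\iota_g\tau)=\{1\}$. 2. If $\iota_g\tau$ has infinite order, then $\mathrm{Fix}(\iota_g\tau)=\langle|g\tau(g)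|\rangle\cong\mathbb{Z}$.
   Context: For an automorphism $\varphi$ of a group $G$, $\mathrm{Fix}(\varphi)=\{g\in G\mid\varphi(g)=g\}$. $[\varphi]$ denotes the class of $\varphi$ in $\mathrm{Out}(G)=\mathrm{Aut}(G)/\mathrm{Inn}(G)$; so the class $[\mathrm{id}]$ consists of the $\iota_g$ and the class $[\tau]$ of the $\iota_g\tau=\iota_g\circ\tau$, $g\in G$. For a non-central $g\in G_{p,q}$, $\langle|g|\rangle$ denotes the maximal cyclic subgroup containing $g$, i.e. the cyclic subgroup of $G_{p,q}$ containing $g$ that contains every cyclic subgroup containing $g$ (this is well defined for non-central elements). The Bass-Serre tree $T$ of $G=G_{p,q}$ has vertices $v_{g\langle x\rangle}$ and $v_{g\langle y\rangle}$ (one for each left coset of $\langle x\rangle$ and of $\langle y\rangle$) and edges $e_{g\langle x^p\rangle}$ (one for each left coset of $\langle x^p\rangle=\langle y^q\rangle$), the edge $e_{g\langle x^p\rangle}$ joining $v_{g\langle x\rangle}$ and $v_{g\langle y\rangle}$; each edge has length $1$, and $G$ acts by left multiplication on cosets. For an isometry $\gamma$ of $T$, its translation length is $l(\gamma)=\inf_{z\in T}d(z,\gamma z)$. It is hyperbolic if $l(\gamma)>0$, in which case the set of points $z$ with $d(z,\gamma z)=l(\gamma)$ is a bi-infinite line (its axis) along which $\gamma$ translates by $l(\gamma)$. An element $g\in G$ acts directly (along an axis $\omega$) if it acts hyperbolically with axis $\omega$ and there is an element $\hat g\in G$ acting hyperbolically along $\omega$, with translation length minimal among the non-zero translation lengths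 of elements of $G$ acting along $\omega$, such that $g=\hat g^k$ for some $0\neq k\in\mathbb{Z}$. *)

theory Defs
  imports Complex_Main "HOL-Algebra.Algebra"
begin

section \<open>Groups given by generators and relations\<close>

text \<open>A word is a list of signed generators: \<open>(a, True)\<close> stands for the generator \<open>a\<close> and
  \<open>(a, False)\<close> for its inverse.  A relation \<open>(r, s)\<close> in \<open>R\<close> stands for the equation \<open>r = s\<close>.\<close>

type_synonym 'a word = "('a \<times> bool) list"

inductive word_eq :: "('a word \<times> 'a word) set \<Rightarrow> 'a word \<Rightarrow> 'a word \<Rightarrow> bool"
  for R :: "('a word \<times> 'a word) set" where
  refl: "word_eq R u u"
| sym: "word_eq R u v \<Longrightarrow> word_eq R v u"
| trans: "word_eq R u v \<Longrightarrow> word_eq R v w \<Longrightarrow> word_eq R u w"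
| cancel: "word_eq R (u @ [(a, b), (a, \<not> b)] @ v) (u @ v)"
| relation: "(r, s) \<in> R \<Longrightarrow> word_eq R (u @ r @ v) (u @ s @ v)"

definition word_class :: "('a word \<times> 'a word) set \<Rightarrow> 'a word \<Rightarrow> 'a word set" where
  "word_class R u = {v. word_eq R u v}"

definition presented_group :: "('a word \<times> 'a word) set \<Rightarrow> 'a word set monoid" where
  "presented_group R =
     \<lparr>carrier = range (word_class R),
      monoid.mult = (\<lambda>A B. \<Union>u\<in>A. \<Union>v\<in>B. word_class R (u @ v)),
      one = word_class R []\<rparr>"

datatype gen = Gen_x | Gen_y

definition Gpq_rels :: "nat \<Rightarrow> nat \<Rightarrow> (gen word \<times> gen word) set" where
  "Gpq_rels p q = {(replicate p (Gen_x, True), replicate q (Gen_y, True))}"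

definition Gpq :: "nat \<Rightarrow> nat \<Rightarrow> gen word set monoid" where
  "Gpq p q = presented_group (Gpq_rels p q)"

definition Gpq_x :: "nat \<Rightarrow> nat \<Rightarrow> gen word set" where
  "Gpq_x p q = word_class (Gpq_rels p q) [(Gen_x, True)]"

definition Gpq_y :: "nat \<Rightarrow> nat \<Rightarrow> gen word set" where
  "Gpq_y p q = word_class (Gpq_rels p q) [(Gen_y, True)]"


section \<open>Automorphisms\<close>

text \<open>As for \<^const>\<open>auto\<close> in the library, automorphisms are extensional functions on the
  carrier; the identity automorphism is the unit of \<^const>\<open>AutoGroup\<close>.\<close>

definition conj_aut :: "('a, 'b) monoid_scheme \<Rightarrow> 'a \<Rightarrow> 'a \<Rightarrow> 'a" where
  "conj_aut G g = (\<lambda>h\<in>carrier G. g \<otimes>\<^bsub>G\<^esub> h \<otimes>\<^bsub>G\<^esub> inv\<^bsub>G\<^esub> g)"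

definition Inn :: "('a, 'b) monoid_scheme \<Rightarrow> ('a \<Rightarrow> 'a) set" where
  "Inn G = conj_aut G ` carrier G"

text \<open>The element of \<open>AutoGroup G Mod Inn G\<close> represented by an automorphism.\<close>

definition outer_class :: "('a, 'b) monoid_scheme \<Rightarrow> ('a \<Rightarrow> 'a) \<Rightarrow> ('a \<Rightarrow> 'a) set" where
  "outer_class G \<phi> = Inn G #>\<^bsub>AutoGroup G\<^esub> \<phi>"

definition has_finite_order :: "('a, 'b) monoid_scheme \<Rightarrow> 'a \<Rightarrow> bool" where
  "has_finite_order H a \<longleftrightarrow> (\<exists>n::nat. n > 0 \<and> a [^]\<^bsub>H\<^esub> n = \<one>\<^bsub>H\<^esub>)"

definition Fix :: "('a, 'b) monoid_scheme \<Rightarrow> ('a \<Rightarrow> 'a) \<Rightarrow> 'a set" where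
  "Fix G \<phi> = {g \<in> carrier G. \<phi> g = g}"

definition tau :: "nat \<Rightarrow> nat \<Rightarrow> gen word set \<Rightarrow> gen word set" where
  "tau p q = (THE \<phi>. \<phi> \<in> auto (Gpq p q) \<and>
     \<phi> (Gpq_x p q) = inv\<^bsub>Gpq p q\<^esub> (Gpq_x p q) \<and>
     \<phi> (Gpq_y p q) = inv\<^bsub>Gpq p q\<^esub> (Gpq_y p q))"


section \<open>Subgroups\<close>

definition cyclic_subgroup :: "('a, 'b) monoid_scheme \<Rightarrow> 'a set \<Rightarrow> bool" where
  "cyclic_subgroup G C \<longleftrightarrow> (\<exists>a\<in>carrier G. C = generate G {a})"

text \<open>Meaningful only if there is a largest cyclic subgroup containing \<open>g\<close>; in \<open>Gpq p q\<close>
  this is the case for all non-central \<open>g\<close>.\<close>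

definition max_cyclic :: "('a, 'b) monoid_scheme \<Rightarrow> 'a \<Rightarrow> 'a set" where
  "max_cyclic G g = (THE C. cyclic_subgroup G C \<and> g \<in> C \<and>
     (\<forall>D. cyclic_subgroup G D \<and> g \<in> D \<longrightarrow> D \<subseteq> C))"

definition internal_direct_product ::
    "('a, 'b) monoid_scheme \<Rightarrow> 'a set \<Rightarrow> 'a set \<Rightarrow> 'a set \<Rightarrow> bool" where
  "internal_direct_product G H K M \<longleftrightarrow>
     subgroup H G \<and> subgroup K G \<and>
     (\<forall>h\<in>H. \<forall>k\<in>K. h \<otimes>\<^bsub>G\<^esub> k = k \<otimes>\<^bsub>G\<^esub> h) \<and>
     H \<inter> K = {\<one>\<^bsub>G\<^esub>} \<and> M = H <#>\<^bsub>G\<^esub> K"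


section \<open>The Bass-Serre tree as a metric graph\<close>

text \<open>\<open>Inner C t\<close> with \<open>0 < t < 1\<close> is the interior point of the edge labelled by the coset \<open>C\<close>
  at distance \<open>t\<close> from the endpoint that is a coset of the subgroup generated by \<open>x\<close>.\<close>

datatype 'a bs_point = Vertex_x "'a set" | Vertex_y "'a set" | Inner "'a set" real

definition edge_point :: "nat \<Rightarrow> nat \<Rightarrow> gen word set \<Rightarrow> real \<Rightarrow> gen word set bs_point" where
  "edge_point p q g t =
     (if t = 0 then Vertex_x (g <#\<^bsub>Gpq p q\<^esub> generate (Gpq p q) {Gpq_x p q})
      else if t = 1 then Vertex_y (g <#\<^bsub>Gpq p q\<^esub> generate (Gpq p q) {Gpq_y p q})
      else Inner (g <#\<^bsub>Gpq p q\<^esub> generate (Gpq p q) {Gpq_x p q [^]\<^bsub>Gpq p q\<^esub> p}) t)"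

definition bs_tree :: "nat \<Rightarrow> nat \<Rightarrow> gen word set bs_point set" where
  "bs_tree p q = {edge_point p q g t | g t. g \<in> carrier (Gpq p q) \<and> 0 \<le> t \<and> t \<le> 1}"

text \<open>\<open>bs_chain p q z z' L\<close>: one can move from \<open>z\<close> to \<open>z'\<close> by finitely many segments, each inside
  a closed edge, of total length \<open>L\<close>.  The path metric is the infimum of these lengths.\<close>

inductive bs_chain ::
    "nat \<Rightarrow> nat \<Rightarrow> gen word set bs_point \<Rightarrow> gen word set bs_point \<Rightarrow> real \<Rightarrow> bool"
  for p q :: nat where
  start: "z \<in> bs_tree p q \<Longrightarrow> bs_chain p q z z 0"
| step: "bs_chain p q z (edge_point p q g s) L \<Longrightarrow> g \<in> carrier (Gpq p q) \<Longrightarrow>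
     0 \<le> s \<Longrightarrow> s \<le> 1 \<Longrightarrow> 0 \<le> t \<Longrightarrow> t \<le> 1 \<Longrightarrow>
     bs_chain p q z (edge_point p q g t) (L + \<bar>s - t\<bar>)"

definition bs_dist :: "nat \<Rightarrow> nat \<Rightarrow> gen word set bs_point \<Rightarrow> gen word set bs_point \<Rightarrow> real" where
  "bs_dist p q z z' = Inf {L. bs_chain p q z z' L}"

fun bs_act :: "nat \<Rightarrow> nat \<Rightarrow> gen word set \<Rightarrow> gen word set bs_point \<Rightarrow> gen word set bs_point" where
  "bs_act p q g (Vertex_x C) = Vertex_x (g <#\<^bsub>Gpq p q\<^esub> C)"
| "bs_act p q g (Vertex_y C) = Vertex_y (g <#\<^bsub>Gpq p q\<^esub> C)"
| "bs_act p q g (Inner C t) = Inner (g <#\<^bsub>Gpq p q\<^esub> C) t"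

definition transl_length ::
    "nat \<Rightarrow> nat \<Rightarrow> (gen word set bs_point \<Rightarrow> gen word set bs_point) \<Rightarrow> real" where
  "transl_length p q \<gamma> = (INF z\<in>bs_tree p q. bs_dist p q z (\<gamma> z))"

definition hyperbolic ::
    "nat \<Rightarrow> nat \<Rightarrow> (gen word set bs_point \<Rightarrow> gen word set bs_point) \<Rightarrow> bool" where
  "hyperbolic p q \<gamma> \<longleftrightarrow> transl_length p q \<gamma> > 0"

definition transl_axis ::
    "nat \<Rightarrow> nat \<Rightarrow> (gen word set bs_point \<Rightarrow> gen word set bs_point) \<Rightarrow> gen word set bs_point set" where
  "transl_axis p q \<gamma> = {z \<in> bs_tree p q. bs_dist p q z (\<gamma> z) = transl_length p q \<gamma>}"

definition acts_along :: "nat \<Rightarrow> nat \<Rightarrow> gen word set \<Rightarrow> gen word set bs_point set \<Rightarrow> bool" where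
  "acts_along p q g \<omega> \<longleftrightarrow>
     g \<in> carrier (Gpq p q) \<and> hyperbolic p q (bs_act p q g) \<and> transl_axis p q (bs_act p q g) = \<omega>"

definition acts_directly_along ::
    "nat \<Rightarrow> nat \<Rightarrow> gen word set \<Rightarrow> gen word set bs_point set \<Rightarrow> bool" where
  "acts_directly_along p q g \<omega> \<longleftrightarrow>
     acts_along p q g \<omega> \<and>
     (\<exists>g' k. acts_along p q g' \<omega> \<and>
        (\<forall>h. acts_along p q h \<omega> \<longrightarrow>
           transl_length p q (bs_act p q g') \<le> transl_length p q (bs_act p q h)) \<and>
        k \<noteq> 0 \<and> g = g' [^]\<^bsub>Gpq p q\<^esub> (k::int))"

definition acts_directly :: "nat \<Rightarrow> nat \<Rightarrow> gen word set \<Rightarrow> bool" where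
  "acts_directly p q g \<longleftrightarrow> (\<exists>\<omega>. acts_directly_along p q g \<omega>)"

end

theory Submission
  imports Defs
begin

text \<open>
  Write \<open>z\<close> for the central element \<open>x ^ p = y ^ q\<close>.  Modulo \<open>\<langle>z\<rangle>\<close> the group becomes the free product
  of a cyclic group of order \<open>p\<close> and one of order \<open>q\<close>, so every element is \<open>z ^ m\<close> times a unique
  alternating product of syllables \<open>x ^ i\<close> (\<open>0 < i < p\<close>) and \<open>y ^ j\<close> (\<open>0 < j < q\<close>).  Everything rests
  on the number \<open>len g\<close> of syllables and on the types of the first and the last one: lengths add
  unless the two syllables that meet have the same type (\<open>len_mult\<close>), and otherwise the length drops
  (\<open>len_mult_less\<close>).  In the Bass-Serre tree, \<open>len (inv u \<otimes> h)\<close> is the distance between the midpoints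
  of the edges of \<open>u\<close> and \<open>h\<close>.

  Elements of positive even length begin and end with different types, so the lengths of their
  powers grow linearly: they are the cyclically reduced ones.  Minimising the length over a
  conjugacy class shows that every element is conjugate either to a power of a generator (elliptic
  case) or to a cyclically reduced element (hyperbolic case).  An odd element cannot commute with a
  cyclically reduced one (\<open>odd_even_not_commute\<close>), because one of the two products is shorter than
  the other.  Hence the centralizer of a cyclically reduced element consists of even elements, and
  on any group of even elements the length, with a sign for the direction, is a homomorphism to the
  integers (\<open>signed_len_mult\<close>) whose kernel lies in \<open>\<langle>z\<rangle>\<close>.  So the centralizer of a hyperbolic
  element is generated by one element together with \<open>z\<close>.  The homomorphism \<open>deg\<close> with
  \<open>x \<mapsto> q\<close>, \<open>y \<mapsto> p\<close> controls the remaining power of \<open>z\<close>.  This settles the class of the identity,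
  since the fixed subgroup of a conjugation is a centralizer, once acting directly is understood.
  For that, the path metric of the tree is computed from normal forms (\<open>bs_dist_ep\<close>); the
  axis of a hyperbolic \<open>g\<close> turns out to consist of the edges of those \<open>u\<close> for which
  \<open>inv u \<otimes> g \<otimes> u\<close> is cyclically reduced, and elements with the same axis commute
  (\<open>same_axis_commute\<close>).

  For the class of \<open>\<tau>\<close>, note that \<open>\<tau>\<close> replaces each exponent \<open>k\<close> of a syllable by its complement and
  so preserves lengths and types.  The square of \<open>\<iota>_g \<tau>\<close> is \<open>\<iota>_(g \<tau>(g))\<close>.  If this has infinite
  order, the fixed subgroup lies in the centralizer of the hyperbolic element \<open>g \<tau>(g)\<close>, meets
  \<open>\<langle>z\<rangle>\<close> trivially and is closed under roots there, hence is the maximal cyclic subgroup.  If it has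
  finite order, minimising the length over the twisted conjugates \<open>inv u \<otimes> g \<otimes> \<tau> u\<close> brings \<open>g\<close> to
  a power of a generator, and the powers that remain are treated one by one: an even exponent
  reduces to \<open>\<tau>\<close> itself, whose fixed points have all exponents equal to half the period, and an odd
  exponent to a parity argument on lengths.
\<close>


section \<open>Presented groups\<close>

lemma word_eq_append:
  assumes "word_eq R u v"
  shows "word_eq R (a @ u @ b) (a @ v @ b)"
  using assms
proof (induction rule: word_eq.induct)
  case (trans u v w)
  then show ?case by (blast intro: word_eq.trans)
next
  case (cancel u c s v)
  then show ?case using word_eq.cancel[of R "a @ u" c s "v @ b"] by simp
next
  case (relation r s u v)
  then show ?case using word_eq.relation[of r s R "a @ u" "v @ b"] by simp
qed (auto intro: word_eq.refl word_eq.sym)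

lemma word_eq_append2: "word_eq R u u' \<Longrightarrow> word_eq R v v' \<Longrightarrow> word_eq R (u @ v) (u' @ v')"
  using word_eq_append[of R u u' "[]" v] word_eq_append[of R v v' u' "[]"]
  by (auto intro: word_eq.trans)

lemma word_class_eq_iff: "word_class R u = word_class R v \<longleftrightarrow> word_eq R u v"
  by (auto simp: word_class_def intro: word_eq.refl word_eq.sym word_eq.trans)

definition inv_word :: "'a word \<Rightarrow> 'a word" where
  "inv_word u = rev (map (\<lambda>(a, b). (a, \<not> b)) u)"

lemma word_eq_inv_word: "word_eq R (inv_word u @ u) []"
proof (induction u)
  case Nil
  then show ?case by (simp add: inv_word_def word_eq.refl)
next
  case (Cons c u)
  obtain a b where c: "c = (a, b)" by force
  have "word_eq R (inv_word u @ [(a, \<not> b), (a, \<not> \<not> b)] @ u) (inv_word u @ u)"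
    by (rule word_eq.cancel)
  then show ?case using Cons by (auto simp: c inv_word_def intro: word_eq.trans)
qed

lemma presented_group_simps [simp]:
  "carrier (presented_group R) = range (word_class R)"
  "\<one>\<^bsub>presented_group R\<^esub> = word_class R []"
  "word_class R u \<otimes>\<^bsub>presented_group R\<^esub> word_class R v = word_class R (u @ v)"
proof -
  have "word_class R (u' @ v') = word_class R (u @ v)" if "word_eq R u u'" "word_eq R v v'" for u' v'
    using word_eq_append2[OF that] by (simp add: word_class_eq_iff word_eq.sym)
  then show "word_class R u \<otimes>\<^bsub>presented_group R\<^esub> word_class R v = word_class R (u @ v)"
    by (auto simp: presented_group_def word_class_def intro: word_eq.refl)
qed (simp_all add: presented_group_def)

lemma group_presented_group: "group (presented_group R)"
proof (rule groupI)
  fix a assume "a \<in> carrier (presented_group R)"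
  then obtain u where "a = word_class R u" by auto
  then show "\<exists>b\<in>carrier (presented_group R). b \<otimes>\<^bsub>presented_group R\<^esub> a = \<one>\<^bsub>presented_group R\<^esub>"
    using word_eq_inv_word[of R u] by (auto simp: word_class_eq_iff)
qed auto

definition word_eval :: "('b, 'c) monoid_scheme \<Rightarrow> ('a \<Rightarrow> 'b) \<Rightarrow> 'a word \<Rightarrow> 'b" where
  "word_eval H f u = foldr (\<lambda>(a, b) h. (if b then f a else inv\<^bsub>H\<^esub> f a) \<otimes>\<^bsub>H\<^esub> h) u \<one>\<^bsub>H\<^esub>"

context group
begin

lemma word_eval_closed: "range f \<subseteq> carrier G \<Longrightarrow> word_eval G f u \<in> carrier G"
  by (induction u) (auto simp: word_eval_def image_subset_iff)

lemma word_eval_append: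
  "range f \<subseteq> carrier G \<Longrightarrow> word_eval G f (u @ v) = word_eval G f u \<otimes> word_eval G f v"
proof (induction u)
  case Nil
  then show ?case using word_eval_closed[of f v] by (simp add: word_eval_def)
next
  case (Cons c u)
  obtain a b where c: "c = (a, b)" by force
  have *: "word_eval G f ((a, b) # w) = (if b then f a else inv f a) \<otimes> word_eval G f w" for w
    by (simp add: word_eval_def)
  have "f a \<in> carrier G" using Cons.prems by auto
  then show ?case
    using Cons word_eval_closed[OF Cons.prems] by (simp add: c * m_assoc)
qed

lemma word_eval_cong:
  assumes "word_eq R u v" "range f \<subseteq> carrier G"
    and "\<And>r s. (r, s) \<in> R \<Longrightarrow> word_eval G f r = word_eval G f s"
  shows "word_eval G f u = word_eval G f v"
  using assms(1)
proof (induction rule: word_eq.induct)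
  case (cancel u a b v)
  have fa: "f a \<in> carrier G" using assms(2) by auto
  have "word_eval G f [(a, b), (a, \<not> b)] = \<one>" using fa by (simp add: word_eval_def)
  then show ?case
    using assms(2) word_eval_closed[OF assms(2)] by (simp add: word_eval_append del: append_Cons)
next
  case (relation r s u v)
  then show ?case using assms by (simp add: word_eval_append)
qed auto

text \<open>Von Dyck's theorem.\<close>

lemma presented_group_lift:
  assumes "range f \<subseteq> carrier G"
    and "\<And>r s. (r, s) \<in> R \<Longrightarrow> word_eval G f r = word_eval G f s"
  obtains F where "F \<in> hom (presented_group R) G" "\<And>u. F (word_class R u) = word_eval G f u"
proof
  let ?F = "\<lambda>A. word_eval G f (SOME u. u \<in> A)"
  show F: "?F (word_class R u) = word_eval G f u" for u
  proof -
    have "u \<in> word_class R u" by (simp add: word_class_def word_eq.refl)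
    then have "(SOME v. v \<in> word_class R u) \<in> word_class R u" by (rule someI)
    then have "word_eq R u (SOME v. v \<in> word_class R u)" by (simp add: word_class_def)
    then show ?thesis using word_eval_cong assms by metis
  qed
  show "?F \<in> hom (presented_group R) G"
    using assms(1) by (auto simp: hom_def F word_eval_append word_eval_closed)
qed

end

section \<open>Normal forms\<close>

lemma (in group) cancel_left [simp]:
  "a \<in> carrier G \<Longrightarrow> b \<in> carrier G \<Longrightarrow> inv a \<otimes> (a \<otimes> b) = b"
  "a \<in> carrier G \<Longrightarrow> b \<in> carrier G \<Longrightarrow> a \<otimes> (inv a \<otimes> b) = b"
  by (simp_all add: m_assoc[symmetric])

lemma (in group) commute_int_pow:
  assumes "a \<otimes> b = b \<otimes> a" "a \<in> carrier G" "b \<in> carrier G"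
  shows "a \<otimes> b [^] (k::int) = b [^] k \<otimes> a"
proof -
  have "a \<otimes> b [^] n = b [^] n \<otimes> a" for n :: nat
    using assms by (induction n) (simp_all add: m_assoc[symmetric], simp add: m_assoc)
  then show ?thesis using assms
    by (cases k rule: int_cases2)
      (simp_all add: int_pow_int int_pow_neg inv_solve_left inv_solve_right m_assoc flip: m_assoc)
qed

lemma gen_eq_third: "(s::gen) \<noteq> t \<Longrightarrow> u \<noteq> t \<Longrightarrow> s = u"
  by (cases s; cases t; cases u) auto

locale knot_group =
  fixes p q :: nat and G (structure)
  assumes p2: "2 \<le> p" and q2: "2 \<le> q" and G_def: "G = Gpq p q"

sublocale knot_group \<subseteq> group G
  by (simp add: G_def Gpq_def group_presented_group)

context knot_group
begin

abbreviation cls :: "gen word \<Rightarrow> gen word set" where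
  "cls \<equiv> word_class (Gpq_rels p q)"

definition gn :: "gen \<Rightarrow> gen word set" where
  "gn t = cls [(t, True)]"

definition period :: "gen \<Rightarrow> int" where
  "period t = (case t of Gen_x \<Rightarrow> int p | Gen_y \<Rightarrow> int q)"

text \<open>The common value of \<open>x ^ p\<close> and \<open>y ^ q\<close>.\<close>

definition z :: "gen word set" where
  "z = gn Gen_x [^] period Gen_x"

lemma period_ge: "2 \<le> period t"
  using p2 q2 by (cases t) (auto simp: period_def)

lemma period_pos [simp]: "0 < period t" "period t \<noteq> 0"
  using period_ge[of t] by auto

lemma carrier_cls: "carrier G = range cls"
  and one_cls: "\<one> = cls []"
  and mult_cls: "cls u \<otimes> cls v = cls (u @ v)"
  by (simp_all add: G_def Gpq_def)

lemma gn_closed [simp]: "gn t \<in> carrier G"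
  by (simp add: gn_def carrier_cls)

lemma z_closed [simp]: "z \<in> carrier G"
  by (simp add: z_def)

lemma cls_Cons: "cls ((t, b) # u) = (if b then gn t else inv (gn t)) \<otimes> cls u"
proof -
  have "cls [(t, False)] \<otimes> gn t = \<one>"
    using word_eq_inv_word[of "Gpq_rels p q" "[(t, True)]"]
    by (simp add: gn_def mult_cls one_cls word_class_eq_iff inv_word_def)
  then have "inv (gn t) = cls [(t, False)]"
    by (rule inv_equality) (simp_all add: carrier_cls gn_def)
  then show ?thesis by (simp add: gn_def mult_cls)
qed

lemma cls_replicate: "cls (replicate n (t, True)) = gn t [^] n"
proof (induction n)
  case (Suc n)
  have "gn t \<otimes> gn t [^] n = gn t [^] Suc n" by (metis gn_closed nat_pow_Suc2)
  then show ?case using Suc by (simp add: cls_Cons)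
qed (simp add: one_cls)

lemma gn_pow_period: "gn t [^] period t = z"
proof -
  have "cls (replicate p (Gen_x, True)) = cls (replicate q (Gen_y, True))"
    using word_eq.relation[of _ _ "Gpq_rels p q" "[]" "[]"]
    by (auto simp: word_class_eq_iff Gpq_rels_def)
  then show ?thesis by (cases t) (simp_all add: z_def period_def cls_replicate int_pow_int)
qed

lemma G_induct [consumes 1, case_names one gn inv]:
  assumes "g \<in> carrier G" "P \<one>"
    and "\<And>t h. h \<in> carrier G \<Longrightarrow> P h \<Longrightarrow> P (gn t \<otimes> h)"
    and "\<And>t h. h \<in> carrier G \<Longrightarrow> P h \<Longrightarrow> P (inv (gn t) \<otimes> h)"
  shows "P g"
proof -
  have "P (cls u)" for u
  proof (induction u)
    case (Cons c u)
    obtain t b where c: "c = (t, b)" by force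
    have "cls u \<in> carrier G" by (simp add: carrier_cls)
    then show ?case using Cons assms(3,4) by (simp add: c cls_Cons)
  qed (use assms(2) in \<open>simp add: one_cls\<close>)
  then show ?thesis using assms(1) by (auto simp: carrier_cls)
qed

lemma z_commute: "g \<in> carrier G \<Longrightarrow> z \<otimes> g = g \<otimes> z"
proof (induction g rule: G_induct)
  case (gn t h)
  have "gn t \<otimes> z = z \<otimes> gn t"
    unfolding gn_pow_period[of t, symmetric] by (rule commute_int_pow) simp_all
  then show ?case using gn by (metis gn_closed m_assoc z_closed)
next
  case (inv t h)
  have "gn t \<otimes> z = z \<otimes> gn t"
    unfolding gn_pow_period[of t, symmetric] by (rule commute_int_pow) simp_all
  then have "inv (gn t) \<otimes> z = z \<otimes> inv (gn t)"
    by (metis cancel_left(1) gn_closed inv_closed inv_solve_right m_assoc m_closed z_closed)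
  then show ?case using inv by (metis gn_closed inv_closed m_assoc z_closed)
qed simp

lemma zpow_commute: "g \<in> carrier G \<Longrightarrow> z [^] (m::int) \<otimes> g = g \<otimes> z [^] m"
  by (rule commute_int_pow[symmetric]) (simp_all add: z_commute)

lemma zpow_left_commute:
  "g \<in> carrier G \<Longrightarrow> h \<in> carrier G \<Longrightarrow> g \<otimes> (z [^] (m::int) \<otimes> h) = z [^] m \<otimes> (g \<otimes> h)"
  by (metis int_pow_closed m_assoc z_closed zpow_commute)

lemma gn_pow_mod: "gn t [^] (e mod period t) = z [^] (- (e div period t)) \<otimes> gn t [^] e"
proof -
  have "gn t [^] e = gn t [^] (period t * (e div period t) + e mod period t)" by simp
  also have "\<dots> = z [^] (e div period t) \<otimes> gn t [^] (e mod period t)"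
    by (simp only: int_pow_mult gn_closed flip: gn_pow_period[of t]) (simp add: int_pow_pow)
  finally show ?thesis by (simp add: int_pow_neg)
qed

text \<open>
  Normal forms are obtained by van der Waerden's method, which avoids any confluence argument.  A pair
  \<open>(m, l)\<close> with a reduced list \<open>l\<close> stands for \<open>z ^ m\<close> times the product of the syllables of \<open>l\<close>.
  Below, \<open>act t e\<close> is what left multiplication by the \<open>e\<close>-th power of a generator does to such pairs:
  the exponent is added to that of the leading syllable (which is \<open>0\<close> if that syllable has the other
  type), reduced modulo the period, and the quotient goes into the power of \<open>z\<close>.  Since these maps
  satisfy the defining relation, every group element acts, and its value at \<open>(0, [])\<close> is its normal
  form.\<close>

fun red :: "(gen \<times> int) list \<Rightarrow> bool" where
  "red [] \<longleftrightarrow> True"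
| "red ((t, k) # l) \<longleftrightarrow> 0 < k \<and> k < period t \<and> red l \<and> (l \<noteq> [] \<longrightarrow> fst (hd l) \<noteq> t)"

definition push :: "gen \<Rightarrow> int \<Rightarrow> (gen \<times> int) list \<Rightarrow> (gen \<times> int) list" where
  "push t k l = (if k = 0 then l else (t, k) # l)"

definition avoids :: "gen \<Rightarrow> (gen \<times> int) list \<Rightarrow> bool" where
  "avoids t l \<longleftrightarrow> red l \<and> (l \<noteq> [] \<longrightarrow> fst (hd l) \<noteq> t)"

fun peel :: "gen \<Rightarrow> (gen \<times> int) list \<Rightarrow> int \<times> (gen \<times> int) list" where
  "peel t [] = (0, [])"
| "peel t ((t', k) # l) = (if t' = t then (k, l) else (0, (t', k) # l))"

definition act :: "gen \<Rightarrow> int \<Rightarrow> int \<times> (gen \<times> int) list \<Rightarrow> int \<times> (gen \<times> int) list" where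
  "act t e s = (fst s + (fst (peel t (snd s)) + e) div period t,
                push t ((fst (peel t (snd s)) + e) mod period t) (snd (peel t (snd s))))"

text \<open>
  A case distinction on whether the leading syllable has type \<open>t\<close> is avoided by always splitting off
  a syllable of type \<open>t\<close>, with exponent \<open>0\<close> if there is none.\<close>

lemma red_cases:
  assumes "red l"
  obtains k l' where "l = push t k l'" "0 \<le> k" "k < period t" "avoids t l'"
proof (cases l)
  case Nil
  show ?thesis by (rule that[of 0 "[]"]) (auto simp: push_def avoids_def Nil)
next
  case (Cons c l')
  obtain t' k where c: "c = (t', k)" by force
  show ?thesis
  proof (cases "t' = t")
    case True
    show ?thesis by (rule that[of k l']) (use assms in \<open>auto simp: push_def avoids_def Cons c True\<close>)
  next
    case False
    show ?thesis by (rule that[of 0 l]) (use assms False in \<open>auto simp: push_def avoids_def Cons c\<close>)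
  qed
qed

lemma peel_push: "avoids t l \<Longrightarrow> peel t (push t k l) = (k, l)"
  by (cases l) (auto simp: push_def avoids_def)

lemma act_push:
  "avoids t l \<Longrightarrow> act t e (m, push t k l) = (m + (k + e) div period t, push t ((k + e) mod period t) l)"
  by (simp add: act_def peel_push)

lemma red_push: "avoids t l \<Longrightarrow> 0 \<le> k \<Longrightarrow> k < period t \<Longrightarrow> red (push t k l)"
  by (auto simp: push_def avoids_def)

lemma red_act: "red (snd s) \<Longrightarrow> red (snd (act t e s))"
  by (rule red_cases[of "snd s" t]) (auto simp: act_def peel_push intro!: red_push)

lemma act_act: "red (snd s) \<Longrightarrow> act t e (act t f s) = act t (e + f) s"
proof -
  assume "red (snd s)"
  then obtain k l where kl: "snd s = push t k l" "0 \<le> k" "k < period t" "avoids t l"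
    by (rule red_cases)
  define m where "m = fst s"
  have s: "s = (m, push t k l)" using kl by (simp add: m_def prod_eq_iff)
  have "(k + f) div period t + ((k + f) mod period t + e) div period t
      = (((k + f) mod period t + e) + (k + f) div period t * period t) div period t"
    by (subst div_mult_self1) simp_all
  also have "((k + f) mod period t + e) + (k + f) div period t * period t = k + f + e"
    using div_mult_mod_eq[of "k + f" "period t"] by linarith
  finally have "(k + f) div period t + ((k + f) mod period t + e) div period t = (k + f + e) div period t" .
  moreover have "k + (e + f) = k + f + e" by simp
  ultimately show ?thesis
    by (simp only: s act_push[OF kl(4)] add.assoc[of m] mod_add_left_eq)
qed

lemma act_0: "red (snd s) \<Longrightarrow> act t 0 s = s"
proof -
  assume "red (snd s)"
  then obtain k l where kl: "snd s = push t k l" "0 \<le> k" "k < period t" "avoids t l"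
    by (rule red_cases)
  define m where "m = fst s"
  have s: "s = (m, push t k l)" using kl by (simp add: m_def prod_eq_iff)
  show ?thesis by (simp add: s act_push kl)
qed

lemma act_period: "red (snd s) \<Longrightarrow> act t (period t) s = (fst s + 1, snd s)"
proof -
  assume "red (snd s)"
  then obtain k l where kl: "snd s = push t k l" "0 \<le> k" "k < period t" "avoids t l"
    by (rule red_cases)
  define m where "m = fst s"
  have s: "s = (m, push t k l)" using kl by (simp add: m_def prod_eq_iff)
  show ?thesis by (simp add: s act_push kl)
qed

definition act_word :: "gen word \<Rightarrow> int \<times> (gen \<times> int) list \<Rightarrow> int \<times> (gen \<times> int) list" where
  "act_word u s = foldr (\<lambda>(t, b). act t (if b then 1 else -1)) u s"

lemma act_word_simps [simp]:
  "act_word [] s = s"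
  "act_word ((t, b) # u) s = act t (if b then 1 else -1) (act_word u s)"
  "act_word (u @ v) s = act_word u (act_word v s)"
  by (simp_all add: act_word_def)

lemma red_act_word: "red (snd s) \<Longrightarrow> red (snd (act_word u s))"
  by (induction u) (auto simp: act_word_def red_act)

lemma act_word_replicate:
  "red (snd s) \<Longrightarrow> act_word (replicate n (t, True)) s = act t (int n) s"
  by (induction n) (simp_all add: act_0 act_act add.commute)

lemma act_word_cong:
  "word_eq (Gpq_rels p q) u v \<Longrightarrow> red (snd s) \<Longrightarrow> act_word u s = act_word v s"
proof (induction arbitrary: s rule: word_eq.induct)
  case (cancel u a b v)
  have "red (snd (act_word v s))" using cancel by (rule red_act_word)
  then show ?case by (simp add: act_act act_0)
next
  case (relation r s' u v)
  have "red (snd (act_word v s))" using relation by (auto intro: red_act_word)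
  then show ?case
    using relation act_period[of _ Gen_x] act_period[of _ Gen_y]
    by (auto simp: Gpq_rels_def act_word_replicate period_def)
qed auto

text \<open>By the invariance just shown, the value does not depend on the representative chosen.\<close>

definition nfz :: "gen word set \<Rightarrow> int \<times> (gen \<times> int) list" where
  "nfz g = act_word (SOME u. u \<in> g) (0, [])"

lemma nfz_cls: "nfz (cls u) = act_word u (0, [])"
proof -
  have "u \<in> cls u" by (simp add: word_class_def word_eq.refl)
  then have "(SOME v. v \<in> cls u) \<in> cls u" by (rule someI)
  then have "word_eq (Gpq_rels p q) u (SOME v. v \<in> cls u)" by (simp add: word_class_def)
  then show ?thesis using act_word_cong[of u] by (simp add: nfz_def)
qed

lemma red_nfz: "g \<in> carrier G \<Longrightarrow> red (snd (nfz g))"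
  by (auto simp: carrier_cls nfz_cls intro!: red_act_word)

lemma nfz_gn: "g \<in> carrier G \<Longrightarrow> nfz (gn t \<otimes> g) = act t 1 (nfz g)"
  by (auto simp: carrier_cls gn_def mult_cls nfz_cls)

lemma nfz_inv_gn: "g \<in> carrier G \<Longrightarrow> nfz (inv (gn t) \<otimes> g) = act t (-1) (nfz g)"
  using act_act[of "nfz (inv (gn t) \<otimes> g)" t "-1" 1] nfz_gn[of "inv (gn t) \<otimes> g" t]
  by (simp add: red_nfz act_0)

lemma nfz_gn_pow: "g \<in> carrier G \<Longrightarrow> nfz (gn t [^] (e::int) \<otimes> g) = act t e (nfz g)"
proof (induction e rule: int_induct[where k = 0])
  case base
  then show ?case by (simp add: act_0 red_nfz)
next
  case (step1 i)
  have "gn t [^] (i + 1) = gn t \<otimes> gn t [^] i"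
    by (simp add: int_pow_mult commute_int_pow)
  then have "nfz (gn t [^] (i + 1) \<otimes> g) = act t 1 (nfz (gn t [^] i \<otimes> g))"
    using step1 by (simp add: m_assoc nfz_gn)
  then show ?case using step1 by (simp add: act_act red_nfz add.commute)
next
  case (step2 i)
  have "gn t [^] (i - 1) = inv (gn t) \<otimes> gn t [^] i"
    using int_pow_mult[of "gn t" "-1" i] by (simp add: int_pow_neg)
  then have "nfz (gn t [^] (i - 1) \<otimes> g) = act t (-1) (nfz (gn t [^] i \<otimes> g))"
    using step2 by (simp add: m_assoc nfz_inv_gn)
  then show ?case using step2 by (simp add: act_act red_nfz)
qed

lemma nfz_z_pow: "g \<in> carrier G \<Longrightarrow> nfz (z [^] (m::int) \<otimes> g) = (fst (nfz g) + m, snd (nfz g))"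
proof (induction m rule: int_induct[where k = 0])
  case (step1 i)
  have "z [^] (i + 1) = gn Gen_x [^] period Gen_x \<otimes> z [^] i"
    by (simp add: int_pow_mult gn_pow_period z_commute)
  then show ?case using step1 red_nfz[of g] by (simp add: m_assoc nfz_gn_pow act_period)
next
  case (step2 i)
  have "gn Gen_x [^] period Gen_x \<otimes> z [^] (i - 1) = z [^] i"
    using int_pow_mult[of z 1 "i - 1"] by (simp add: gn_pow_period)
  then have "gn Gen_x [^] period Gen_x \<otimes> (z [^] (i - 1) \<otimes> g) = z [^] i \<otimes> g"
    using step2 by (simp add: m_assoc[symmetric])
  then have "nfz (z [^] i \<otimes> g) = act Gen_x (period Gen_x) (nfz (z [^] (i - 1) \<otimes> g))"
    using nfz_gn_pow[of "z [^] (i - 1) \<otimes> g" Gen_x "period Gen_x"] step2.prems by simp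
  also have "\<dots> = (fst (nfz (z [^] (i - 1) \<otimes> g)) + 1, snd (nfz (z [^] (i - 1) \<otimes> g)))"
    using step2 by (intro act_period red_nfz) simp
  finally show ?case using step2 by (simp add: prod_eq_iff)
qed simp

fun val :: "(gen \<times> int) list \<Rightarrow> gen word set" where
  "val [] = \<one>"
| "val ((t, k) # l) = gn t [^] k \<otimes> val l"

lemma val_closed [simp]: "val l \<in> carrier G"
  by (induction l rule: val.induct) auto

lemma val_append: "val (a @ b) = val a \<otimes> val b"
  by (induction a rule: val.induct) (auto simp: m_assoc)

definition nf :: "gen word set \<Rightarrow> (gen \<times> int) list" where
  "nf g = snd (nfz g)"

lemma red_nf: "g \<in> carrier G \<Longrightarrow> red (nf g)"
  by (simp add: nf_def red_nfz)

lemma nf_z_pow_mult: "g \<in> carrier G \<Longrightarrow> nf (z [^] (m::int) \<otimes> g) = nf g"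
  by (simp add: nf_def nfz_z_pow)

text \<open>
  Uniqueness of normal forms; \<open>nfz_decomp\<close> below is their existence.\<close>

lemma nfz_val: "red l \<Longrightarrow> nfz (val l) = (0, l)"
proof (induction l rule: val.induct)
  case 1
  then show ?case by (simp add: one_cls nfz_cls)
next
  case (2 t k l)
  then have "avoids t l" by (auto simp: avoids_def)
  then have "act t k (0, push t 0 l) = (0, (t, k) # l)"
    using 2 act_push[of t l k 0 0] by (simp add: push_def)
  then show ?case using 2 by (simp add: nfz_gn_pow push_def)
qed

lemma nf_val: "red l \<Longrightarrow> nf (val l) = l"
  by (simp add: nf_def nfz_val)

lemma val_push: "val (push t k l) = gn t [^] k \<otimes> val l"
  by (simp add: push_def)

lemma nfz_decomp: "g \<in> carrier G \<Longrightarrow> g = z [^] fst (nfz g) \<otimes> val (snd (nfz g))"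
proof -
  have *: "gn t [^] (e::int) \<otimes> (z [^] fst s \<otimes> val (snd s)) = z [^] fst (act t e s) \<otimes> val (snd (act t e s))"
    if red: "red (snd s)" for t e s
  proof -
    obtain k l where kl: "snd s = push t k l" "0 \<le> k" "k < period t" "avoids t l"
      using red by (rule red_cases)
    show ?thesis
      using kl gn_pow_mod[of t "k + e"]
      by (simp add: act_def peel_push val_push zpow_left_commute int_pow_mult int_pow_neg m_assoc
          add.commute[of k e])
  qed
  assume "g \<in> carrier G"
  then show ?thesis
  proof (induction g rule: G_induct)
    case one
    then show ?case by (simp add: one_cls[symmetric] nfz_val[of "[]", simplified])
  next
    case (gn t h)
    then show ?case
      using *[OF red_nfz[OF gn(1)], of t 1] unfolding nfz_gn[OF gn(1)] gn(2)[symmetric] by simp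
  next
    case (inv t h)
    then show ?case
      using *[OF red_nfz[OF inv(1)], of t "-1"]
      unfolding nfz_inv_gn[OF inv(1)] inv(2)[symmetric] by (simp add: int_pow_neg)
  qed
qed

lemma nf_decomp:
  assumes "g \<in> carrier G"
  obtains m :: int where "g = z [^] m \<otimes> val (nf g)"
  using nfz_decomp[OF assms] by (auto simp: nf_def)

lemma nf_zpow_val: "red l \<Longrightarrow> nf (z [^] (m::int) \<otimes> val l) = l"
  by (simp add: nf_z_pow_mult nf_val)

end

section \<open>Syllable length\<close>

context knot_group
begin

text \<open>
  Length and types ignore powers of \<open>z\<close>, so they are invariants of the image in the free product.  The
  types are meaningful for positive length only.\<close>

definition len :: "gen word set \<Rightarrow> nat" where
  "len g = length (nf g)"

definition first_type :: "gen word set \<Rightarrow> gen" where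
  "first_type g = fst (hd (nf g))"

definition last_type :: "gen word set \<Rightarrow> gen" where
  "last_type g = fst (last (nf g))"

lemma zpow_collect:
  "h \<in> carrier G \<Longrightarrow> z [^] (m::int) \<otimes> (z [^] (k::int) \<otimes> h) = z [^] (m + k) \<otimes> h"
  "val l \<otimes> z [^] m = z [^] m \<otimes> val l"
  "h \<in> carrier G \<Longrightarrow> val l \<otimes> (z [^] m \<otimes> h) = z [^] m \<otimes> (val l \<otimes> h)"
  by (simp add: int_pow_mult m_assoc, rule zpow_commute[symmetric], simp)
    (rule zpow_left_commute, simp_all)

lemma gn_collect:
  "h \<in> carrier G \<Longrightarrow> gn t [^] (i::int) \<otimes> (gn t [^] (j::int) \<otimes> h) = gn t [^] (i + j) \<otimes> h"
  "h \<in> carrier G \<Longrightarrow> gn t [^] i \<otimes> (z [^] (m::int) \<otimes> h) = z [^] m \<otimes> (gn t [^] i \<otimes> h)"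
  by (simp add: int_pow_mult m_assoc) (rule zpow_left_commute, simp_all)

lemma len_pos_iff: "0 < len g \<longleftrightarrow> nf g \<noteq> []"
  by (simp add: len_def)

lemma nf_zpow: "nf (z [^] (m::int)) = []"
  using nf_zpow_val[of "[]" m] by simp

lemma len_eq_0_iff:
  assumes "g \<in> carrier G"
  shows "len g = 0 \<longleftrightarrow> (\<exists>m::int. g = z [^] m)"
proof
  assume "len g = 0"
  moreover obtain m :: int where "g = z [^] m \<otimes> val (nf g)" using assms by (rule nf_decomp)
  ultimately show "\<exists>m::int. g = z [^] m" by (auto simp: len_def)
qed (auto simp: len_def nf_zpow)

lemma len_zpow [simp]: "len (z [^] (m::int)) = 0"
  by (simp add: len_def nf_zpow)

lemma nf_mult_zpow: "g \<in> carrier G \<Longrightarrow> nf (g \<otimes> z [^] (m::int)) = nf g"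
  by (simp add: nf_z_pow_mult flip: zpow_commute)

lemma red_append:
  "red (a @ b) \<longleftrightarrow> red a \<and> red b \<and> (a \<noteq> [] \<and> b \<noteq> [] \<longrightarrow> fst (last a) \<noteq> fst (hd b))"
  by (induction a rule: red.induct) (auto simp: hd_append)

lemma nf_mult:
  assumes "g \<in> carrier G" "h \<in> carrier G"
    and "0 < len g \<Longrightarrow> 0 < len h \<Longrightarrow> last_type g \<noteq> first_type h"
  shows "nf (g \<otimes> h) = nf g @ nf h"
proof -
  obtain m :: int where m: "g = z [^] m \<otimes> val (nf g)" using assms(1) by (rule nf_decomp)
  obtain m' :: int where m': "h = z [^] m' \<otimes> val (nf h)" using assms(2) by (rule nf_decomp)
  have "g \<otimes> h = (z [^] m \<otimes> val (nf g)) \<otimes> (z [^] m' \<otimes> val (nf h))"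
    using m m' by simp
  also have "\<dots> = z [^] (m + m') \<otimes> val (nf g @ nf h)"
    by (simp add: val_append m_assoc zpow_collect)
  finally have eq: "g \<otimes> h = z [^] (m + m') \<otimes> val (nf g @ nf h)" .
  have "red (nf g @ nf h)"
    unfolding red_append using assms red_nf by (auto simp: len_pos_iff last_type_def first_type_def)
  then show ?thesis unfolding eq by (rule nf_zpow_val)
qed

text \<open>
  This lemma and \<open>len_mult_less\<close> are the two facts about products on which all later arguments rest.\<close>

lemma len_mult:
  assumes "g \<in> carrier G" "h \<in> carrier G" "0 < len g" "0 < len h" "last_type g \<noteq> first_type h"
  shows "len (g \<otimes> h) = len g + len h" "first_type (g \<otimes> h) = first_type g" "last_type (g \<otimes> h) = last_type h"
proof -
  have "nf (g \<otimes> h) = nf g @ nf h"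
    using assms(1,2) by (rule nf_mult) (use assms(5) in blast)
  moreover have "nf g \<noteq> []" "nf h \<noteq> []"
    using assms(3,4) by (auto simp: len_def)
  ultimately show "len (g \<otimes> h) = len g + len h" "first_type (g \<otimes> h) = first_type g" "last_type (g \<otimes> h) = last_type h"
    by (simp_all add: len_def first_type_def last_type_def)
qed

lemma nf_gn_pow: "nf (gn t [^] (e::int)) = push t (e mod period t) []"
proof -
  have "nf (gn t [^] e) = snd (act t e (nfz \<one>))"
    using nfz_gn_pow[of \<one> t e] by (simp add: nf_def)
  also have "nfz \<one> = (0, [])" using nfz_val[of "[]"] by simp
  finally show ?thesis by (simp add: act_def)
qed

lemma len_gn_pow_mult_le: "h \<in> carrier G \<Longrightarrow> len (gn t [^] (e::int) \<otimes> h) \<le> Suc (len h)"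
proof -
  have "length (snd (peel t l)) \<le> length l" for l
    by (induction t l rule: peel.induct) auto
  then show "h \<in> carrier G \<Longrightarrow> ?thesis"
    by (auto simp: len_def nf_def nfz_gn_pow act_def push_def intro: le_SucI)
qed

lemma len_zpow_mult [simp]: "g \<in> carrier G \<Longrightarrow> len (z [^] (m::int) \<otimes> g) = len g"
  by (simp add: len_def nf_z_pow_mult)

lemma len_val_mult_le: "h \<in> carrier G \<Longrightarrow> len (val l \<otimes> h) \<le> length l + len h"
proof (induction l rule: val.induct)
  case (2 t k l)
  have "len (gn t [^] k \<otimes> (val l \<otimes> h)) \<le> Suc (len (val l \<otimes> h))"
    using 2 by (intro len_gn_pow_mult_le) simp
  then show ?case using 2 by (simp add: m_assoc)
qed simp

lemma len_val_le: "len (val l) \<le> length l"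
  using len_val_mult_le[of \<one> l] len_zpow[of 0] by simp

lemma len_mult_le:
  assumes "g \<in> carrier G" "h \<in> carrier G"
  shows "len (g \<otimes> h) \<le> len g + len h"
proof -
  obtain m :: int where m: "g = z [^] m \<otimes> val (nf g)" using assms(1) by (rule nf_decomp)
  have "len (z [^] m \<otimes> val (nf g) \<otimes> h) \<le> len g + len h"
    using len_val_mult_le[of h "nf g"] assms by (simp add: m_assoc len_def[of g])
  then show ?thesis using m by simp
qed

text \<open>
  Two syllables of the same type that meet merge into one or cancel.\<close>

lemma len_mult_less:
  assumes "g \<in> carrier G" "h \<in> carrier G" "0 < len g" "0 < len h" "last_type g = first_type h"
  shows "len (g \<otimes> h) < len g + len h"
proof -
  define t where "t = first_type h"
  obtain a i where a: "nf g = a @ [(t, i)]"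
    using assms by (metis append_butlast_last_id len_pos_iff last_type_def prod.collapse t_def)
  obtain b j where b: "nf h = (t, j) # b"
    using assms by (metis first_type_def hd_Cons_tl len_pos_iff prod.collapse t_def)
  obtain m :: int where m: "g = z [^] m \<otimes> val (nf g)" using assms(1) by (rule nf_decomp)
  obtain m' :: int where m': "h = z [^] m' \<otimes> val (nf h)" using assms(2) by (rule nf_decomp)
  have "g \<otimes> h = (z [^] m \<otimes> val (nf g)) \<otimes> (z [^] m' \<otimes> val (nf h))"
    using m m' by simp
  also have "\<dots> = z [^] (m + m') \<otimes> val (a @ (t, i + j) # b)"
    by (simp add: a b val_append m_assoc zpow_collect gn_collect)
  finally have eq: "g \<otimes> h = z [^] (m + m') \<otimes> val (a @ (t, i + j) # b)" .
  have "len (g \<otimes> h) \<le> length (a @ (t, i + j) # b)"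
    unfolding eq len_zpow_mult[OF val_closed] by (rule len_val_le)
  also have "\<dots> < length (nf g) + length (nf h)" by (simp add: a b)
  finally show ?thesis by (simp add: len_def)
qed

definition flip_exps :: "(gen \<times> int) list \<Rightarrow> (gen \<times> int) list" where
  "flip_exps l = map (\<lambda>(t, k). (t, period t - k)) l"

lemma flip_exps_simps [simp]:
  "flip_exps [] = []" "flip_exps ((t, k) # l) = (t, period t - k) # flip_exps l"
  "length (flip_exps l) = length l" "flip_exps l = [] \<longleftrightarrow> l = []"
  "l \<noteq> [] \<Longrightarrow> fst (hd (flip_exps l)) = fst (hd l)"
  "l \<noteq> [] \<Longrightarrow> fst (last (flip_exps l)) = fst (last l)"
  by (auto simp: flip_exps_def hd_map last_map split: prod.split)

lemma red_flip_exps: "red l \<Longrightarrow> red (flip_exps l)"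
  by (induction l rule: red.induct) auto

lemma red_rev: "red l \<Longrightarrow> red (rev l)"
  by (induction l rule: red.induct) (auto simp: red_append last_rev)

lemma gn_pow_minus: "gn t [^] (- k) = inv z \<otimes> gn t [^] (period t - k)"
proof -
  have "gn t [^] (period t + (- k)) = z \<otimes> gn t [^] (- k)"
    by (simp only: int_pow_mult gn_closed gn_pow_period)
  then show ?thesis by simp
qed

lemma inv_val: "inv (val l) = z [^] (- int (length l)) \<otimes> val (rev (flip_exps l))"
proof (induction l rule: val.induct)
  case (2 t k l)
  have "inv (val ((t, k) # l)) = inv (val l) \<otimes> gn t [^] (- k)"
    by (simp add: inv_mult_group int_pow_neg)
  also have "\<dots> = (z [^] (- int (length l)) \<otimes> val (rev (flip_exps l))) \<otimes> (z [^] (-1::int) \<otimes> gn t [^] (period t - k))"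
    using 2 by (simp add: gn_pow_minus int_pow_neg[of z 1])
  also have "\<dots> = z [^] (- int (length l) + (-1)) \<otimes> val (rev (flip_exps l) @ [(t, period t - k)])"
    by (simp add: val_append m_assoc zpow_collect)
  also have "- int (length l) + (-1) = - int (length ((t, k) # l))" by simp
  finally show ?case by (simp only: flip_exps_simps rev.simps)
qed simp

lemma nf_inv:
  assumes "g \<in> carrier G"
  shows "nf (inv g) = rev (flip_exps (nf g))"
proof -
  obtain m :: int where m: "g = z [^] m \<otimes> val (nf g)" using assms(1) by (rule nf_decomp)
  have "inv (z [^] m \<otimes> val (nf g)) = inv (val (nf g)) \<otimes> z [^] (- m)"
    by (simp add: inv_mult_group int_pow_neg)
  also have "\<dots> = z [^] (- int (len g) + - m) \<otimes> val (rev (flip_exps (nf g)))"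
    by (simp add: inv_val len_def m_assoc zpow_collect)
  finally have eq: "inv g = z [^] (- int (len g) + - m) \<otimes> val (rev (flip_exps (nf g)))"
    using m by simp
  have "red (rev (flip_exps (nf g)))" by (intro red_rev red_flip_exps red_nf assms)
  then show ?thesis unfolding eq by (rule nf_zpow_val)
qed

lemma len_inv [simp]: "g \<in> carrier G \<Longrightarrow> len (inv g) = len g"
  by (simp add: len_def nf_inv)

lemma first_type_inv: "g \<in> carrier G \<Longrightarrow> 0 < len g \<Longrightarrow> first_type (inv g) = last_type g"
  by (simp add: len_pos_iff nf_inv first_type_def last_type_def hd_rev)

lemma last_type_inv: "g \<in> carrier G \<Longrightarrow> 0 < len g \<Longrightarrow> last_type (inv g) = first_type g"
  by (simp add: len_pos_iff nf_inv first_type_def last_type_def last_rev)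

lemma red_odd_iff: "red l \<Longrightarrow> l \<noteq> [] \<Longrightarrow> odd (length l) \<longleftrightarrow> fst (hd l) = fst (last l)"
proof (induction l rule: red.induct)
  case (2 t k l)
  show ?case
  proof (cases "l = []")
    case False
    then have "odd (length l) \<longleftrightarrow> fst (hd l) = fst (last l)" "fst (hd l) \<noteq> t"
      using 2 by auto
    then show ?thesis using False gen_eq_third[of "fst (hd l)" t "fst (last l)"] by auto
  qed simp
qed simp

lemma odd_len_iff: "g \<in> carrier G \<Longrightarrow> 0 < len g \<Longrightarrow> odd (len g) \<longleftrightarrow> first_type g = last_type g"
  using red_odd_iff[of "nf g"] red_nf by (simp add: len_def first_type_def last_type_def)

lemma len_mult_cong:
  assumes "g \<in> carrier G"
  shows "len (z [^] (m::int) \<otimes> g) = len g" "first_type (z [^] m \<otimes> g) = first_type g" "last_type (z [^] m \<otimes> g) = last_type g"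
    "len (g \<otimes> z [^] m) = len g" "first_type (g \<otimes> z [^] m) = first_type g" "last_type (g \<otimes> z [^] m) = last_type g"
  using assms by (simp_all add: len_def first_type_def last_type_def nf_z_pow_mult nf_mult_zpow)

text \<open>
  The odd element begins and ends with one type, the even one has different types at its ends.  So
  lengths add in exactly one of the two products.\<close>

lemma odd_even_not_commute:
  assumes "v \<in> carrier G" "w \<in> carrier G" "odd (len v)" "even (len w)" "0 < len w"
  shows "v \<otimes> w \<noteq> w \<otimes> v"
proof -
  have v: "0 < len v" using assms(3) by (rule odd_pos)
  have "first_type v = last_type v" "first_type w \<noteq> last_type w"
    using odd_len_iff assms v by auto
  then consider "last_type w \<noteq> first_type v" "last_type v = first_type w" | "last_type w = first_type v" "last_type v \<noteq> first_type w"
    using gen_eq_third[of "first_type w" "last_type w" "first_type v"] by metis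
  then show ?thesis
  proof cases
    case 1
    then have "len (w \<otimes> v) = len w + len v" "len (v \<otimes> w) < len v + len w"
      using assms v by (auto intro: len_mult len_mult_less)
    then show ?thesis by auto
  next
    case 2
    then have "len (v \<otimes> w) = len v + len w" "len (w \<otimes> v) < len w + len v"
      using assms v by (auto intro: len_mult len_mult_less)
    then show ?thesis by auto
  qed
qed

definition cyc_red :: "gen word set \<Rightarrow> bool" where
  "cyc_red g \<longleftrightarrow> g \<in> carrier G \<and> even (len g) \<and> 0 < len g"

lemma cyc_redD: "cyc_red g \<Longrightarrow> g \<in> carrier G" "cyc_red g \<Longrightarrow> 0 < len g"
    "cyc_red g \<Longrightarrow> first_type g \<noteq> last_type g"
  using odd_len_iff by (auto simp: cyc_red_def)

lemma cyc_red_nat_pow: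
  assumes "cyc_red g"
  shows "len (g [^] n) = n * len g \<and> (0 < n \<longrightarrow> first_type (g [^] n) = first_type g \<and> last_type (g [^] n) = last_type g)"
proof (induction n)
  case 0
  then show ?case using len_zpow[of 0] by simp
next
  case (Suc n)
  note [simp] = cyc_redD[OF assms]
  show ?case
  proof (cases "n = 0")
    case False
    then have "0 < len (g [^] n)" using Suc by simp
    then show ?thesis
      using Suc False cyc_redD(3)[OF assms, symmetric] len_mult[of "g [^] n" g] by simp
  qed simp
qed

lemma cyc_red_inv: "cyc_red g \<Longrightarrow> cyc_red (inv g)"
  by (simp add: cyc_red_def)

lemma len_int_pow:
  assumes "cyc_red g"
  shows "len (g [^] (k::int)) = nat \<bar>k\<bar> * len g"
proof (cases k rule: int_cases2)
  case (nonneg n)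
  then show ?thesis using cyc_red_nat_pow[OF assms] by (simp add: int_pow_int)
next
  case (nonpos n)
  then show ?thesis
    using cyc_red_nat_pow[OF assms] cyc_redD[OF assms] by (simp add: int_pow_int int_pow_neg)
qed

lemma cyc_red_int_pow: "cyc_red g \<Longrightarrow> k \<noteq> 0 \<Longrightarrow> cyc_red (g [^] (k::int))"
  by (simp add: cyc_red_def len_int_pow)

text \<open>
  A cyclically reduced element translates its axis through the edge of \<open>\<one>\<close>; the type of its first
  syllable tells in which of the two directions.\<close>

definition signed_len :: "gen word set \<Rightarrow> int" where
  "signed_len g = (if len g = 0 then 0 else if first_type g = Gen_x then int (len g) else - int (len g))"

text \<open>
  If nothing merges, both factors point in the same direction and lengths add.  Otherwise they point in
  opposite directions, and one of the factors is the product, without merging, of the inverse of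
  the other one with \<open>v \<otimes> u\<close>.\<close>

lemma signed_len_mult:
  assumes "v \<in> carrier G" "u \<in> carrier G" "even (len v)" "even (len u)" "even (len (v \<otimes> u))"
  shows "signed_len (v \<otimes> u) = signed_len v + signed_len u"
proof -
  consider "len v = 0" | "len u = 0" | "0 < len v" "0 < len u" by auto
  then show ?thesis
  proof cases
    case 1
    then obtain m :: int where m: "v = z [^] m" using len_eq_0_iff assms by blast
    show ?thesis using assms by (simp add: m signed_len_def len_mult_cong)
  next
    case 2
    then obtain m :: int where m: "u = z [^] m" using len_eq_0_iff assms by blast
    show ?thesis using assms by (simp add: m signed_len_def len_mult_cong)
  next
    case 3
    then have vu: "first_type v \<noteq> last_type v" "first_type u \<noteq> last_type u" using assms odd_len_iff by auto
    show ?thesis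
    proof (cases "last_type v = first_type u")
      case False
      then have "first_type v = first_type u" using vu gen_eq_third by metis
      then show ?thesis using len_mult[of v u] False assms 3 by (auto simp: signed_len_def)
    next
      case True
      then have ne: "first_type v \<noteq> first_type u" using vu by simp
      let ?w = "v \<otimes> u"
      have v: "v = ?w \<otimes> inv u" and u: "u = inv v \<otimes> ?w" using assms by (simp_all add: m_assoc)
      show ?thesis
      proof (cases "len ?w = 0")
        case True
        then obtain m :: int where m: "?w = z [^] m" using len_eq_0_iff assms by blast
        have "len v = len u"
          using arg_cong[OF v, of len] assms by (simp only: m) (simp add: len_mult_cong)
        then show ?thesis using True ne by (cases "first_type v"; cases "first_type u") (auto simp: signed_len_def)
      next
        case False
        then have w: "0 < len ?w" "first_type ?w \<noteq> last_type ?w" using assms odd_len_iff[of ?w] by auto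
        show ?thesis
        proof (cases "first_type ?w = first_type v")
          case T: True
          have "last_type u = first_type v" using ne vu gen_eq_third by metis
          then have "len (?w \<otimes> inv u) = len ?w + len (inv u)"
            using w 3 assms T by (intro len_mult) (auto simp: first_type_inv)
          then have "len v = len ?w + len u" using v assms by simp
          then show ?thesis
            using w 3 T ne by (cases "first_type v"; cases "first_type u") (auto simp: signed_len_def)
        next
          case F: False
          have "len (inv v \<otimes> ?w) = len (inv v) + len ?w"
            using w 3 assms F by (intro len_mult) (auto simp: last_type_inv)
          then have "len u = len v + len ?w" using u assms by simp
          then show ?thesis
            using w 3 F ne by (cases "first_type v"; cases "first_type u"; cases "first_type ?w") (auto simp: signed_len_def)
        qed
      qed
    qed
  qed
qed

lemma signed_len_eq_0_iff: "signed_len g = 0 \<longleftrightarrow> len g = 0"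
  by (simp add: signed_len_def)

end

section \<open>Conjugation and the centre\<close>

text \<open>
  The values of \<open>s\<close> form a subgroup of the integers; \<open>c\<close> is an element with the least positive value,
  or the identity if \<open>s\<close> vanishes.\<close>

lemma (in group) subgroup_int_hom_generator:
  fixes s :: "'a \<Rightarrow> int"
  assumes H: "subgroup H G" and s: "\<And>a b. a \<in> H \<Longrightarrow> b \<in> H \<Longrightarrow> s (a \<otimes> b) = s a + s b"
  obtains c where "c \<in> H" "\<And>i::int. s (c [^] i) = i * s c" "\<And>a. a \<in> H \<Longrightarrow> s c dvd s a"
proof -
  interpret H: group "G\<lparr>carrier := H\<rparr>" using H by (rule subgroup.subgroup_is_group) (rule is_group)
  have "s \<in> hom (G\<lparr>carrier := H\<rparr>) integer_group" using s by (simp add: hom_def)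
  then interpret s: group_hom "G\<lparr>carrier := H\<rparr>" integer_group s
    by (simp add: group_hom_def group_hom_axioms_def H.is_group)
  have pow: "s (c [^] i) = i * s c" if "c \<in> H" for c and i :: int
    using s.hom_int_pow[of c i] that int_pow_consistent[OF H that] by simp
  show ?thesis
  proof (cases "\<exists>a\<in>H. s a \<noteq> 0")
    case False
    then show ?thesis using that[of \<one>] subgroup.one_closed[OF H] pow by auto
  next
    case True
    then obtain a where a: "a \<in> H" "s a \<noteq> 0" by blast
    have "\<exists>n. 0 < n \<and> (\<exists>b\<in>H. s b = int n)"
    proof (cases "0 < s a")
      case True
      then show ?thesis using a by (intro exI[of _ "nat (s a)"]) auto
    next
      case False
      have "inv a \<in> H" "s (inv a) = - s a"
        using a pow[OF a(1), of "-1"] subgroup.m_inv_closed[OF H] subgroup.mem_carrier[OF H]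
        by (auto simp: int_pow_neg)
      then show ?thesis using a False by (intro exI[of _ "nat (- s a)"]) auto
    qed
    define n where "n = (LEAST n. 0 < n \<and> (\<exists>b\<in>H. s b = int n))"
    have n: "0 < n \<and> (\<exists>b\<in>H. s b = int n)"
      unfolding n_def by (rule LeastI_ex) fact
    then obtain c where c: "c \<in> H" "s c = int n" by blast
    have "s c dvd s b" if b: "b \<in> H" for b
    proof -
      have cp: "c [^] (- (s b div int n)) \<in> H" using H c(1) by (rule subgroup_int_pow_closed)
      have "s (b \<otimes> c [^] (- (s b div int n))) = s b mod int n"
        using s[OF b cp] by (simp add: pow c minus_div_mult_eq_mod)
      moreover have "b \<otimes> c [^] (- (s b div int n)) \<in> H"
        using subgroup.m_closed[OF H b cp] .
      moreover have "s b mod int n < int n" "0 \<le> s b mod int n" using n by auto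
      moreover have "n \<le> k" if "0 < k" "\<exists>b\<in>H. s b = int k" for k
        unfolding n_def using that by (intro Least_le) blast
      ultimately have "\<not> 0 < nat (s b mod int n)"
        by (metis leD nat_0_le nat_less_iff zless_nat_eq_int_zless)
      then show ?thesis using \<open>0 \<le> s b mod int n\<close> by (auto simp: c)
    qed
    then show ?thesis using that[of c] c pow by blast
  qed
qed

context group
begin

text \<open>
  Conjugation in this direction fits the tree: translation by \<open>u\<close> turns the action of \<open>conj_by u g\<close> near
  the edge of \<open>\<one>\<close> into that of \<open>g\<close> near the edge of \<open>u\<close>.\<close>

definition conj_by :: "'a \<Rightarrow> 'a \<Rightarrow> 'a" where
  "conj_by u g = inv u \<otimes> g \<otimes> u"

lemma conj_by_closed [simp]: "u \<in> carrier G \<Longrightarrow> g \<in> carrier G \<Longrightarrow> conj_by u g \<in> carrier G"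
  by (simp add: conj_by_def)

lemma conj_by_mult: "u \<in> carrier G \<Longrightarrow> g \<in> carrier G \<Longrightarrow> h \<in> carrier G \<Longrightarrow> conj_by u (g \<otimes> h) = conj_by u g \<otimes> conj_by u h"
  by (simp add: conj_by_def m_assoc)

lemma conj_by_inv: "u \<in> carrier G \<Longrightarrow> g \<in> carrier G \<Longrightarrow> conj_by u (inv g) = inv (conj_by u g)"
  by (simp add: conj_by_def m_assoc inv_mult_group)

lemma conj_by_nat_pow: "u \<in> carrier G \<Longrightarrow> g \<in> carrier G \<Longrightarrow> conj_by u (g [^] (n::nat)) = conj_by u g [^] n"
  by (induction n) (simp add: conj_by_def, simp add: conj_by_mult)

lemma conj_by_int_pow: "u \<in> carrier G \<Longrightarrow> g \<in> carrier G \<Longrightarrow> conj_by u (g [^] (n::int)) = conj_by u g [^] n"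
  by (cases n rule: int_cases2) (auto simp: conj_by_nat_pow int_pow_int int_pow_neg conj_by_inv)

lemma conj_by_conj_by: "u \<in> carrier G \<Longrightarrow> v \<in> carrier G \<Longrightarrow> g \<in> carrier G \<Longrightarrow> conj_by u (conj_by v g) = conj_by (v \<otimes> u) g"
  by (simp add: conj_by_def m_assoc inv_mult_group)

lemma conj_by_one [simp]: "g \<in> carrier G \<Longrightarrow> conj_by \<one> g = g"
  by (simp add: conj_by_def)

lemma conj_by_commute_iff:
  assumes "u \<in> carrier G" "g \<in> carrier G" "h \<in> carrier G"
  shows "conj_by u g \<otimes> conj_by u h = conj_by u h \<otimes> conj_by u g \<longleftrightarrow> g \<otimes> h = h \<otimes> g"
proof -
  have "conj_by u a = conj_by u b \<longleftrightarrow> a = b" if "a \<in> carrier G" "b \<in> carrier G" for a b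
    using assms that by (simp add: conj_by_def)
  then show ?thesis using assms by (simp flip: conj_by_mult)
qed

definition cent :: "'a \<Rightarrow> 'a set" where
  "cent g = {a \<in> carrier G. a \<otimes> g = g \<otimes> a}"

lemma subgroup_cent:
  assumes g: "g \<in> carrier G"
  shows "subgroup (cent g) G"
proof (rule subgroupI)
  show "cent g \<noteq> {}" using g by (auto simp: cent_def)
next
  fix a assume "a \<in> cent g"
  then have a: "a \<in> carrier G" "a \<otimes> g = g \<otimes> a" by (auto simp: cent_def)
  then have "inv a \<otimes> (a \<otimes> g) \<otimes> inv a = inv a \<otimes> (g \<otimes> a) \<otimes> inv a" by simp
  then show "inv a \<in> cent g" using a(1) g by (simp add: cent_def m_assoc)
next
  fix a b assume "a \<in> cent g" "b \<in> cent g"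
  then show "a \<otimes> b \<in> cent g" using g by (simp add: cent_def m_assoc) (simp flip: m_assoc)
qed (auto simp: cent_def)

end

context knot_group
begin

text \<open>
  The abelianization, up to torsion.  It sees the powers of \<open>z\<close>, to which lengths are blind.\<close>

definition deg :: "gen word set \<Rightarrow> int" where
  "deg = (SOME F. F \<in> hom G integer_group \<and> (\<forall>t. F (gn t) * period t = int p * int q))"

lemma deg_hom: "deg \<in> hom G integer_group" and deg_gn: "deg (gn t) * period t = int p * int q"
proof -
  define f where "f t = (case t of Gen_x \<Rightarrow> int q | Gen_y \<Rightarrow> int p)" for t
  have ev: "word_eval integer_group f (replicate n (t, True)) = int n * f t" for n t
    by (induction n) (simp_all add: word_eval_def algebra_simps)
  obtain F where F: "F \<in> hom (presented_group (Gpq_rels p q)) integer_group"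
      "\<And>u. F (cls u) = word_eval integer_group f u"
    by (rule group.presented_group_lift[OF group_integer_group, of f "Gpq_rels p q"])
      (auto simp: Gpq_rels_def ev f_def)
  have "F \<in> hom G integer_group \<and> (\<forall>t. F (gn t) * period t = int p * int q)"
    using F ev[of 1] by (auto simp: G_def Gpq_def gn_def f_def period_def split: gen.split)
  then have *: "deg \<in> hom G integer_group \<and> (\<forall>t. deg (gn t) * period t = int p * int q)"
    
    unfolding deg_def
    by (rule someI[where P = "\<lambda>F. F \<in> hom G integer_group \<and> (\<forall>t. F (gn t) * period t = int p * int q)"])
  then show "deg \<in> hom G integer_group" "deg (gn t) * period t = int p * int q" by blast+
qed

lemma deg_mult: "a \<in> carrier G \<Longrightarrow> b \<in> carrier G \<Longrightarrow> deg (a \<otimes> b) = deg a + deg b"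
  using deg_hom by (simp add: hom_def)

lemma deg_int_pow: "a \<in> carrier G \<Longrightarrow> deg (a [^] (k::int)) = k * deg a"
  using hom_int_pow[OF deg_hom _ is_group group_integer_group] by simp

lemma deg_inv: "a \<in> carrier G \<Longrightarrow> deg (inv a) = - deg a"
  using deg_int_pow[of a "-1"] by (simp add: int_pow_neg)

lemma deg_z: "deg z = int p * int q"
  using deg_int_pow[of "gn Gen_x" "period Gen_x"] deg_gn[of Gen_x] by (simp add: z_def mult.commute)

lemma deg_z_pos: "0 < deg z"
  using p2 q2 by (simp add: deg_z)

lemma deg_gn_pos: "0 < deg (gn t)"
  using deg_gn[of t] deg_z_pos period_pos(1)[of t] zero_less_mult_pos2[of "deg (gn t)" "period t"]
  by (simp add: deg_z)

lemma zpow_eq_iff: "z [^] (m::int) = z [^] (k::int) \<longleftrightarrow> m = k"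
  by (metis deg_int_pow deg_z_pos less_irrefl mult_cancel_right z_closed)

lemma len_gn_pow:
  "len (gn t [^] (e::int)) = (if e mod period t = 0 then 0 else 1)"
  "e mod period t \<noteq> 0 \<Longrightarrow> first_type (gn t [^] e) = t"
  "e mod period t \<noteq> 0 \<Longrightarrow> last_type (gn t [^] e) = t"
  by (simp_all add: len_def first_type_def last_type_def nf_gn_pow push_def)

lemma len_gn: "len (gn t) = 1" "first_type (gn t) = t" "last_type (gn t) = t"
  using len_gn_pow[where t = t and e = 1] period_ge[of t] by simp_all

lemma len_0_commute: "g \<in> carrier G \<Longrightarrow> h \<in> carrier G \<Longrightarrow> len g = 0 \<Longrightarrow> g \<otimes> h = h \<otimes> g"
  using len_eq_0_iff[of g] by (auto simp: zpow_commute)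

text \<open>
  A non-trivial even element fails to commute with a generator, an odd one with \<open>x \<otimes> y\<close>.\<close>

lemma central_iff:
  assumes "g \<in> carrier G"
  shows "(\<forall>h\<in>carrier G. g \<otimes> h = h \<otimes> g) \<longleftrightarrow> len g = 0"
proof
  assume c: "\<forall>h\<in>carrier G. g \<otimes> h = h \<otimes> g"
  show "len g = 0"
  proof (rule ccontr)
    assume ne: "len g \<noteq> 0"
    show False
    proof (cases "even (len g)")
      case True
      have "gn Gen_x \<otimes> g \<noteq> g \<otimes> gn Gen_x"
        by (rule odd_even_not_commute) (use assms ne True in \<open>auto simp: len_gn\<close>)
      then show False using c by simp
    next
      case False
      have "len (gn Gen_x \<otimes> gn Gen_y) = 2" by (subst len_mult) (simp_all add: len_gn)
      then have "g \<otimes> (gn Gen_x \<otimes> gn Gen_y) \<noteq> gn Gen_x \<otimes> gn Gen_y \<otimes> g"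
        by (intro odd_even_not_commute) (use assms False in auto)
      then show False using c by simp
    qed
  qed
qed (use assms len_0_commute in blast)

lemma len_conj_by_eq_0_iff:
  assumes "u \<in> carrier G" "g \<in> carrier G"
  shows "len (conj_by u g) = 0 \<longleftrightarrow> len g = 0"
proof -
  have *: "conj_by v (z [^] (m::int)) = z [^] m" if "v \<in> carrier G" for v m
    using that by (simp add: conj_by_def m_assoc zpow_commute)
  have "conj_by (inv u) (conj_by u g) = g" using assms by (simp add: conj_by_conj_by)
  then show ?thesis
    using assms *[of u] *[of "inv u"] by (metis conj_by_closed inv_closed len_eq_0_iff)
qed

lemma split_first_syllable:
  assumes "g \<in> carrier G" "0 < len g"
  obtains i :: int and v where "v \<in> carrier G" "g = gn (first_type g) [^] i \<otimes> v" "len g = Suc (len v)"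
    "0 < len v \<Longrightarrow> first_type v \<noteq> first_type g" "0 < len v \<Longrightarrow> last_type v = last_type g"
proof -
  obtain i l where l: "nf g = (first_type g, i) # l"
    using assms by (metis first_type_def len_pos_iff list.collapse prod.collapse)
  obtain m :: int where m: "g = z [^] m \<otimes> val (nf g)" using assms(1) by (rule nf_decomp)
  have red: "red ((first_type g, i) # l)" using red_nf[OF assms(1)] l by simp
  have nf: "nf (z [^] m \<otimes> val l) = l" using red by (intro nf_zpow_val) simp
  have "g = z [^] m \<otimes> (gn (first_type g) [^] i \<otimes> val l)" using m by (simp only: l val.simps)
  also have "\<dots> = gn (first_type g) [^] i \<otimes> (z [^] m \<otimes> val l)" by (simp add: gn_collect)
  finally have "g = gn (first_type g) [^] i \<otimes> (z [^] m \<otimes> val l)" .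
  then show ?thesis
    by (rule that[rotated])
      (use red in \<open>auto simp: len_def l nf first_type_def[of "z [^] m \<otimes> val l"] last_type_def\<close>)
qed

lemma len_le_1_imp_gn_pow:
  assumes "g \<in> carrier G" "len g \<le> 1"
  obtains t and k :: int where "g = gn t [^] k" "0 < len g \<Longrightarrow> t = first_type g"
proof (cases "len g = 0")
  case True
  then obtain m :: int where "g = z [^] m" using assms len_eq_0_iff by blast
  then have "g = gn Gen_x [^] (period Gen_x * m)" by (simp add: z_def int_pow_pow)
  then show ?thesis using that True by simp
next
  case False
  then obtain i :: int and v where v: "v \<in> carrier G" "g = gn (first_type g) [^] i \<otimes> v" "len g = Suc (len v)"
    using split_first_syllable[of g] assms by (metis neq0_conv)
  then have "len v = 0" using assms by simp
  then obtain m :: int where "v = z [^] m" using v len_eq_0_iff by blast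
  then have "v = gn (first_type g) [^] (period (first_type g) * m)"
    by (simp add: gn_pow_period flip: int_pow_pow)
  then have "g = gn (first_type g) [^] (i + period (first_type g) * m)"
    using v(2) by (simp add: int_pow_mult)
  then show ?thesis using that by blast
qed

lemma len_nat_pow_le: "g \<in> carrier G \<Longrightarrow> len (g [^] (n::nat)) \<le> n * len g"
proof (induction n)
  case 0
  then show ?case using len_zpow[of 0] by simp
next
  case (Suc n)
  then show ?case using len_mult_le[of "g [^] n" g] by (simp add: nat_pow_Suc)
qed

text \<open>
  In a twisted conjugate \<open>inv u \<otimes> g \<otimes> f u\<close> of minimal length, odd length greater than \<open>1\<close> is impossible:
  moving the first syllable to the other end, where it is met by a syllable of its own type, makes the
  element shorter.  Taking the identity for \<open>f\<close> gives ordinary conjugation; the inversion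
  automorphism gives the conjugation relevant for its outer class.\<close>

lemma ex_short_twisted_conjugate:
  assumes g: "g \<in> carrier G" and f: "f \<in> hom G G"
    and f_gn: "\<And>t (i::int). \<exists>j::int. f (gn t [^] i) = gn t [^] j"
  obtains u where "u \<in> carrier G"
    "len (inv u \<otimes> g \<otimes> f u) \<le> 1 \<or> cyc_red (inv u \<otimes> g \<otimes> f u)"
proof -
  define P where "P n \<longleftrightarrow> (\<exists>u\<in>carrier G. len (inv u \<otimes> g \<otimes> f u) = n)" for n
  have f_closed: "f a \<in> carrier G" if "a \<in> carrier G" for a
    using f that by (auto simp: hom_def)
  have f_mult: "f (a \<otimes> b) = f a \<otimes> f b" if "a \<in> carrier G" "b \<in> carrier G" for a b
    using f that by (auto simp: hom_def)
  have "P (len (inv \<one> \<otimes> g \<otimes> f \<one>))" unfolding P_def by blast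
  then have "P (LEAST n. P n)" by (rule LeastI)
  then obtain u where u: "u \<in> carrier G" "len (inv u \<otimes> g \<otimes> f u) = (LEAST n. P n)"
    unfolding P_def by blast
  define w where "w = inv u \<otimes> g \<otimes> f u"
  have w: "w \<in> carrier G" using u g f_closed by (simp add: w_def)
  have "len w \<le> 1 \<or> cyc_red w"
  proof (rule ccontr)
    assume "\<not> (len w \<le> 1 \<or> cyc_red w)"
    then have w1: "1 < len w" and odd: "odd (len w)" using w by (auto simp: cyc_red_def)
    obtain i :: int and v where v: "v \<in> carrier G" "w = gn (first_type w) [^] i \<otimes> v"
        "len w = Suc (len v)" "0 < len v \<Longrightarrow> last_type v = last_type w"
      using split_first_syllable[of w] w w1 by (metis less_trans zero_less_one)
    obtain j :: int where j: "f (gn (first_type w) [^] i) = gn (first_type w) [^] j" using f_gn by blast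
    let ?t = "gn (first_type w) [^] i"
    have "inv (u \<otimes> ?t) \<otimes> g \<otimes> f (u \<otimes> ?t) = inv ?t \<otimes> w \<otimes> f ?t"
      using u g f_closed by (simp add: w_def inv_mult_group m_assoc f_mult)
    also have "\<dots> = inv ?t \<otimes> w \<otimes> gn (first_type w) [^] j" by (simp only: j)
    also have "\<dots> = v \<otimes> gn (first_type w) [^] j"
      using v(1) by (subst v(2)) (simp add: m_assoc)
    finally have eq: "inv (u \<otimes> ?t) \<otimes> g \<otimes> f (u \<otimes> ?t) = v \<otimes> gn (first_type w) [^] j" .
    have "u \<otimes> ?t \<in> carrier G" using u by simp
    then have "P (len (inv (u \<otimes> ?t) \<otimes> g \<otimes> f (u \<otimes> ?t)))"
      unfolding P_def by (intro bexI[of _ "u \<otimes> ?t"] HOL.refl)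
    then have le: "len w \<le> len (v \<otimes> gn (first_type w) [^] j)"
      unfolding eq using Least_le[of P] u(2) by (simp add: w_def)
    have "last_type v = first_type w" using v w w1 odd odd_len_iff[OF w] by simp
    then have "len (v \<otimes> gn (first_type w) [^] j) < Suc (len v)"
      using len_mult_less[of v "gn (first_type w) [^] j"] len_mult_le[of v "gn (first_type w) [^] j"] v(1,3) w1
      by (cases "j mod period (first_type w) = 0") (simp_all add: len_gn_pow)
    then show False using le v(3) by simp
  qed
  then show ?thesis using that u(1) by (simp add: w_def)
qed

section \<open>Hyperbolic elements and their centralizers\<close>

text \<open>
  The combinatorial form of acting hyperbolically on the tree (\<open>hyperbolic_iff\<close>).\<close>

definition hyp :: "gen word set \<Rightarrow> bool" where
  "hyp g \<longleftrightarrow> g \<in> carrier G \<and> (\<exists>u\<in>carrier G. cyc_red (conj_by u g))"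

lemma ex_short_conjugate:
  assumes "g \<in> carrier G" "\<not> hyp g"
  obtains u where "u \<in> carrier G" "len (conj_by u g) \<le> 1"
proof -
  obtain u where "u \<in> carrier G" "len (conj_by u g) \<le> 1 \<or> cyc_red (conj_by u g)"
    by (rule ex_short_twisted_conjugate[OF assms(1), of "\<lambda>a. a"]) (auto simp: hom_def conj_by_def)
  then show ?thesis using assms that by (auto simp: hyp_def)
qed

text \<open>
  Conjugation changes the length of each power by at most \<open>2 * len u\<close>, whereas the length of the
  \<open>k\<close>-th power of \<open>w\<close> is \<open>k * len w\<close>; a shorter conjugate would be too short for large \<open>k\<close>.\<close>

lemma cyc_red_len_le_conjugate:
  assumes "cyc_red w" "u \<in> carrier G"
  shows "len w \<le> len (conj_by u w)"
proof (rule ccontr)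
  assume less: "\<not> len w \<le> len (conj_by u w)"
  have w: "w \<in> carrier G" using assms cyc_redD by blast
  (* Large enough that the loss of one syllable per factor outweighs the two conjugating elements. *)
  define k where "k = Suc (2 * len u)"
  have "w [^] k = u \<otimes> (conj_by u w [^] k \<otimes> inv u)"
    using assms(2) w by (simp add: conj_by_nat_pow[symmetric]) (simp add: conj_by_def m_assoc)
  then have "k * len w = len (u \<otimes> (conj_by u w [^] k \<otimes> inv u))"
    using cyc_red_nat_pow[OF assms(1), of k] by simp
  also have "\<dots> \<le> len u + (k * len (conj_by u w) + len u)"
    using assms w len_mult_le[of u "conj_by u w [^] k \<otimes> inv u"] len_mult_le[of "conj_by u w [^] k" "inv u"]
      len_nat_pow_le[of "conj_by u w" k] by simp
  finally have "k * len w \<le> 2 * len u + k * len (conj_by u w)" by simp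
  moreover have "k * Suc (len (conj_by u w)) \<le> k * len w" using less by (intro mult_le_mono2) simp
  ultimately show False by (simp add: k_def)
qed

lemma cyc_red_conjugate_len:
  assumes "cyc_red w" "u \<in> carrier G" "cyc_red (conj_by u w)"
  shows "len (conj_by u w) = len w"
  using cyc_red_len_le_conjugate[of w u] cyc_red_len_le_conjugate[of "conj_by u w" "inv u"] assms
  by (simp add: conj_by_conj_by cyc_redD)

lemma cyc_red_commute_even:
  assumes "cyc_red w" "a \<in> carrier G" "a \<otimes> w = w \<otimes> a"
  shows "even (len a)"
  using odd_even_not_commute[of a w] assms by (auto simp: cyc_red_def)

text \<open>
  For the non-trivial direction: an element commutes with its powers, so it is even if a power of it is
  cyclically reduced.\<close>

lemma cyc_red_int_pow_iff:
  assumes "v \<in> carrier G" "k \<noteq> 0"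
  shows "cyc_red (v [^] (k::int)) \<longleftrightarrow> cyc_red v"
proof
  assume c: "cyc_red (v [^] k)"
  have "even (len v)"
    using c assms(1) by (rule cyc_red_commute_even) (simp add: assms(1) commute_int_pow)
  moreover have "len v \<noteq> 0"
  proof
    assume "len v = 0"
    then obtain m :: int where "v = z [^] m" using assms len_eq_0_iff by blast
    then show False using cyc_redD(2)[OF c] by (simp add: int_pow_pow)
  qed
  ultimately show "cyc_red v" using assms by (simp add: cyc_red_def)
qed (use assms cyc_red_int_pow in blast)

lemma hyp_int_pow: "hyp g \<Longrightarrow> k \<noteq> 0 \<Longrightarrow> hyp (g [^] (k::int))"
  unfolding hyp_def by (metis conj_by_int_pow cyc_red_int_pow int_pow_closed)

lemma hyp_len: "hyp g \<Longrightarrow> len g \<noteq> 0"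
  using len_conj_by_eq_0_iff cyc_redD(2) by (fastforce simp: hyp_def)

lemma not_hyp_pow_central:
  assumes "g \<in> carrier G" "\<not> hyp g"
  obtains n :: nat where "0 < n" "len (g [^] n) = 0"
proof -
  obtain u where u: "u \<in> carrier G" "len (conj_by u g) \<le> 1"
    using ex_short_conjugate[OF assms] .
  then obtain t and k :: int where k: "conj_by u g = gn t [^] k"
    using len_le_1_imp_gn_pow[of "conj_by u g"] assms by (metis conj_by_closed)
  have "conj_by u (g [^] nat (period t)) = gn t [^] (k * period t)"
    using u assms k int_pow_int[of G "gn t [^] k" "nat (period t)"]
    by (simp add: conj_by_nat_pow conj_by_int_pow int_pow_pow less_imp_le[OF period_pos(1)])
  then have "len (conj_by u (g [^] nat (period t))) = 0" by (simp add: len_gn_pow)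
  then have "len (g [^] nat (period t)) = 0" using u assms by (simp add: len_conj_by_eq_0_iff)
  then show ?thesis using that[of "nat (period t)"] by simp
qed

lemma hyp_iff: "hyp g \<longleftrightarrow> g \<in> carrier G \<and> (\<forall>n::nat. 0 < n \<longrightarrow> len (g [^] n) \<noteq> 0)"
proof
  assume g: "hyp g"
  have "len (g [^] n) \<noteq> 0" if "0 < n" for n :: nat
    using hyp_len[OF hyp_int_pow[OF g, of "int n"]] that by (simp add: int_pow_int)
  then show "g \<in> carrier G \<and> (\<forall>n::nat. 0 < n \<longrightarrow> len (g [^] n) \<noteq> 0)"
    using g by (auto simp: hyp_def)
qed (metis not_hyp_pow_central)

text \<open>
  After a conjugation the centralizer consists of even elements, so the signed length is a
  homomorphism on it.\<close>

lemma cent_hyp_hom: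
  assumes "hyp g"
  obtains s :: "gen word set \<Rightarrow> int"
  where "\<And>a b. a \<in> cent g \<Longrightarrow> b \<in> cent g \<Longrightarrow> s (a \<otimes> b) = s a + s b"
    "\<And>a. a \<in> cent g \<Longrightarrow> s a = 0 \<longleftrightarrow> len a = 0"
proof -
  obtain u where u: "u \<in> carrier G" "cyc_red (conj_by u g)" and g: "g \<in> carrier G"
    using assms by (auto simp: hyp_def)
  have even: "even (len (conj_by u a))" if "a \<in> cent g" for a
    using u(2) by (rule cyc_red_commute_even)
      (use that u g in \<open>auto simp: cent_def conj_by_commute_iff\<close>)
  show ?thesis
  proof (rule that[of "\<lambda>a. signed_len (conj_by u a)"])
    fix a b assume ab: "a \<in> cent g" "b \<in> cent g"
    then have "a \<otimes> b \<in> cent g" using subgroup.m_closed[OF subgroup_cent[OF g]] by blast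
    then have "even (len (conj_by u a \<otimes> conj_by u b))"
      using even[of "a \<otimes> b"] ab u by (simp add: conj_by_mult cent_def)
    then show "signed_len (conj_by u (a \<otimes> b)) = signed_len (conj_by u a) + signed_len (conj_by u b)"
      using ab u even by (simp add: conj_by_mult cent_def signed_len_mult)
  next
    fix a assume "a \<in> cent g"
    then show "signed_len (conj_by u a) = 0 \<longleftrightarrow> len a = 0"
      using u by (simp add: signed_len_eq_0_iff len_conj_by_eq_0_iff cent_def)
  qed
qed

lemma len_0_deg_0: "a \<in> carrier G \<Longrightarrow> len a = 0 \<Longrightarrow> deg a = 0 \<Longrightarrow> a = \<one>"
  using deg_z_pos by (auto simp: len_eq_0_iff deg_int_pow)

text \<open>
  The commutator of \<open>a\<close> and \<open>b\<close> is killed by the homomorphism of \<open>cent_hyp_hom\<close>, hence is a power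
  of \<open>z\<close>; it is also killed by \<open>deg\<close>, hence is trivial.\<close>

lemma cent_hyp_abelian:
  assumes "hyp g" "a \<in> cent g" "b \<in> cent g"
  shows "a \<otimes> b = b \<otimes> a"
proof -
  have g: "g \<in> carrier G" using assms by (simp add: hyp_def)
  note C = subgroup.m_closed[OF subgroup_cent[OF g]] subgroup.m_inv_closed[OF subgroup_cent[OF g]]
  obtain s :: "gen word set \<Rightarrow> int"
    where s: "\<And>a b. a \<in> cent g \<Longrightarrow> b \<in> cent g \<Longrightarrow> s (a \<otimes> b) = s a + s b"
      "\<And>a. a \<in> cent g \<Longrightarrow> s a = 0 \<longleftrightarrow> len a = 0"
    using cent_hyp_hom[OF assms(1)] by metis
  have ab: "a \<in> carrier G" "b \<in> carrier G" using assms by (auto simp: cent_def)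
  let ?c = "inv (b \<otimes> a) \<otimes> (a \<otimes> b)"
  have "s ((b \<otimes> a) \<otimes> ?c) = s (b \<otimes> a) + s ?c" using assms by (intro s(1) C)
  moreover have "(b \<otimes> a) \<otimes> ?c = a \<otimes> b" using ab by simp
  ultimately have "s ?c = 0" using s(1) assms by simp
  then have "len ?c = 0" using s(2)[of ?c] C assms by simp
  moreover have "deg ?c = 0" using ab by (simp add: deg_mult deg_inv)
  ultimately have "?c = \<one>" using ab by (intro len_0_deg_0) simp_all
  then have "(b \<otimes> a) \<otimes> ?c = b \<otimes> a" using ab by simp
  then show ?thesis using ab by simp
qed

lemma cent_hyp_generator:
  assumes "hyp g"
  obtains c where "c \<in> cent g" "\<And>a. a \<in> cent g \<Longrightarrow> \<exists>(i::int) (m::int). a = c [^] i \<otimes> z [^] m"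
proof -
  have g: "g \<in> carrier G" using assms by (simp add: hyp_def)
  note C = subgroup_cent[OF g]
  obtain s :: "gen word set \<Rightarrow> int"
    where s: "\<And>a b. a \<in> cent g \<Longrightarrow> b \<in> cent g \<Longrightarrow> s (a \<otimes> b) = s a + s b"
      "\<And>a. a \<in> cent g \<Longrightarrow> s a = 0 \<longleftrightarrow> len a = 0"
    using cent_hyp_hom[OF assms(1)] by metis
  obtain c where c: "c \<in> cent g" "\<And>i::int. s (c [^] i) = i * s c" "\<And>a. a \<in> cent g \<Longrightarrow> s c dvd s a"
    using subgroup_int_hom_generator[of "cent g" s, OF C s(1)] by blast
  have "\<exists>(i::int) (m::int). a = c [^] i \<otimes> z [^] m" if a: "a \<in> cent g" for a
  proof -
    obtain i where i: "s a = s c * i" using c(3)[OF a] by (rule dvdE)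
    have ci: "c [^] i \<in> cent g" "c [^] (- i) \<in> cent g"
      using subgroup_int_pow_closed[OF C c(1)] by auto
    have "s (c [^] (- i) \<otimes> a) = 0" using s(1)[OF ci(2) a] c(2)[of "-i"] i by simp
    then have "len (c [^] (- i) \<otimes> a) = 0" using s(2) subgroup.m_closed[OF C ci(2) a] by simp
    moreover have car: "c \<in> carrier G" "a \<in> carrier G" using a c by (auto simp: cent_def)
    ultimately obtain m :: int where "c [^] (- i) \<otimes> a = z [^] m"
      using len_eq_0_iff[of "c [^] (- i) \<otimes> a"] by auto
    then have "a = c [^] i \<otimes> z [^] m" using car by (simp add: int_pow_neg flip: \<open>_ = z [^] m\<close>)
    then show ?thesis by blast
  qed
  then show ?thesis using that c(1) by blast
qed

text \<open>
  By \<open>odd_even_not_commute\<close> only odd \<open>a\<close> and powers of \<open>z\<close> can occur.  If \<open>a\<close> has the wrong type at its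
  ends, the two products begin differently.  Otherwise the first syllable of \<open>a\<close> can be removed, and
  the even remainder still commutes.\<close>

lemma cent_gn_pow:
  assumes "a \<in> carrier G" "len (gn t [^] (k::int)) \<noteq> 0" "a \<otimes> gn t [^] k = gn t [^] k \<otimes> a"
  shows "\<exists>j::int. a = gn t [^] j"
proof -
  let ?w = "gn t [^] k"
  have w: "len ?w = 1" "first_type ?w = t" "last_type ?w = t" "?w \<in> carrier G"
    using assms(2) by (auto simp: len_gn_pow split: if_splits)
  have even: "len b = 0" if "b \<in> carrier G" "even (len b)" "b \<otimes> ?w = ?w \<otimes> b" for b
    using odd_even_not_commute[of ?w b] that w by fastforce
  consider "len a = 0" | "odd (len a)" using even[OF assms(1) _ assms(3)] by metis
  then show ?thesis
  proof cases
    case 1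
    then obtain m :: int where "a = z [^] m" using assms len_eq_0_iff by blast
    then have "a = gn t [^] (period t * m)" by (simp add: gn_pow_period flip: int_pow_pow)
    then show ?thesis by blast
  next
    case 2
    then have a0: "0 < len a" by (rule odd_pos)
    have fl: "first_type a = last_type a" using odd_len_iff assms a0 2 by blast
    show ?thesis
    proof (cases "first_type a = t")
      case False
      then have "first_type (a \<otimes> ?w) = first_type a" "first_type (?w \<otimes> a) = first_type ?w"
        using len_mult(2)[of a ?w] len_mult(2)[of ?w a] assms(1) a0 w fl False by simp_all
      then show ?thesis using False assms(3) w(2) by metis
    next
      case True
      obtain i :: int and v where v: "v \<in> carrier G" "a = gn t [^] i \<otimes> v" "len a = Suc (len v)"
        using split_first_syllable[of a] assms a0 True by metis
      have ti: "?w \<otimes> gn t [^] i = gn t [^] i \<otimes> ?w"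
        by (simp flip: int_pow_mult add: add.commute)
      have "gn t [^] i \<otimes> (v \<otimes> ?w) = a \<otimes> ?w" using v by (simp add: m_assoc)
      also have "\<dots> = ?w \<otimes> (gn t [^] i \<otimes> v)" using assms v by simp
      also have "\<dots> = gn t [^] i \<otimes> (?w \<otimes> v)" using v ti by (simp flip: m_assoc)
      finally have "v \<otimes> ?w = ?w \<otimes> v" using v by simp
      moreover have "even (len v)" using 2 v by simp
      ultimately have "len v = 0" using even v by blast
      then obtain m :: int where "v = z [^] m" using v len_eq_0_iff by blast
      then have "v = gn t [^] (period t * m)" by (simp add: gn_pow_period flip: int_pow_pow)
      then have "a = gn t [^] (i + period t * m)" using v(2) by (simp add: int_pow_mult)
      then show ?thesis by blast
    qed
  qed
qed

text \<open>
  Powers \<open>A\<close> of \<open>g\<close> and \<open>B\<close> of \<open>h\<close> of the same length and direction are compared.  As \<open>B\<close> moves the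
  edge of \<open>\<one>\<close> along the axis of \<open>h\<close>, the conjugate of \<open>A\<close> by \<open>B\<close> is cyclically reduced, so it has the
  length of \<open>A\<close>.  Then \<open>A \<otimes> B = B \<otimes> conj_by B A\<close> holds without merging on either side, and comparing
  the first halves of the normal forms gives \<open>A = B\<close> up to a power of \<open>z\<close>.  Hence \<open>g\<close> and \<open>h\<close> both
  centralize \<open>A\<close>.\<close>

lemma same_axis_commute:
  assumes "cyc_red g" "cyc_red h"
    and axis: "\<And>u. u \<in> carrier G \<Longrightarrow> cyc_red (conj_by u h) \<Longrightarrow> cyc_red (conj_by u g)"
  shows "g \<otimes> h = h \<otimes> g"
proof -
  have *: "g \<otimes> h = h \<otimes> g"
    if h: "cyc_red h" and first_type: "first_type h = first_type g"
      and axis: "\<And>u. u \<in> carrier G \<Longrightarrow> cyc_red (conj_by u h) \<Longrightarrow> cyc_red (conj_by u g)" for h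
  proof -
    note [simp] = cyc_redD(1)[OF assms(1)] cyc_redD(1)[OF h]
    have pos: "0 < len g" "0 < len h" using assms h cyc_redD by auto
    (* The exponents make both powers equally long. *)
    define A where "A = g [^] len h"
    define B where "B = h [^] len g"
    have [simp]: "A \<in> carrier G" "B \<in> carrier G" by (simp_all add: A_def B_def)
    have A: "len A = len h * len g" "first_type A = first_type g" "last_type A = last_type g"
      and B: "len B = len g * len h" "first_type B = first_type g" "last_type B = last_type h"
      using cyc_red_nat_pow[OF assms(1), of "len h"] cyc_red_nat_pow[OF h, of "len g"] pos first_type
      by (auto simp: A_def B_def)
    have "h \<otimes> B = B \<otimes> h" unfolding B_def by (metis \<open>h \<in> carrier G\<close> nat_pow_Suc nat_pow_Suc2)
    then have "conj_by B h = h" by (simp add: conj_by_def m_assoc)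
    then have "cyc_red (conj_by B g)" using axis[of B] h by simp
    then have "cyc_red (conj_by B A)"
      using cyc_red_int_pow[of "conj_by B g" "int (len h)"] pos by (simp add: A_def conj_by_nat_pow int_pow_int)
    moreover have Ac: "cyc_red A"
      using cyc_red_int_pow[OF assms(1), of "int (len h)"] pos by (simp add: A_def int_pow_int)
    ultimately have conj_by: "len (conj_by B A) = len A" by (intro cyc_red_conjugate_len) simp_all
    have AB: "A \<otimes> B = B \<otimes> conj_by B A" by (simp add: conj_by_def m_assoc)
    have lA: "0 < len A" "0 < len B" using A B pos by auto
    have "last_type A \<noteq> first_type B" using A B cyc_redD(3)[OF assms(1)] by simp
    then have nf1: "nf (A \<otimes> B) = nf A @ nf B" and l: "len (A \<otimes> B) = len A + len B"
      using lA by (auto intro: nf_mult len_mult)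
    have "last_type B \<noteq> first_type (conj_by B A)"
      using len_mult_less[of B "conj_by B A"] l conj_by lA AB by auto
    then have "nf (B \<otimes> conj_by B A) = nf B @ nf (conj_by B A)" by (intro nf_mult) simp_all
    then have "nf A @ nf B = nf B @ nf (conj_by B A)" using nf1 AB by simp
    moreover have "length (nf A) = length (nf B)" using A B by (simp add: len_def)
    ultimately have nf: "nf A = nf B" by simp
    obtain m m' :: int where "A = z [^] m \<otimes> val (nf A)" "B = z [^] m' \<otimes> val (nf B)"
      using nf_decomp[of A] nf_decomp[of B] by (metis \<open>A \<in> carrier G\<close> \<open>B \<in> carrier G\<close>)
    then have "A = z [^] (m - m') \<otimes> B" using nf by (metis add.commute diff_add_cancel val_closed zpow_collect(1))
    then have "h \<otimes> A = A \<otimes> h"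
      using \<open>h \<otimes> B = B \<otimes> h\<close> by (simp add: zpow_left_commute m_assoc)
    moreover have "g \<otimes> A = A \<otimes> g" unfolding A_def by (metis \<open>g \<in> carrier G\<close> nat_pow_Suc nat_pow_Suc2)
    moreover have "hyp A" unfolding hyp_def using Ac conj_by_one[of A] by (metis cyc_redD(1) one_closed)
    ultimately show ?thesis by (intro cent_hyp_abelian[of A]) (simp_all add: cent_def)
  qed
  show ?thesis
  proof (cases "first_type h = first_type g")
    case True
    then show ?thesis using * assms by blast
  next
    case False
    have h: "h \<in> carrier G" "g \<in> carrier G" "0 < len h" "first_type h \<noteq> last_type h" using assms cyc_redD by auto
    have "g \<otimes> inv h = inv h \<otimes> g"
    proof (rule *)
      show "first_type (inv h) = first_type g" using h False gen_eq_third[of "last_type h" "first_type h" "first_type g"] by (simp add: first_type_inv)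
      show "cyc_red (conj_by u g)" if "u \<in> carrier G" "cyc_red (conj_by u (inv h))" for u
        using that h axis[of u] cyc_red_inv[of "conj_by u (inv h)"] by (simp add: conj_by_inv)
    qed (use assms cyc_red_inv in blast)
    then show ?thesis using h commute_int_pow[of g "inv h" "-1"] by (simp add: int_pow_neg)
  qed
qed

end

section \<open>The metric of the Bass-Serre tree\<close>

context knot_group
begin

text \<open>
  The coordinate, on each edge, of the endpoint that is a coset of the subgroup generated by \<open>gn t\<close>.\<close>

definition pos :: "gen \<Rightarrow> real" where
  "pos t = (case t of Gen_x \<Rightarrow> 0 | Gen_y \<Rightarrow> 1)"

lemma pos_bounds: "0 \<le> pos t" "pos t \<le> 1"
  by (auto simp: pos_def split: gen.split)

lemma pos_ne: "r \<noteq> t \<Longrightarrow> \<bar>s - pos r\<bar> + \<bar>s - pos t\<bar> = 1" if "0 \<le> s" "s \<le> 1"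
  using that by (cases r; cases t) (auto simp: pos_def)

lemma pos_ne': "r \<noteq> t \<Longrightarrow> \<bar>pos r - pos t\<bar> = 1"
  using pos_ne[of "pos r" r t] pos_bounds by simp

lemma lcos_eq_iff:
  assumes "a \<in> carrier G" "g \<in> carrier G" "h \<in> carrier G"
  shows "g <# generate G {a} = h <# generate G {a} \<longleftrightarrow> (\<exists>k::int. h = g \<otimes> a [^] k)"
proof
  assume eq: "g <# generate G {a} = h <# generate G {a}"
  have "h \<in> h <# generate G {a}"
    using assms by (auto simp: l_coset_def intro!: bexI[of _ \<one>] generate.one)
  then show "\<exists>k::int. h = g \<otimes> a [^] k"
    using assms unfolding eq[symmetric] by (auto simp: l_coset_def generate_pow)
next
  assume "\<exists>k::int. h = g \<otimes> a [^] k"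
  then obtain k :: int where k: "h = g \<otimes> a [^] k" by blast
  have "\<exists>j::int. g \<otimes> a [^] i = h \<otimes> a [^] j" for i :: int
    using assms by (intro exI[of _ "i - k"]) (simp add: k m_assoc flip: int_pow_mult)
  moreover have "\<exists>j::int. h \<otimes> a [^] i = g \<otimes> a [^] j" for i :: int
    using assms by (intro exI[of _ "k + i"]) (simp add: k m_assoc int_pow_mult)
  ultimately show "g <# generate G {a} = h <# generate G {a}"
    using assms by (fastforce simp: l_coset_def generate_pow)
qed

abbreviation ep :: "gen word set \<Rightarrow> real \<Rightarrow> gen word set bs_point" where
  "ep \<equiv> edge_point p q"

lemma ep_def:
  "ep g t = (if t = pos Gen_x then Vertex_x (g <# generate G {gn Gen_x})
     else if t = pos Gen_y then Vertex_y (g <# generate G {gn Gen_y})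
     else Inner (g <# generate G {z}) t)"
  by (simp add: edge_point_def pos_def z_def period_def int_pow_int gn_def Gpq_x_def Gpq_y_def
      flip: G_def)

text \<open>
  A point inside an edge determines the coset of \<open>\<langle>z\<rangle>\<close>; an endpoint is shared by all edges whose labels
  differ by a power of its generator.\<close>

lemma ep_eq_iff:
  assumes "g \<in> carrier G" "h \<in> carrier G"
  shows "ep g s = ep h t \<longleftrightarrow> s = t \<and>
    ((\<exists>k::int. h = g \<otimes> z [^] k) \<or> (\<exists>r. s = pos r \<and> (\<exists>k::int. h = g \<otimes> gn r [^] k)))"
proof -
  have zr: "\<exists>k::int. h = g \<otimes> gn r [^] k" if "h = g \<otimes> z [^] m" for m :: int and r
    using that by (intro exI[of _ "period r * m"]) (simp add: gn_pow_period flip: int_pow_pow)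
  have r: "s = pos r \<longleftrightarrow> (s = pos Gen_x \<and> r = Gen_x) \<or> (s = pos Gen_y \<and> r = Gen_y)" for s r
    by (cases r) (auto simp: pos_def)
  have ne: "pos Gen_x \<noteq> pos Gen_y" by (simp add: pos_def)
  show ?thesis
    using assms ne zr unfolding ep_def by (subst r) (auto simp: lcos_eq_iff)
qed

lemma ep_vertex: "g \<in> carrier G \<Longrightarrow> ep (g \<otimes> gn r [^] (k::int)) (pos r) = ep g (pos r)"
  by (subst eq_commute) (auto simp: ep_eq_iff)

lemma ep_zpow: "g \<in> carrier G \<Longrightarrow> ep (g \<otimes> z [^] (k::int)) s = ep g s"
  by (subst eq_commute) (auto simp: ep_eq_iff)

lemma bs_act_ep: "g \<in> carrier G \<Longrightarrow> u \<in> carrier G \<Longrightarrow> bs_act p q g (ep u s) = ep (g \<otimes> u) s"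
  by (simp add: ep_def lcos_m_assoc generate_incl flip: G_def)

lemma bs_tree_eq: "bs_tree p q = {ep u s | u s. u \<in> carrier G \<and> 0 \<le> s \<and> s \<le> 1}"
  by (simp add: bs_tree_def flip: G_def)

text \<open>
  With \<open>w = inv u \<otimes> h\<close> this is the length of the geodesic from the point with coordinate \<open>s\<close> on the edge
  of \<open>u\<close> to the one with coordinate \<open>t\<close> on the edge of \<open>h\<close>: each syllable of \<open>w\<close> is a turn at a vertex
  of its type, and consecutive turns are one edge apart.\<close>

definition edge_dist :: "gen word set \<Rightarrow> real \<Rightarrow> real \<Rightarrow> real" where
  "edge_dist w s t = (if len w = 0 then \<bar>s - t\<bar>
     else \<bar>s - pos (first_type w)\<bar> + (real (len w) - 1) + \<bar>t - pos (last_type w)\<bar>)"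

lemma edge_dist_Lipschitz: "edge_dist w s t' \<le> edge_dist w s t + \<bar>t - t'\<bar>"
  by (cases "len w = 0") (simp add: edge_dist_def; linarith)+

lemma split_last_syllable:
  assumes "g \<in> carrier G" "0 < len g"
  obtains i :: int and v where "v \<in> carrier G" "g = v \<otimes> gn (last_type g) [^] i" "len g = Suc (len v)"
    "0 < len v \<Longrightarrow> last_type v \<noteq> last_type g" "0 < len v \<Longrightarrow> first_type v = first_type g"
proof -
  obtain i :: int and v where v: "v \<in> carrier G" "inv g = gn (first_type (inv g)) [^] i \<otimes> v"
    "len (inv g) = Suc (len v)" "0 < len v \<Longrightarrow> first_type v \<noteq> first_type (inv g)" "0 < len v \<Longrightarrow> last_type v = last_type (inv g)"
    using split_first_syllable[of "inv g"] assms by (metis inv_closed len_inv)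
  have fl: "first_type (inv g) = last_type g" "last_type (inv g) = first_type g" using assms by (simp_all add: first_type_inv last_type_inv)
  have len: "len g = Suc (len v)" using v(3) assms by simp
  have "g = inv (gn (last_type g) [^] i \<otimes> v)" using v(2) assms fl by (metis inv_inv)
  also have "\<dots> = inv v \<otimes> gn (last_type g) [^] (- i)" using v(1) by (simp add: inv_mult_group int_pow_neg)
  finally have "g = inv v \<otimes> gn (last_type g) [^] (- i)" .
  then show ?thesis
    by (rule that[rotated]) (use v(1,4,5) len fl assms in \<open>auto simp: first_type_inv last_type_inv\<close>)
qed

text \<open>
  The distance to a vertex does not depend on the edge through which the vertex is described.\<close>

lemma edge_dist_vertex:
  assumes "w \<in> carrier G"
  shows "edge_dist (w \<otimes> gn r [^] (k::int)) s (pos r) = edge_dist w s (pos r)"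
proof -
  have *: "edge_dist (v \<otimes> gn r [^] (i::int)) s (pos r) = edge_dist v s (pos r)"
    if v: "v \<in> carrier G" "0 < len v \<Longrightarrow> last_type v \<noteq> r" for v i
  proof (cases "i mod period r = 0")
    case True
    then have "len (gn r [^] i) = 0" by (simp add: len_gn_pow)
    then obtain m :: int where "gn r [^] i = z [^] m" using len_eq_0_iff[of "gn r [^] i"] by auto
    then show ?thesis using v by (simp add: edge_dist_def len_mult_cong)
  next
    case i: False
    show ?thesis
    proof (cases "len v = 0")
      case True
      then obtain m :: int where "v = z [^] m" using len_eq_0_iff v by blast
      then show ?thesis using i by (simp add: edge_dist_def len_mult_cong len_gn_pow)
    next
      case False
      have "len (v \<otimes> gn r [^] i) = len v + len (gn r [^] i)"
        "first_type (v \<otimes> gn r [^] i) = first_type v" "last_type (v \<otimes> gn r [^] i) = last_type (gn r [^] i)"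
        using len_mult[of v "gn r [^] i"] v False i by (simp_all add: len_gn_pow)
      then show ?thesis using v False i pos_ne'[of r "last_type v"]
        by (simp add: edge_dist_def len_gn_pow)
    qed
  qed
  obtain v and i :: int where v: "v \<in> carrier G" "0 < len v \<Longrightarrow> last_type v \<noteq> r" "w = v \<otimes> gn r [^] i"
  proof (cases "0 < len w \<and> last_type w = r")
    case True
    then show ?thesis using split_last_syllable[of w] that assms by metis
  next
    case False
    then show ?thesis using that[of w 0] assms by auto
  qed
  have "w \<otimes> gn r [^] k = v \<otimes> gn r [^] (i + k)" using v by (simp add: m_assoc int_pow_mult)
  then show ?thesis using *[OF v(1,2)] v(3) by simp
qed

lemma edge_dist_cong:
  assumes "u \<in> carrier G" "h \<in> carrier G" "h' \<in> carrier G" "ep h t = ep h' t'"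
  shows "edge_dist (inv u \<otimes> h) s t = edge_dist (inv u \<otimes> h') s t'"
proof -
  have t: "t' = t" using assms by (simp add: ep_eq_iff)
  consider k :: int where "h' = h \<otimes> z [^] k" | r and k :: int where "t = pos r" "h' = h \<otimes> gn r [^] k"
    using assms ep_eq_iff[of h h' t t'] by blast
  then show ?thesis
  proof cases
    case 1
    then have "inv u \<otimes> h' = inv u \<otimes> h \<otimes> z [^] k" using assms by (simp add: m_assoc)
    then show ?thesis using assms t by (simp add: edge_dist_def len_mult_cong)
  next
    case 2
    then have "inv u \<otimes> h' = inv u \<otimes> h \<otimes> gn r [^] k" using assms by (simp add: m_assoc)
    then show ?thesis using assms t 2 by (simp add: edge_dist_vertex)
  qed
qed

text \<open>
  Lower bound for the metric: along each segment of a chain \<open>edge_dist\<close> grows by at most the length of the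
  segment, and it is well defined where the chain passes to another edge.\<close>

lemma bs_chain_lower:
  assumes "bs_chain p q a b L" "u \<in> carrier G" "h \<in> carrier G" "a = ep u s" "b = ep h t"
  shows "edge_dist (inv u \<otimes> h) s t \<le> L"
  using assms
proof (induction arbitrary: h t rule: bs_chain.induct)
  case (start a)
  then have "edge_dist (inv u \<otimes> u) s s = edge_dist (inv u \<otimes> h) s t"
    by (intro edge_dist_cong) simp_all
  moreover have "edge_dist \<one> s s = 0" using len_zpow[of 0] by (simp add: edge_dist_def)
  ultimately show ?case using start by simp
next
  case (step a g s' L t')
  have g: "g \<in> carrier G" using step.hyps by (simp add: G_def)
  have "edge_dist (inv u \<otimes> h) s t = edge_dist (inv u \<otimes> g) s t'"
    using step.prems g by (intro edge_dist_cong) simp_all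
  also have "\<dots> \<le> edge_dist (inv u \<otimes> g) s s' + \<bar>s' - t'\<bar>" by (rule edge_dist_Lipschitz)
  also have "\<dots> \<le> L + \<bar>s' - t'\<bar>" using step.IH[of g s'] step.prems g by simp
  finally show ?case .
qed

text \<open>
  Upper bound for the metric: the geodesic is built syllable by syllable.\<close>

lemma bs_chain_edge_dist:
  assumes u: "u \<in> carrier G" and s: "0 \<le> s" "s \<le> 1"
  shows "h \<in> carrier G \<Longrightarrow> 0 \<le> t \<Longrightarrow> t \<le> 1 \<Longrightarrow> bs_chain p q (ep u s) (ep h t) (edge_dist (inv u \<otimes> h) s t)"
proof (induction "len (inv u \<otimes> h)" arbitrary: h t)
  case 0
  then obtain m :: int where "inv u \<otimes> h = z [^] m" using len_eq_0_iff[of "inv u \<otimes> h"] u by auto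
  then have "h = u \<otimes> z [^] m" using u 0 by (metis cancel_left(2))
  then have ep: "ep h t = ep u t" using u by (simp add: ep_zpow)
  have "bs_chain p q (ep u s) (ep u s) 0"
    by (rule bs_chain.start) (use u s in \<open>auto simp: bs_tree_eq\<close>)
  from bs_chain.step[OF this, of t] have "bs_chain p q (ep u s) (ep u t) (0 + \<bar>s - t\<bar>)"
    using u s 0 by (simp add: G_def)
  then show ?case using 0 ep by (simp add: edge_dist_def)
next
  case (Suc n)
  define w where "w = inv u \<otimes> h"
  define r where "r = last_type w"
  have w: "w \<in> carrier G" "0 < len w" using u Suc.prems Suc.hyps(2) by (simp_all add: w_def)
  obtain i :: int and v where v: "v \<in> carrier G" "w = v \<otimes> gn r [^] i" "len w = Suc (len v)"
    using split_last_syllable[OF w] unfolding r_def by metis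
  have h: "h = u \<otimes> v \<otimes> gn r [^] i"
    using v u Suc.prems by (simp add: m_assoc flip: v(2)) (simp add: w_def)
  have "bs_chain p q (ep u s) (ep (u \<otimes> v) (pos r)) (edge_dist (inv u \<otimes> (u \<otimes> v)) s (pos r))"
    using Suc.hyps(2) u v pos_bounds by (intro Suc.hyps(1)) (simp_all flip: w_def)
  then have "bs_chain p q (ep u s) (ep h (pos r)) (edge_dist v s (pos r))"
    using u v by (simp add: h ep_vertex)
  also have "edge_dist v s (pos r) = edge_dist w s (pos r)"
    using v by (simp add: edge_dist_vertex)
  finally have "bs_chain p q (ep u s) (ep h t) (edge_dist w s (pos r) + \<bar>pos r - t\<bar>)"
    using Suc.prems pos_bounds by (intro bs_chain.step) (simp_all add: G_def)
  also have "edge_dist w s (pos r) + \<bar>pos r - t\<bar> = edge_dist w s t"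
    using w by (simp add: edge_dist_def r_def)
  finally show ?case by (simp add: w_def)
qed

lemma bs_dist_ep:
  assumes "u \<in> carrier G" "h \<in> carrier G" "0 \<le> s" "s \<le> 1" "0 \<le> t" "t \<le> 1"
  shows "bs_dist p q (ep u s) (ep h t) = edge_dist (inv u \<otimes> h) s t"
  unfolding bs_dist_def
  by (rule cInf_eq_minimum)
    (use assms bs_chain_edge_dist bs_chain_lower in auto)

section \<open>Translation lengths and axes\<close>

lemma displacement:
  assumes "g \<in> carrier G" "u \<in> carrier G" "0 \<le> s" "s \<le> 1"
  shows "bs_dist p q (ep u s) (bs_act p q g (ep u s)) = edge_dist (conj_by u g) s s"
  using assms by (simp add: bs_act_ep bs_dist_ep conj_by_def m_assoc)

lemma edge_dist_same_nonneg: "0 \<le> edge_dist w s s"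
  by (auto simp: edge_dist_def)

lemma transl_length_image:
  "g \<in> carrier G \<Longrightarrow> transl_length p q (bs_act p q g) =
     Inf {edge_dist (conj_by u g) s s | u s. u \<in> carrier G \<and> 0 \<le> s \<and> s \<le> 1}"
  unfolding transl_length_def bs_tree_eq
  by (rule arg_cong[where f = Inf]) (force simp: displacement)

lemma transl_length_not_hyp:
  assumes "g \<in> carrier G" "\<not> hyp g"
  shows "transl_length p q (bs_act p q g) = 0"
proof -
  obtain u where u: "u \<in> carrier G" "len (conj_by u g) \<le> 1"
    using ex_short_conjugate[OF assms] .
  have "\<exists>s. 0 \<le> s \<and> s \<le> 1 \<and> edge_dist (conj_by u g) s s = 0"
  proof (cases "len (conj_by u g) = 0")
    case True
    then show ?thesis by (intro exI[of _ 0]) (simp add: edge_dist_def)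
  next
    case False
    then have 1: "len (conj_by u g) = 1" using u by simp
    then have "first_type (conj_by u g) = last_type (conj_by u g)" using odd_len_iff[of "conj_by u g"] u assms by simp
    then show ?thesis using 1
      by (intro exI[of _ "pos (first_type (conj_by u g))"]) (simp add: edge_dist_def pos_bounds)
  qed
  then have "0 \<in> {edge_dist (conj_by u g) s s | u s. u \<in> carrier G \<and> 0 \<le> s \<and> s \<le> 1}"
    using u(1) by (metis (mono_tags, lifting) mem_Collect_eq)
  then show ?thesis unfolding transl_length_image[OF assms(1)]
    by (rule cInf_eq_minimum) (auto simp: edge_dist_same_nonneg)
qed

lemma edge_dist_cyc_red: "cyc_red w \<Longrightarrow> 0 \<le> s \<Longrightarrow> s \<le> 1 \<Longrightarrow> edge_dist w s s = len w"
  using pos_ne[of s "first_type w" "last_type w"] cyc_redD(2,3)[of w] by (simp add: edge_dist_def)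

lemma edge_dist_odd:
  "w \<in> carrier G \<Longrightarrow> odd (len w) \<Longrightarrow> edge_dist w s s = 2 * \<bar>s - pos (first_type w)\<bar> + (real (len w) - 1)"
  using odd_len_iff[of w] by (auto simp: edge_dist_def odd_pos)

text \<open>
  Parity turns the weak inequality for conjugates into a strict one.\<close>

lemma odd_conjugate_len:
  assumes "cyc_red w" "u \<in> carrier G" "odd (len (conj_by u w))"
  shows "Suc (len w) \<le> len (conj_by u w)"
  using cyc_red_len_le_conjugate[OF assms(1,2)] assms
  by (metis cyc_red_def le_neq_implies_less Suc_leI)

text \<open>
  On an edge where \<open>g\<close> is given by an even element the displacement is constantly the length of that
  element.  On the other edges the element is odd and longer by at least \<open>1\<close>, which compensates for the
  possible gain at the endpoint next to the axis.\<close>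

lemma transl_length_hyp:
  assumes "u \<in> carrier G" "g \<in> carrier G" "cyc_red (conj_by u g)"
  shows "transl_length p q (bs_act p q g) = len (conj_by u g)"
proof -
  have "real (len (conj_by u g)) \<le> edge_dist (conj_by v g) s s" if v: "v \<in> carrier G" "0 \<le> s" "s \<le> 1" for v s
  proof -
    have conj_by: "conj_by (inv u \<otimes> v) (conj_by u g) = conj_by v g" using assms v by (simp add: conj_by_conj_by flip: m_assoc)
    have le: "len (conj_by u g) \<le> len (conj_by v g)"
      using cyc_red_len_le_conjugate[OF assms(3), of "inv u \<otimes> v"] assms v conj_by by simp
    show ?thesis
    proof (cases "even (len (conj_by v g))")
      case True
      then have "cyc_red (conj_by v g)" using le cyc_redD(2)[OF assms(3)] assms v by (simp add: cyc_red_def)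
      then show ?thesis using le v by (simp add: edge_dist_cyc_red)
    next
      case False
      then have "Suc (len (conj_by u g)) \<le> len (conj_by v g)"
        using odd_conjugate_len[OF assms(3), of "inv u \<otimes> v"] assms v conj_by by simp
      then have "real (len (conj_by u g)) + 1 \<le> real (len (conj_by v g))" by simp
      moreover define d where "d = \<bar>s - pos (first_type (conj_by v g))\<bar>"
      have "edge_dist (conj_by v g) s s = 2 * d + (real (len (conj_by v g)) - 1)" "0 \<le> d"
        using edge_dist_odd[of "conj_by v g" s] False v assms by (simp_all add: d_def)
      ultimately show ?thesis by linarith
    qed
  qed
  moreover have "real (len (conj_by u g)) \<in> {edge_dist (conj_by u g) s s | u s. u \<in> carrier G \<and> 0 \<le> s \<and> s \<le> 1}"
    using edge_dist_cyc_red[OF assms(3), of 0] assms(1) by force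
  ultimately show ?thesis unfolding transl_length_image[OF assms(2)]
    by (intro cInf_eq_minimum) auto
qed

lemma hyperbolic_iff: "g \<in> carrier G \<Longrightarrow> hyperbolic p q (bs_act p q g) \<longleftrightarrow> hyp g"
  using transl_length_not_hyp[of g] transl_length_hyp[of _ g] cyc_redD(2)
  by (fastforce simp: hyperbolic_def hyp_def)

text \<open>
  If the minimum is attained on an edge where \<open>g\<close> is given by an odd element, then at an endpoint of it, and
  moving the first syllable of that element to its end gives an edge of the axis at the same endpoint.\<close>

lemma transl_axis_hyp:
  assumes "hyp g"
  shows "transl_axis p q (bs_act p q g) =
    {ep u s | u s. u \<in> carrier G \<and> 0 \<le> s \<and> s \<le> 1 \<and> cyc_red (conj_by u g)}" (is "?A = ?B")
proof
  have g: "g \<in> carrier G" using assms by (simp add: hyp_def)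
  obtain u where u: "u \<in> carrier G" "cyc_red (conj_by u g)" using assms by (auto simp: hyp_def)
  show "?B \<subseteq> ?A"
    using transl_length_hyp[OF _ g] by (auto simp: transl_axis_def bs_tree_eq displacement[OF g] edge_dist_cyc_red)
  show "?A \<subseteq> ?B"
  proof
    fix a assume a: "a \<in> ?A"
    then obtain v s where v: "a = ep v s" "v \<in> carrier G" "0 \<le> s" "s \<le> 1"
      by (auto simp: transl_axis_def bs_tree_eq)
    let ?w = "conj_by v g"
    have w: "?w \<in> carrier G" using v g by simp
    have dist: "edge_dist ?w s s = len (conj_by u g)"
      using a v u g by (simp add: transl_axis_def displacement transl_length_hyp)
    have conj_by: "conj_by (inv u \<otimes> x) (conj_by u g) = conj_by x g" if "x \<in> carrier G" for x
      using u g that by (simp add: conj_by_conj_by flip: m_assoc)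
    have le: "len (conj_by u g) \<le> len (conj_by x g)" if "x \<in> carrier G" for x
      using cyc_red_len_le_conjugate[OF u(2), of "inv u \<otimes> x"] u conj_by that by simp
    have pos: "0 < len (conj_by u g)" "even (len (conj_by u g))" using u by (auto simp: cyc_red_def)
    show "a \<in> ?B"
    proof (cases "even (len ?w)")
      case True
      then have "cyc_red ?w" using le[OF v(2)] pos w by (simp add: cyc_red_def)
      then show ?thesis using v by auto
    next
      case False
      define r where "r = first_type ?w"
      have "Suc (len (conj_by u g)) \<le> len ?w"
        using odd_conjugate_len[OF u(2), of "inv u \<otimes> v"] u conj_by[OF v(2)] v False by simp
      moreover define d where "d = \<bar>s - pos r\<bar>"
      have "2 * d + (real (len ?w) - 1) = len (conj_by u g)" "0 \<le> d"
        using edge_dist_odd[OF w False, of s] dist by (simp_all add: r_def d_def)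
      ultimately have "d = 0" and lw: "len ?w = Suc (len (conj_by u g))" by linarith+
      then have sr: "s = pos r" by (simp add: d_def)
      obtain i :: int and x where x: "x \<in> carrier G" "?w = gn r [^] i \<otimes> x" "len ?w = Suc (len x)"
          "0 < len x \<Longrightarrow> last_type x = last_type ?w"
        using split_first_syllable[OF w] lw unfolding r_def by (metis zero_less_Suc)
      have v': "v \<otimes> gn r [^] i \<in> carrier G" using v by simp
      have "conj_by (v \<otimes> gn r [^] i) g = conj_by (gn r [^] i) ?w" using v g by (simp add: conj_by_conj_by)
      also have "\<dots> = x \<otimes> gn r [^] i" 
        using x(1) unfolding conj_by_def[of "gn r [^] i"] by (subst x(2)) (simp add: m_assoc)
      finally have cjx: "conj_by (v \<otimes> gn r [^] i) g = x \<otimes> gn r [^] i" .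
      have "last_type x = r" using x pos lw odd_len_iff[OF w] False by (simp add: r_def)
      then have "len (x \<otimes> gn r [^] i) < Suc (len x)"
        using len_mult_less[of x "gn r [^] i"] len_mult_le[of x "gn r [^] i"] x(1,3) lw pos
        by (cases "i mod period r = 0") (simp_all add: len_gn_pow len_mult_cong)
      then have "len (conj_by (v \<otimes> gn r [^] i) g) = len (conj_by u g)"
        using le[OF v'] cjx x(3) lw by simp
      then have "cyc_red (conj_by (v \<otimes> gn r [^] i) g)"
        using pos v' g by (simp add: cyc_red_def)
      moreover have "a = ep (v \<otimes> gn r [^] i) s" using v sr by (simp add: ep_vertex)
      ultimately show ?thesis using v v' by blast
    qed
  qed
qed

lemma conj_by_zpow: "a \<in> carrier G \<Longrightarrow> conj_by (z [^] (k::int)) a = a"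
  by (simp add: conj_by_def m_assoc flip: zpow_commute)

lemma acts_along_iff:
  "acts_along p q g \<omega> \<longleftrightarrow> hyp g \<and> transl_axis p q (bs_act p q g) = \<omega>"
  using hyperbolic_iff[of g] by (auto simp: acts_along_def hyp_def simp flip: G_def)

text \<open>
  Midpoints of edges determine the edge, so the axis remembers which conjugates are cyclically
  reduced.\<close>

lemma same_axis_cyc_red:
  assumes "hyp g" "hyp h" "transl_axis p q (bs_act p q g) = transl_axis p q (bs_act p q h)"
    and u: "u \<in> carrier G" "cyc_red (conj_by u h)"
  shows "cyc_red (conj_by u g)"
proof -
  have g: "g \<in> carrier G" using assms by (simp add: hyp_def)
  have "ep u (1/2) \<in> transl_axis p q (bs_act p q h)"
    unfolding transl_axis_hyp[OF assms(2)] using u by force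
  then have "ep u (1/2) \<in> transl_axis p q (bs_act p q g)" using assms by simp
  then obtain v s where v: "ep u (1/2) = ep v s" "v \<in> carrier G" "cyc_red (conj_by v g)"
    unfolding transl_axis_hyp[OF assms(1)] by blast
  moreover have "1/2 \<noteq> pos r" for r by (cases r) (simp_all add: pos_def)
  ultimately obtain k :: int where "v = u \<otimes> z [^] k" using u ep_eq_iff by blast
  then have "conj_by v g = conj_by (z [^] k) (conj_by u g)" using u g by (simp add: conj_by_conj_by)
  also have "\<dots> = conj_by u g" using u g by (intro conj_by_zpow) simp
  finally have "conj_by v g = conj_by u g" .
  then show ?thesis using v by simp
qed

lemma same_transl_axis_commute:
  assumes "hyp g" "hyp h" "transl_axis p q (bs_act p q g) = transl_axis p q (bs_act p q h)"
  shows "g \<otimes> h = h \<otimes> g"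
proof -
  obtain u where u: "u \<in> carrier G" "cyc_red (conj_by u h)" using assms by (auto simp: hyp_def)
  have gh: "g \<in> carrier G" "h \<in> carrier G" using assms by (auto simp: hyp_def)
  note * = same_axis_cyc_red[OF assms]
  have "conj_by u g \<otimes> conj_by u h = conj_by u h \<otimes> conj_by u g"
    by (rule same_axis_commute) (use u gh * in \<open>simp_all add: conj_by_conj_by\<close>)
  then show ?thesis using u gh by (simp add: conj_by_commute_iff)
qed

lemma hyp_int_pow_iff: "g \<in> carrier G \<Longrightarrow> k \<noteq> 0 \<Longrightarrow> hyp (g [^] (k::int)) \<longleftrightarrow> hyp g"
  by (auto simp: hyp_def conj_by_int_pow cyc_red_int_pow_iff)

lemma transl_axis_int_pow:
  assumes "hyp g" "k \<noteq> 0"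
  shows "transl_axis p q (bs_act p q (g [^] (k::int))) = transl_axis p q (bs_act p q g)"
proof -
  have "g \<in> carrier G" using assms by (simp add: hyp_def)
  then have "cyc_red (conj_by u (g [^] k)) \<longleftrightarrow> cyc_red (conj_by u g)" if "u \<in> carrier G" for u
    using that assms by (simp add: conj_by_int_pow cyc_red_int_pow_iff)
  then show ?thesis
    unfolding transl_axis_hyp[OF assms(1)] transl_axis_hyp[OF hyp_int_pow[OF assms]] by blast
qed

lemma bs_act_zpow:
  assumes "g \<in> carrier G" "a \<in> bs_tree p q"
  shows "bs_act p q (g \<otimes> z [^] (m::int)) a = bs_act p q g a"
proof -
  obtain u s where u: "a = ep u s" "u \<in> carrier G" using assms by (auto simp: bs_tree_eq)
  then have "g \<otimes> z [^] m \<otimes> u = g \<otimes> u \<otimes> z [^] m" using assms by (simp add: m_assoc zpow_commute)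
  then show ?thesis using u assms by (simp add: bs_act_ep ep_zpow)
qed

lemma transl_zpow:
  assumes "g \<in> carrier G"
  shows "transl_length p q (bs_act p q (g \<otimes> z [^] (m::int))) = transl_length p q (bs_act p q g)"
    "transl_axis p q (bs_act p q (g \<otimes> z [^] m)) = transl_axis p q (bs_act p q g)"
    "hyp (g \<otimes> z [^] m) \<longleftrightarrow> hyp g"
proof -
  show len: "transl_length p q (bs_act p q (g \<otimes> z [^] m)) = transl_length p q (bs_act p q g)"
    using assms by (simp add: transl_length_def bs_act_zpow)
  show "transl_axis p q (bs_act p q (g \<otimes> z [^] m)) = transl_axis p q (bs_act p q g)"
    using assms len by (auto simp: transl_axis_def bs_act_zpow)
  show "hyp (g \<otimes> z [^] m) \<longleftrightarrow> hyp g"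
    using hyperbolic_iff[of g] hyperbolic_iff[of "g \<otimes> z [^] m"] assms len
    by (simp add: hyperbolic_def)
qed

lemma transl_length_int_pow:
  assumes "hyp g"
  shows "transl_length p q (bs_act p q (g [^] (k::int))) = \<bar>k\<bar> * transl_length p q (bs_act p q g)"
proof (cases "k = 0")
  case True
  have "\<not> hyp \<one>" using hyp_len[of \<one>] len_zpow[of 0] by auto
  then show ?thesis using True transl_length_not_hyp[of \<one>] by simp
next
  case False
  obtain u where u: "u \<in> carrier G" "cyc_red (conj_by u g)" and g: "g \<in> carrier G"
    using assms by (auto simp: hyp_def)
  have "cyc_red (conj_by u (g [^] k))" using u g False by (simp add: conj_by_int_pow cyc_red_int_pow)
  then have "transl_length p q (bs_act p q (g [^] k)) = len (conj_by u (g [^] k))"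
    using u g by (intro transl_length_hyp) simp_all
  also have "\<dots> = \<bar>k\<bar> * transl_length p q (bs_act p q g)"
    using u g by (simp add: transl_length_hyp[OF u(1) g u(2)] conj_by_int_pow len_int_pow)
  finally show ?thesis by simp
qed

lemma transl_length_pos: "hyp g \<Longrightarrow> 0 < transl_length p q (bs_act p q g)"
  using hyperbolic_iff by (auto simp: hyperbolic_def hyp_def)

text \<open>
  If \<open>c\<close> generates the centralizer of \<open>g\<close> together with \<open>z\<close>, then \<open>g = c ^ k z ^ m\<close>.  Elements with the
  axis of \<open>c\<close> commute with \<open>g\<close>, so their translation lengths are multiples of that of \<open>c\<close>; thus \<open>c ^ k\<close>
  acts directly.\<close>

lemma ex_acts_directly:
  assumes "hyp g"
  obtains g' and m :: int where "acts_directly p q g'" "g' \<in> carrier G" "g = g' \<otimes> z [^] m"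
proof -
  have g: "g \<in> carrier G" using assms by (simp add: hyp_def)
  obtain c where c: "c \<in> cent g" "\<And>a. a \<in> cent g \<Longrightarrow> \<exists>(i::int) (m::int). a = c [^] i \<otimes> z [^] m"
    using cent_hyp_generator[OF assms] by metis
  have c': "c \<in> carrier G" using c by (simp add: cent_def)
  obtain k m :: int where km: "g = c [^] k \<otimes> z [^] m"
    using c(2)[of g] g by (auto simp: cent_def)
  have "k \<noteq> 0"
  proof
    assume "k = 0"
    then have "len g = 0" using km by simp
    then show False using hyp_len[OF assms] by simp
  qed
  have hk: "hyp (c [^] k)" using assms km transl_zpow(3)[of "c [^] k" m] c' by simp
  then have hc: "hyp c" using hyp_int_pow_iff[OF c' \<open>k \<noteq> 0\<close>] by simp
  let ?\<omega> = "transl_axis p q (bs_act p q c)"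
  have min: "transl_length p q (bs_act p q c) \<le> transl_length p q (bs_act p q h)"
    if "acts_along p q h ?\<omega>" for h
  proof -
    have h: "hyp h" "transl_axis p q (bs_act p q h) = ?\<omega>" using that by (auto simp: acts_along_iff)
    then have h': "h \<in> carrier G" by (simp add: hyp_def)
    have "h \<otimes> c = c \<otimes> h" using h hc by (intro same_transl_axis_commute) auto
    then have "h \<otimes> c [^] k = c [^] k \<otimes> h" using h' c' by (rule commute_int_pow)
    then have "h \<otimes> g = g \<otimes> h" unfolding km using h' c'
      by (simp add: m_assoc zpow_commute) (simp flip: m_assoc)
    then obtain i j :: int where ij: "h = c [^] i \<otimes> z [^] j" using c(2)[of h] h' by (auto simp: cent_def)
    have "i \<noteq> 0" using ij h(1) hyp_len[of h] by auto
    have "transl_length p q (bs_act p q h) = \<bar>i\<bar> * transl_length p q (bs_act p q c)"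
      using ij c' transl_zpow(1)[of "c [^] i" j] transl_length_int_pow[OF hc, of i] by simp
    moreover have "1 * transl_length p q (bs_act p q c) \<le> \<bar>i\<bar> * transl_length p q (bs_act p q c)"
      using \<open>i \<noteq> 0\<close> transl_length_pos[OF hc] by (intro mult_right_mono) auto
    ultimately show ?thesis by simp
  qed
  have "acts_directly_along p q (c [^] k) ?\<omega>"
    unfolding acts_directly_along_def
  proof (intro conjI exI[of _ c] exI[of _ k])
    show "acts_along p q (c [^] k) ?\<omega>"
      using hk transl_axis_int_pow[OF hc \<open>k \<noteq> 0\<close>] by (simp add: acts_along_iff)
    show "acts_along p q c ?\<omega>" using hc by (simp add: acts_along_iff)
    show "c [^] k = c [^]\<^bsub>Gpq p q\<^esub> k" by (simp add: G_def)
  qed (use min \<open>k \<noteq> 0\<close> in auto)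
  then have "acts_directly p q (c [^] k)" unfolding acts_directly_def by blast
  then show ?thesis using that[OF _ _ km] c' by simp
qed

text \<open>
  With \<open>e\<close> a generator of the centralizer modulo \<open>\<langle>z\<rangle>\<close>, the minimal \<open>c\<close> is \<open>e ^ a\<close> times a power of
  \<open>z\<close>.  As \<open>e\<close> has the same axis, minimality forces \<open>a\<close> to be \<open>1\<close> or \<open>-1\<close>.\<close>

lemma acts_directly_cent:
  assumes "acts_directly p q g"
  obtains c and k :: int where "hyp c" "k \<noteq> 0" "g = c [^] k" "hyp g"
    "\<And>a. a \<in> cent g \<Longrightarrow> \<exists>(i::int) (m::int). a = c [^] i \<otimes> z [^] m"
proof -
  obtain \<omega> c and k :: int where d: "acts_along p q g \<omega>" "acts_along p q c \<omega>" "k \<noteq> 0" "g = c [^] k"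
    and min: "\<And>h. acts_along p q h \<omega> \<Longrightarrow>
      transl_length p q (bs_act p q c) \<le> transl_length p q (bs_act p q h)"
    using assms unfolding acts_directly_def acts_directly_along_def G_def by blast
  have h: "hyp g" "hyp c" using d by (auto simp: acts_along_iff)
  then have cg: "c \<in> carrier G" "g \<in> carrier G" by (auto simp: hyp_def)
  obtain e where e: "e \<in> cent g" "\<And>a. a \<in> cent g \<Longrightarrow> \<exists>(i::int) (m::int). a = e [^] i \<otimes> z [^] m"
    using cent_hyp_generator[OF h(1)] by metis
  have e': "e \<in> carrier G" using e by (simp add: cent_def)
  have "c \<in> cent g" using cg d(4) by (simp add: cent_def commute_int_pow)
  then obtain a b :: int where ab: "c = e [^] a \<otimes> z [^] b" using e by blast
  have "a \<noteq> 0" using ab hyp_len[OF h(2)] by auto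
  have "hyp (e [^] a)" using h(2) ab transl_zpow(3)[of "e [^] a" b] e' by simp
  then have he: "hyp e" using hyp_int_pow_iff[OF e' \<open>a \<noteq> 0\<close>] by simp
  have "acts_along p q e \<omega>"
    using d(2) ab e' transl_zpow(2)[of "e [^] a" b] transl_axis_int_pow[OF he \<open>a \<noteq> 0\<close>] he
    by (simp add: acts_along_iff)
  then have "transl_length p q (bs_act p q c) \<le> transl_length p q (bs_act p q e)" by (rule min)
  moreover have "transl_length p q (bs_act p q c) = \<bar>a\<bar> * transl_length p q (bs_act p q e)"
    using ab e' transl_zpow(1)[of "e [^] a" b] transl_length_int_pow[OF he, of a] by simp
  ultimately have "real_of_int \<bar>a\<bar> \<le> 1"
    using transl_length_pos[OF he] by simp
  then have "\<bar>a\<bar> \<le> 1" by linarith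
  then have "a = 1 \<or> a = -1" using \<open>a \<noteq> 0\<close> by linarith
  then have aa: "a * a = 1" by auto
  have "\<exists>(i::int) (m::int). x = c [^] i \<otimes> z [^] m" if x: "x \<in> cent g" for x
  proof -
    obtain i m :: int where im: "x = e [^] i \<otimes> z [^] m" using e(2)[OF x] by blast
    have "c [^] (a * i) = e [^] (a * (a * i)) \<otimes> z [^] (b * (a * i))"
      unfolding ab using e' by (subst int_pow_mult_distrib) (simp_all add: int_pow_pow zpow_commute)
    also have "a * (a * i) = i" using aa by (simp flip: mult.assoc)
    finally have "x = c [^] (a * i) \<otimes> z [^] (m - b * (a * i))"
      using im e' by (simp add: m_assoc flip: int_pow_mult)
    then show ?thesis by blast
  qed
  then show ?thesis by (rule that[OF h(2) d(3,4) h(1)])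
qed

end

section \<open>Cyclic subgroups\<close>

context group
begin

lemma max_cyclic_eqI:
  assumes "c \<in> carrier G" "g \<in> generate G {c}"
    and "\<And>e (n::int). e \<in> carrier G \<Longrightarrow> g = e [^] n \<Longrightarrow> e \<in> generate G {c}"
  shows "max_cyclic G g = generate G {c}"
  unfolding max_cyclic_def
proof (rule the_equality)
  have *: "D \<subseteq> generate G {c}" if "cyclic_subgroup G D" "g \<in> D" for D
  proof -
    obtain e where e: "e \<in> carrier G" "D = generate G {e}"
      using \<open>cyclic_subgroup G D\<close> by (auto simp: cyclic_subgroup_def)
    then obtain n :: int where "g = e [^] n" using \<open>g \<in> D\<close> by (auto simp: generate_pow)
    then have "e \<in> generate G {c}" using e assms(3) by blast
    then show ?thesis
      using e(2) assms(1) generate_subgroup_incl[OF _ generate_is_subgroup] by simp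
  qed
  show **: "cyclic_subgroup G (generate G {c}) \<and> g \<in> generate G {c} \<and>
      (\<forall>D. cyclic_subgroup G D \<and> g \<in> D \<longrightarrow> D \<subseteq> generate G {c})"
    using assms * by (auto simp: cyclic_subgroup_def)
  show "C = generate G {c}" if "cyclic_subgroup G C \<and> g \<in> C \<and>
      (\<forall>D. cyclic_subgroup G D \<and> g \<in> D \<longrightarrow> D \<subseteq> C)" for C
    using that ** by (intro subset_antisym) blast+
qed

lemma generate_iso_integer_group:
  assumes "c \<in> carrier G" "\<And>n::int. c [^] n = \<one> \<Longrightarrow> n = 0"
  shows "G\<lparr>carrier := generate G {c}\<rparr> \<cong> integer_group"
proof -
  have "m = n" if "c [^] m = c [^] n" for m n :: int
    using assms(2)[of "m - n"] that assms(1) by (simp add: int_pow_diff)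
  then have "(\<lambda>n. c [^] n) \<in> iso integer_group (G\<lparr>carrier := generate G {c}\<rparr>)"
    using assms(1) by (auto simp: iso_def hom_def bij_betw_def inj_on_def int_pow_mult generate_pow)
  then have "integer_group \<cong> G\<lparr>carrier := generate G {c}\<rparr>" by (auto simp: is_iso_def)
  then show ?thesis by (rule group.iso_sym[OF group_integer_group])
qed

lemma conj_by_vimage_generate:
  assumes "u \<in> carrier G" "d \<in> carrier G"
  shows "{a \<in> carrier G. conj_by u a \<in> generate G {d}} = generate G {conj_by (inv u) d}"
proof -
  have "conj_by u a = d [^] n \<longleftrightarrow> a = conj_by (inv u) d [^] n" if "a \<in> carrier G" for a and n :: int
  proof -
    have "conj_by u a = d [^] n \<longleftrightarrow> conj_by (inv u) (conj_by u a) = conj_by (inv u) (d [^] n)"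
      using assms that by (simp add: conj_by_def)
    then show ?thesis using assms that by (simp add: conj_by_conj_by conj_by_int_pow)
  qed
  then show ?thesis using assms by (auto simp: generate_pow)
qed

end

section \<open>The inversion automorphism\<close>

context knot_group
begin

abbreviation tu :: "gen word set \<Rightarrow> gen word set" where
  "tu \<equiv> tau p q"

lemma hom_eqI:
  assumes "f \<in> hom G G" "f' \<in> hom G G" "\<And>t. f (gn t) = f' (gn t)" "g \<in> carrier G"
  shows "f g = f' g"
proof -
  interpret f: group_hom G G f using assms(1) by unfold_locales
  interpret f': group_hom G G f' using assms(2) by unfold_locales
  show ?thesis using assms(4)
    by (induction g rule: G_induct) (simp_all add: assms(3) f.hom_mult f'.hom_mult)
qed

text \<open>
  The inverses of the generators satisfy the defining relation, so von Dyck's theorem gives the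
  endomorphism; it is its own inverse.\<close>

lemma tau_auto: "tu \<in> auto G" and tau_gn: "tu (gn t) = inv (gn t)"
proof -
  define f where "f t = inv (gn t)" for t
  have ev: "word_eval G f (replicate n (t, True)) = inv (gn t) [^] n" for n t
  proof (induction n)
    case (Suc n)
    have "inv (gn t) \<otimes> inv (gn t) [^] n = inv (gn t) [^] Suc n"
      by (rule nat_pow_Suc2[symmetric]) simp
    then show ?case using Suc by (simp add: word_eval_def f_def)
  qed (simp add: word_eval_def)
  have rel: "inv (gn Gen_x) [^] p = inv (gn Gen_y) [^] q"
    using gn_pow_period[of Gen_x] gn_pow_period[of Gen_y] by (simp add: nat_pow_inv period_def int_pow_int)
  obtain F where F: "F \<in> hom (presented_group (Gpq_rels p q)) G" "\<And>u. F (cls u) = word_eval G f u"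
    by (rule presented_group_lift[of f "Gpq_rels p q"]) (auto simp: Gpq_rels_def ev rel f_def)
  have hom: "F \<in> hom G G" using F(1) by (simp add: G_def Gpq_def)
  have gn: "F (gn t) = inv (gn t)" for t
    using F(2)[of "[(t, True)]"] ev[of 1 t] by (simp flip: gn_def)
  interpret F: group_hom G G F using hom by unfold_locales
  have FF: "F (F g) = g" if "g \<in> carrier G" for g
  proof -
    have "(\<lambda>a. F (F a)) \<in> hom G G" by (simp add: hom_def F.hom_mult)
    then show ?thesis
      using hom_eqI[of "\<lambda>a. F (F a)" "\<lambda>a. a" g] that by (simp add: gn hom_def)
  qed
  define \<phi> where "\<phi> = restrict F (carrier G)"
  have "bij_betw \<phi> (carrier G) (carrier G)"
    by (rule bij_betwI[of _ _ _ \<phi>]) (simp_all add: \<phi>_def FF)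
  then have 1: "\<phi> \<in> auto G"
    by (simp add: auto_def Bij_def \<phi>_def hom_def F.hom_mult)
  have 2: "\<phi> (gn t) = inv (gn t)" for t by (simp add: \<phi>_def gn)
  have gens: "Gpq_x p q = gn Gen_x" "Gpq_y p q = gn Gen_y"
    by (simp_all add: gn_def Gpq_x_def Gpq_y_def)
  have "tu = \<phi>"
    unfolding tau_def gens G_def[symmetric]
  proof (rule the_equality)
    fix \<psi> assume \<psi>: "\<psi> \<in> auto G \<and> \<psi> (gn Gen_x) = inv (gn Gen_x) \<and> \<psi> (gn Gen_y) = inv (gn Gen_y)"
    have "\<psi> g = \<phi> g" if "g \<in> carrier G" for g
    proof (rule hom_eqI[where f = \<psi> and f' = \<phi> and g = g])
      show "\<psi> (gn t) = \<phi> (gn t)" for t using \<psi> 2 by (cases t) simp_all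
    qed (use that 1 \<psi> in \<open>simp_all add: auto_def\<close>)
    then show "\<psi> = \<phi>"
      using \<psi> 1 by (intro extensionalityI[of _ "carrier G"]) (auto simp: auto_def Bij_def)
  qed (use 1 2 in simp)
  then show "tu \<in> auto G" "tu (gn t) = inv (gn t)" using 1 2 by simp_all
qed

lemma tau_hom: "tu \<in> hom G G"
  using tau_auto by (simp add: auto_def)

interpretation tau: group_hom G G tu
  using tau_hom by unfold_locales

lemma tau_closed [simp]: "g \<in> carrier G \<Longrightarrow> tu g \<in> carrier G"
  by (rule tau.hom_closed)

lemma tau_mult: "g \<in> carrier G \<Longrightarrow> h \<in> carrier G \<Longrightarrow> tu (g \<otimes> h) = tu g \<otimes> tu h"
  by (rule tau.hom_mult)

lemma tau_inv: "g \<in> carrier G \<Longrightarrow> tu (inv g) = inv (tu g)"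
  by (rule tau.hom_inv)

lemma tau_one: "tu \<one> = \<one>"
  by (rule tau.hom_one)

lemma tau_int_pow: "g \<in> carrier G \<Longrightarrow> tu (g [^] (k::int)) = tu g [^] k"
  by (rule tau.hom_int_pow)

lemma tau_tau: "g \<in> carrier G \<Longrightarrow> tu (tu g) = g"
proof -
  assume "g \<in> carrier G"
  moreover have "(\<lambda>a. tu (tu a)) \<in> hom G G" by (simp add: hom_def tau_mult)
  ultimately show ?thesis
    using hom_eqI[of "\<lambda>a. tu (tu a)" "\<lambda>a. a" g] by (simp add: tau_gn hom_def)
qed

lemma tau_gn_pow: "tu (gn t [^] (k::int)) = gn t [^] (- k)"
  by (simp add: tau_int_pow tau_gn int_pow_inv int_pow_neg)

lemma tau_zpow: "tu (z [^] (m::int)) = z [^] (- m)"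
proof -
  have "z [^] m = gn Gen_x [^] (period Gen_x * m)" for m :: int by (simp add: z_def int_pow_pow)
  then show ?thesis by (simp only: tau_gn_pow) simp
qed

text \<open>
  Inverting a syllable \<open>t ^ k\<close> gives \<open>z ^ (-1)\<close> times the syllable with the complementary exponent.\<close>

lemma tau_val: "tu (val l) = z [^] (- int (length l)) \<otimes> val (flip_exps l)"
proof (induction l rule: val.induct)
  case (2 t k l)
  have "tu (val ((t, k) # l)) = gn t [^] (- k) \<otimes> tu (val l)"
    by (simp add: tau_mult tau_gn_pow)
  also have "\<dots> = (z [^] (-1::int) \<otimes> gn t [^] (period t - k)) \<otimes> (z [^] (- int (length l)) \<otimes> val (flip_exps l))"
    using 2 by (simp add: gn_pow_minus int_pow_neg[of z 1])
  also have "\<dots> = z [^] (-1 + - int (length l)) \<otimes> val (flip_exps ((t, k) # l))"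
    by (simp add: m_assoc gn_collect zpow_collect(1))
  also have "-1 + - int (length l) = - int (length ((t, k) # l))" by simp
  finally show ?case .
qed (simp add: tau_one)

lemma nf_tau:
  assumes "g \<in> carrier G"
  shows "nf (tu g) = flip_exps (nf g)"
proof -
  obtain m :: int where m: "g = z [^] m \<otimes> val (nf g)" using assms by (rule nf_decomp)
  have "tu (z [^] m \<otimes> val (nf g)) = z [^] (- m + - int (length (nf g))) \<otimes> val (flip_exps (nf g))"
    by (simp add: tau_mult tau_zpow tau_val zpow_collect(1))
  then have eq: "tu g = z [^] (- m + - int (length (nf g))) \<otimes> val (flip_exps (nf g))"
    using m by simp
  show ?thesis unfolding eq by (rule nf_zpow_val) (intro red_flip_exps red_nf assms)
qed

lemma len_tau [simp]: "g \<in> carrier G \<Longrightarrow> len (tu g) = len g"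
  by (simp add: len_def nf_tau)

lemma first_type_tau: "g \<in> carrier G \<Longrightarrow> 0 < len g \<Longrightarrow> first_type (tu g) = first_type g"
  by (simp add: len_pos_iff first_type_def nf_tau)

lemma deg_one: "deg \<one> = 0"
  using deg_int_pow[of \<one> 0] by simp

lemma deg_tau: "g \<in> carrier G \<Longrightarrow> deg (tu g) = - deg g"
  by (induction g rule: G_induct) (simp_all add: tau_mult tau_inv tau_one tau_gn deg_mult deg_inv deg_one)

section \<open>Fixed points of twisted inversions\<close>

text \<open>
  The fixed subgroup of the inversion followed by conjugation with \<open>g\<close> (\<open>Fix_conj_tau\<close>).\<close>

definition twisted_fix :: "gen word set \<Rightarrow> gen word set set" where
  "twisted_fix g = {a \<in> carrier G. g \<otimes> tu a = a \<otimes> g}"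

lemma subgroup_twisted_fix:
  assumes g: "g \<in> carrier G"
  shows "subgroup (twisted_fix g) G"
proof (rule subgroupI)
  show "twisted_fix g \<noteq> {}" using g by (auto simp: twisted_fix_def tau_one intro!: exI[of _ \<one>])
next
  fix a assume "a \<in> twisted_fix g"
  then have a: "a \<in> carrier G" "g \<otimes> tu a = a \<otimes> g" by (auto simp: twisted_fix_def)
  then have "inv a \<otimes> (g \<otimes> tu a) \<otimes> inv (tu a) = inv a \<otimes> (a \<otimes> g) \<otimes> inv (tu a)" by simp
  then show "inv a \<in> twisted_fix g" using a(1) g by (simp add: twisted_fix_def m_assoc tau_inv)
next
  fix a b assume "a \<in> twisted_fix g" "b \<in> twisted_fix g"
  then have a: "a \<in> carrier G" "g \<otimes> tu a = a \<otimes> g" and b: "b \<in> carrier G" "g \<otimes> tu b = b \<otimes> g"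
    by (auto simp: twisted_fix_def)
  have "g \<otimes> tu (a \<otimes> b) = (g \<otimes> tu a) \<otimes> tu b" using a(1) b(1) g by (simp add: tau_mult m_assoc)
  also have "\<dots> = (a \<otimes> g) \<otimes> tu b" by (simp only: a(2))
  also have "\<dots> = a \<otimes> (g \<otimes> tu b)" using a(1) b(1) g by (simp add: m_assoc)
  also have "\<dots> = a \<otimes> (b \<otimes> g)" by (simp only: b(2))
  also have "\<dots> = a \<otimes> b \<otimes> g" using a(1) b(1) g by (simp add: m_assoc)
  finally show "a \<otimes> b \<in> twisted_fix g" using a b by (simp add: twisted_fix_def)
qed (auto simp: twisted_fix_def)

lemma twisted_fix_twisted_conjugate:
  assumes "h \<in> carrier G" "g \<in> carrier G"
  shows "twisted_fix (h \<otimes> g \<otimes> inv (tu h)) = {a \<in> carrier G. conj_by h a \<in> twisted_fix g}"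
proof -
  have "h \<otimes> g \<otimes> inv (tu h) \<otimes> tu a = a \<otimes> (h \<otimes> g \<otimes> inv (tu h)) \<longleftrightarrow> g \<otimes> tu (conj_by h a) = conj_by h a \<otimes> g"
    if a: "a \<in> carrier G" for a
  proof -
    have "h \<otimes> g \<otimes> inv (tu h) \<otimes> tu a = h \<otimes> (g \<otimes> tu (conj_by h a)) \<otimes> inv (tu h)"
      using assms a by (simp add: conj_by_def tau_mult tau_inv m_assoc)
    moreover have "a \<otimes> (h \<otimes> g \<otimes> inv (tu h)) = h \<otimes> (conj_by h a \<otimes> g) \<otimes> inv (tu h)"
      using assms a by (simp add: conj_by_def m_assoc)
    ultimately show ?thesis using assms a by simp
  qed
  then show ?thesis using assms by (auto simp: twisted_fix_def)
qed

lemma twisted_fix_zpow: "g \<in> carrier G \<Longrightarrow> twisted_fix (g \<otimes> z [^] (m::int)) = twisted_fix g"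
proof -
  assume g: "g \<in> carrier G"
  have "g \<otimes> z [^] m \<otimes> tu a = z [^] m \<otimes> (g \<otimes> tu a)" "a \<otimes> (g \<otimes> z [^] m) = z [^] m \<otimes> (a \<otimes> g)"
    if "a \<in> carrier G" for a
    using g that by (simp_all add: m_assoc flip: zpow_commute zpow_left_commute)
  then show ?thesis using g by (auto simp: twisted_fix_def)
qed

text \<open>
  Both sides of the fixed point equation have the same degree, so a fixed point has degree \<open>0\<close>.\<close>

lemma twisted_fix_len_0:
  assumes "g \<in> carrier G" "a \<in> twisted_fix g" "len a = 0"
  shows "a = \<one>"
proof -
  have a: "a \<in> carrier G" "g \<otimes> tu a = a \<otimes> g" using assms by (auto simp: twisted_fix_def)
  have "deg g + deg (tu a) = deg a + deg g"
    using arg_cong[OF a(2), of deg] a(1) assms(1) by (simp add: deg_mult)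
  then show ?thesis using a(1) assms(3) by (intro len_0_deg_0) (simp_all add: deg_tau)
qed

lemma flip_exps_fixed: "flip_exps l = l \<Longrightarrow> (t, k) \<in> set l \<Longrightarrow> 2 * k = period t"
  by (induction l rule: val.induct) auto

lemma deg_val_flip_fixed: "flip_exps l = l \<Longrightarrow> 2 * deg (val l) = int (length l) * deg z"
proof (induction l rule: val.induct)
  case (2 t k l)
  then have k: "2 * k = period t" by simp
  have "2 * (k * deg (gn t)) = deg z"
    using deg_gn[of t] k by (simp add: deg_z mult.commute flip: mult.assoc)
  then show ?case using 2 by (simp add: deg_mult deg_int_pow algebra_simps)
qed (simp add: deg_one)

lemma tau_fixed_flip: "a \<in> twisted_fix \<one> \<Longrightarrow> flip_exps (nf a) = nf a"
  using nf_tau[of a] by (auto simp: twisted_fix_def)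

text \<open>
  All exponents of a fixed point are half the period, so each syllable has half the degree of \<open>z\<close>.  The
  total degree is \<open>0\<close>, so the number of syllables must be even.\<close>

lemma tau_fixed_even:
  assumes "a \<in> twisted_fix \<one>"
  shows "even (len a)"
proof -
  have a: "a \<in> carrier G" "tu a = a" using assms by (auto simp: twisted_fix_def)
  obtain m :: int where m: "a = z [^] m \<otimes> val (nf a)" using a(1) by (rule nf_decomp)
  have "2 * deg a = 0" using deg_tau[OF a(1)] a(2) by simp
  moreover have "deg a = m * deg z + deg (val (nf a))"
    using arg_cong[OF m, of deg] by (simp add: deg_mult deg_int_pow)
  moreover have "2 * deg (val (nf a)) = int (len a) * deg z"
    using deg_val_flip_fixed[OF tau_fixed_flip[OF assms]] by (simp add: len_def)
  ultimately have "(2 * m + int (len a)) * deg z = 0" by (simp add: algebra_simps)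
  then have "int (len a) = 2 * (- m)" using deg_z_pos by auto
  then have "even (int (len a))" by simp
  then show ?thesis by simp
qed

text \<open>
  A fixed point of positive length is even, hence contains syllables of both types, with exponents half
  the respective periods; that is impossible if one period is odd.\<close>

lemma twisted_fix_one_trivial:
  assumes "odd (period t)"
  shows "twisted_fix \<one> = {\<one>}"
proof -
  have "a = \<one>" if a: "a \<in> twisted_fix \<one>" for a
  proof (rule twisted_fix_len_0[OF _ a])
    have ac: "a \<in> carrier G" using a by (simp add: twisted_fix_def)
    show "len a = 0"
    proof (rule ccontr)
      assume ne: "len a \<noteq> 0"
      then have "first_type a \<noteq> last_type a" using odd_len_iff[OF ac] tau_fixed_even[OF a] by simp
      then have "t = first_type a \<or> t = last_type a" using gen_eq_third by metis
      moreover have "hd (nf a) \<in> set (nf a)" "last (nf a) \<in> set (nf a)"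
        using ne by (simp_all add: len_def)
      ultimately obtain k where "(t, k) \<in> set (nf a)" unfolding first_type_def last_type_def by (metis prod.collapse)
      then have "2 * k = period t" by (rule flip_exps_fixed[OF tau_fixed_flip[OF a]])
      then show False using assms by (metis dvd_triv_left)
    qed
  qed simp
  then show ?thesis using subgroup.one_closed[OF subgroup_twisted_fix[of \<one>]] by auto
qed

lemma signed_len_int_pow:
  assumes "cyc_red g"
  shows "signed_len (g [^] (k::int)) = k * signed_len g"
proof -
  note g = cyc_redD[OF assms]
  have nat: "signed_len (h [^] n) = int n * signed_len h" if "cyc_red h" for h and n :: nat
    using cyc_red_nat_pow[OF that, of n] cyc_redD(2)[OF that] by (cases "n = 0") (auto simp: signed_len_def)
  have inv: "signed_len (inv g) = - signed_len g"
    using g by (cases "first_type g"; cases "last_type g") (auto simp: signed_len_def first_type_inv)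
  show ?thesis
  proof (cases k rule: int_cases2)
    case (nonneg n)
    then show ?thesis using nat[OF assms] by (simp add: int_pow_int)
  next
    case (nonpos n)
    then have "g [^] k = inv g [^] n" using g(1) by (simp add: int_pow_neg int_pow_int nat_pow_inv)
    then show ?thesis using nat[OF cyc_red_inv[OF assms], of n] inv nonpos by simp
  qed
qed

lemma int_pow_eq_one_cyc_red: "cyc_red g \<Longrightarrow> g [^] (n::int) = \<one> \<Longrightarrow> n = 0"
  using len_int_pow[of g n] len_zpow[of 0] cyc_redD(2)[of g] by simp

text \<open>The product of the half periods; the inversion multiplies the two factors by opposite
  powers of \<open>z\<close>.\<close>

definition half_quotient :: "gen word set" where
  "half_quotient = gn Gen_x [^] (int p div 2) \<otimes> gn Gen_y [^] (- (int q div 2))"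

lemma half_quotient:
  assumes "even p" "even q"
  shows "half_quotient \<in> twisted_fix \<one>" "cyc_red half_quotient" "signed_len half_quotient = 2"
proof -
  let ?a = "gn Gen_x [^] (int p div 2)" and ?b = "gn Gen_y [^] (- (int q div 2))"
  have pq: "period Gen_x = 2 * (int p div 2)" "period Gen_y = 2 * (int q div 2)"
    using assms by (simp_all add: period_def)
  have mod: "(int p div 2) mod period Gen_x \<noteq> 0" "(- (int q div 2)) mod period Gen_y \<noteq> 0"
    using p2 q2 assms by (auto simp: period_def mod_eq_0_iff_dvd elim!: evenE)
  have tauab: "tu ?a = z [^] (-1::int) \<otimes> ?a" "tu ?b = ?b \<otimes> z [^] (1::int)"
  proof -
    have "z \<otimes> gn Gen_x [^] (- (int p div 2)) = gn Gen_x [^] (period Gen_x + - (int p div 2))"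
      by (simp only: int_pow_mult gn_closed gn_pow_period)
    then have "z \<otimes> gn Gen_x [^] (- (int p div 2)) = ?a" by (simp add: pq)
    moreover have "z [^] (-1::int) \<otimes> (z \<otimes> gn Gen_x [^] (- (int p div 2))) = gn Gen_x [^] (- (int p div 2))"
      by (simp add: int_pow_neg)
    ultimately show "tu ?a = z [^] (-1::int) \<otimes> ?a" by (simp add: tau_gn_pow)
    have "?b \<otimes> z = gn Gen_y [^] (- (int q div 2) + period Gen_y)"
      by (simp only: int_pow_mult gn_closed gn_pow_period)
    then show "tu ?b = ?b \<otimes> z [^] (1::int)" by (simp add: tau_gn_pow pq)
  qed
  have "tu half_quotient = (z [^] (-1::int) \<otimes> ?a) \<otimes> (?b \<otimes> z [^] (1::int))"
    by (simp only: half_quotient_def tau_mult gn_closed int_pow_closed tauab)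
  also have "\<dots> = z [^] (-1::int) \<otimes> (half_quotient \<otimes> z [^] (1::int))"
    by (simp add: half_quotient_def m_assoc)
  also have "\<dots> = half_quotient"
    by (simp add: half_quotient_def int_pow_neg flip: z_commute)
  finally show "half_quotient \<in> twisted_fix \<one>" by (simp add: twisted_fix_def half_quotient_def)
  have "len half_quotient = 1 + 1" "first_type half_quotient = Gen_x"
    unfolding half_quotient_def
    using len_mult[of ?a ?b] mod by (simp_all add: len_gn_pow)
  then show "cyc_red half_quotient" "signed_len half_quotient = 2"
    by (simp_all add: cyc_red_def signed_len_def half_quotient_def)
qed

text \<open>
  All fixed points are even, so their signed lengths are even integers, and the element in question
  has signed length \<open>2\<close>; it remains to compare elements of the same signed length.\<close>

lemma twisted_fix_one_generate:
  assumes "even p" "even q"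
  shows "twisted_fix \<one> = generate G {half_quotient}"
proof
  note hq = half_quotient[OF assms]
  have C: "subgroup (twisted_fix \<one>) G" by (rule subgroup_twisted_fix) simp
  show "generate G {half_quotient} \<subseteq> twisted_fix \<one>"
    using hq(1) by (intro generate_subgroup_incl C) simp
  show "twisted_fix \<one> \<subseteq> generate G {half_quotient}"
  proof
    fix a assume a: "a \<in> twisted_fix \<one>"
    have "even (signed_len a)" using tau_fixed_even[OF a] by (simp add: signed_len_def)
    then obtain j where j: "signed_len a = 2 * j" by (rule evenE)
    let ?c = "half_quotient [^] (- j)"
    have c: "?c \<in> twisted_fix \<one>" by (rule subgroup_int_pow_closed[OF C hq(1)])
    have ca: "?c \<otimes> a \<in> twisted_fix \<one>" using subgroup.m_closed[OF C c a] .
    have car: "a \<in> carrier G" "half_quotient \<in> carrier G" using a hq(1) by (simp_all add: twisted_fix_def)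
    have "signed_len (?c \<otimes> a) = signed_len ?c + signed_len a"
      using car a c ca by (intro signed_len_mult tau_fixed_even) simp_all
    also have "\<dots> = 0" using signed_len_int_pow[OF hq(2), of "- j"] hq(3) j by simp
    finally have "?c \<otimes> a = \<one>" using ca by (intro twisted_fix_len_0[of \<one>]) (simp_all add: signed_len_eq_0_iff)
    then have "half_quotient [^] j \<otimes> (?c \<otimes> a) = half_quotient [^] j" using car by simp
    then have "a = half_quotient [^] j" using car by (simp add: int_pow_neg)
    then show "a \<in> generate G {half_quotient}" using car by (auto simp: generate_pow)
  qed
qed

text \<open>
  As the period is even, odd powers of \<open>gn t\<close> are not central.  For an even fixed point \<open>v\<close> of positive
  length, merging occurs on exactly one side of the equation.  For odd ones, either the two sides begin
  with different types or the first syllable can be removed, which turns the exponent on the left into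
  another odd number.\<close>

lemma twisted_fix_odd_power_trivial:
  assumes r: "odd r" and period: "even (period t)"
  shows "twisted_fix (gn t [^] (r::int)) = {\<one>}"
proof -
  have odd: "len (gn t [^] e) = 1 \<and> first_type (gn t [^] e) = t \<and> last_type (gn t [^] e) = t" if "odd e" for e :: int
  proof -
    have "e mod period t \<noteq> 0" using that period by (metis dvd_trans mod_eq_0_iff_dvd)
    then show ?thesis by (simp add: len_gn_pow)
  qed
  have contr: False
    if v: "v \<in> carrier G" "even (len v)" "0 < len v" "odd e" "gn t [^] e \<otimes> tu v = v \<otimes> gn t [^] r"
    for v and e :: int
  proof -
    have ty: "first_type v \<noteq> last_type v" using v odd_len_iff by blast
    note t = odd[OF r] odd[OF v(4)]
    show False
    proof (cases "first_type v = t")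
      case True
      have "len (gn t [^] e \<otimes> tu v) < len (gn t [^] e) + len (tu v)"
        using v t True by (intro len_mult_less) (simp_all add: first_type_tau)
      moreover have "len (v \<otimes> gn t [^] r) = len v + len (gn t [^] r)"
        using v t True ty by (intro len_mult) auto
      ultimately show False using v t by simp
    next
      case False
      then have "last_type v = t" using ty gen_eq_third by metis
      have "len (v \<otimes> gn t [^] r) < len v + len (gn t [^] r)"
        using v t \<open>last_type v = t\<close> by (intro len_mult_less) simp_all
      moreover have "len (gn t [^] e \<otimes> tu v) = len (gn t [^] e) + len (tu v)"
        using v t False by (intro len_mult) (simp_all add: first_type_tau)
      ultimately show False using v t by simp
    qed
  qed
  have "a = \<one>" if a: "a \<in> twisted_fix (gn t [^] r)" for a
  proof (rule twisted_fix_len_0[OF _ a])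
    have ac: "a \<in> carrier G" "gn t [^] r \<otimes> tu a = a \<otimes> gn t [^] r" using a by (auto simp: twisted_fix_def)
    show "len a = 0"
    proof (rule ccontr)
      assume ne: "len a \<noteq> 0"
      then have odda: "odd (len a)" using contr[of a r] ac r by blast
      then have ty: "first_type a = last_type a" using ne odd_len_iff[of a] ac by simp
      note t = odd[OF r]
      show False
      proof (cases "first_type a = t")
        case False
        have "first_type (gn t [^] r \<otimes> tu a) = first_type (gn t [^] r)"
          using ac(1) t ne False by (intro len_mult) (simp_all add: first_type_tau)
        moreover have "first_type (a \<otimes> gn t [^] r) = first_type a"
          using ac(1) t ne False ty by (intro len_mult) simp_all
        ultimately show False using ac(2) t False by metis
      next
        case True
        obtain i :: int and v where v: "v \<in> carrier G" "a = gn t [^] i \<otimes> v" "len a = Suc (len v)"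
          using split_first_syllable[of a] ac ne True by (metis neq0_conv)
        have "gn t [^] i \<otimes> (gn t [^] (r - 2 * i) \<otimes> tu v) = gn t [^] r \<otimes> (gn t [^] (- i) \<otimes> tu v)"
          using v(1) by (simp add: gn_collect)
        also have "\<dots> = gn t [^] r \<otimes> tu a" using v by (simp add: tau_mult tau_gn_pow)
        also have "\<dots> = gn t [^] i \<otimes> (v \<otimes> gn t [^] r)" using ac(2) v by (simp add: m_assoc)
        finally have eq: "gn t [^] (r - 2 * i) \<otimes> tu v = v \<otimes> gn t [^] r" using v by simp
        have "even (len v)" using odda v by simp
        then have "len v = 0" using contr[of v "r - 2 * i"] v eq r by fastforce
        then obtain m :: int where "v = z [^] m" using v len_eq_0_iff by blast
        then have "v = gn t [^] (period t * m)" by (simp add: gn_pow_period flip: int_pow_pow)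
        then have aj: "a = gn t [^] (i + period t * m)" using v(2) by (simp add: int_pow_mult)
        define j where "j = i + period t * m"
        have "deg (gn t [^] r \<otimes> tu a) = deg (a \<otimes> gn t [^] r)" using ac by simp
        then have "deg a = 0" using ac(1) by (simp add: deg_mult deg_tau)
        then have "j = 0" using aj deg_gn_pos[of t] by (simp add: deg_int_pow j_def)
        then have "a = \<one>" using aj by (simp add: j_def)
        then show False using ne len_zpow[of 0] by simp
      qed
    qed
  qed simp
  moreover have "\<one> \<in> twisted_fix (gn t [^] r)"
    by (rule subgroup.one_closed[OF subgroup_twisted_fix]) simp
  ultimately show ?thesis by blast
qed

text \<open>
  If the shortest twisted conjugate \<open>w\<close> were cyclically reduced, so would be \<open>w \<otimes> tu w\<close>, which is
  conjugate to \<open>g \<otimes> tu g\<close>.\<close>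

lemma elliptic_twisted_form:
  assumes "g \<in> carrier G" "\<not> hyp (g \<otimes> tu g)"
  obtains h t and r :: int where "h \<in> carrier G" "g = h \<otimes> gn t [^] r \<otimes> inv (tu h)"
proof -
  obtain u where u: "u \<in> carrier G"
      "len (inv u \<otimes> g \<otimes> tu u) \<le> 1 \<or> cyc_red (inv u \<otimes> g \<otimes> tu u)"
    using ex_short_twisted_conjugate[OF assms(1) tau_hom] tau_gn_pow by blast
  define w where "w = inv u \<otimes> g \<otimes> tu u"
  have w: "w \<in> carrier G" using u assms by (simp add: w_def)
  have "\<not> cyc_red w"
  proof
    assume c: "cyc_red w"
    have l: "len (w \<otimes> tu w) = len w + len (tu w)"
      by (rule len_mult) (use cyc_redD[OF c] in \<open>auto simp: first_type_tau\<close>)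
    have "cyc_red (w \<otimes> tu w)"
      using w l cyc_redD(2)[OF c] by (simp add: cyc_red_def)
    moreover have "w \<otimes> tu w = conj_by u (g \<otimes> tu g)"
      using u assms by (simp add: w_def conj_by_def tau_mult tau_inv tau_tau m_assoc)
    ultimately show False using assms u by (auto simp: hyp_def)
  qed
  then obtain t and r :: int where tr: "w = gn t [^] r"
    using len_le_1_imp_gn_pow[OF w] u(2) unfolding w_def[symmetric] by metis
  have "g = u \<otimes> w \<otimes> inv (tu u)" using u assms by (simp add: w_def m_assoc)
  then show ?thesis using that u tr by blast
qed

section \<open>The fixed subgroups\<close>

lemma cent_hyp_root_unique:
  assumes "hyp g" "a \<in> cent g" "b \<in> cent g" "a [^] (n::int) = b [^] n" "n \<noteq> 0"
  shows "a = b"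
proof -
  have g: "g \<in> carrier G" using assms by (simp add: hyp_def)
  note C = subgroup_cent[OF g]
  obtain s :: "gen word set \<Rightarrow> int"
    where s: "\<And>a b. a \<in> cent g \<Longrightarrow> b \<in> cent g \<Longrightarrow> s (a \<otimes> b) = s a + s b"
      "\<And>a. a \<in> cent g \<Longrightarrow> s a = 0 \<longleftrightarrow> len a = 0"
    using cent_hyp_hom[OF assms(1)] by metis
  let ?c = "a \<otimes> inv b"
  have car: "a \<in> carrier G" "b \<in> carrier G" using assms by (simp_all add: cent_def)
  have ib: "inv b \<in> cent g" using subgroup.m_inv_closed[OF C] assms by blast
  have cc: "?c \<in> cent g" using subgroup.m_closed[OF C assms(2) ib] .
  have "?c [^] n = a [^] n \<otimes> inv b [^] n"
    by (rule int_pow_mult_distrib) (use cent_hyp_abelian[OF assms(1,2) ib] car in simp_all)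
  then have one: "?c [^] n = \<one>" using car assms(4) by (simp add: int_pow_inv)
  have "\<not> hyp ?c" using hyp_len[OF hyp_int_pow[of ?c n]] one assms(5) len_zpow[of 0] by auto
  have "n * deg ?c = 0" using deg_int_pow[of ?c n] one car by (simp add: deg_one)
  then have d: "deg ?c = 0" using assms(5) by simp
  have "s (?c [^] k) = int k * s ?c" for k :: nat
  proof (induction k)
    case 0
    then show ?case using s(2)[of \<one>] subgroup.one_closed[OF C] len_zpow[of 0] by simp
  next
    case (Suc k)
    have "?c [^] k \<in> cent g" using subgroup_int_pow_closed[OF C cc, of "int k"] by (simp add: int_pow_int)
    then show ?case using s(1)[of "?c [^] k" ?c] cc Suc by (simp add: algebra_simps)
  qed
  moreover have "?c [^] nat \<bar>n\<bar> = \<one>"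
    using one car by (cases n rule: int_cases2) (simp_all add: int_pow_int int_pow_neg)
  moreover have "s \<one> = 0" using s(2)[of \<one>] subgroup.one_closed[OF C] len_zpow[of 0] by simp
  ultimately have "int (nat \<bar>n\<bar>) * s ?c = 0" by metis
  then have "s ?c = 0" using assms(5) by simp
  then have "?c = \<one>" using s(2)[OF cc] d car by (intro len_0_deg_0) simp_all
  then have "?c \<otimes> b = b" using car by simp
  then show ?thesis using car by (simp add: m_assoc)
qed

lemma hyp_int_pow_eq_one: "hyp g \<Longrightarrow> g [^] (n::int) = \<one> \<Longrightarrow> n = 0"
  using hyp_len[OF hyp_int_pow[of g n]] len_zpow[of 0] by auto

text \<open>
  The fixed subgroup lies in the centralizer of \<open>k = g \<otimes> tu g\<close> and contains \<open>k\<close>.  The homomorphism from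
  \<open>cent_hyp_hom\<close> is injective on it, because a fixed power of \<open>z\<close> is trivial; so it is infinite cyclic.
  A root \<open>e\<close> of \<open>k\<close> and its image under the automorphism are both roots of \<open>k\<close> of the same order in the
  centralizer, where roots are unique; so \<open>e\<close> is fixed.\<close>

lemma twisted_fix_hyp:
  assumes g: "g \<in> carrier G" and hyp: "hyp (g \<otimes> tu g)"
  obtains c where "c \<in> carrier G" "twisted_fix g = generate G {c}" "\<And>n::int. c [^] n = \<one> \<Longrightarrow> n = 0"
    "max_cyclic G (g \<otimes> tu g) = generate G {c}"
proof -
  let ?k = "g \<otimes> tu g"
  have k: "?k \<in> carrier G" using g by simp
  note T = subgroup_twisted_fix[OF g]
  have sub: "twisted_fix g \<subseteq> cent ?k"
  proof
    fix a assume "a \<in> twisted_fix g"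
    then have a: "a \<in> carrier G" "g \<otimes> tu a = a \<otimes> g" by (auto simp: twisted_fix_def)
    have "a \<otimes> ?k = (a \<otimes> g) \<otimes> tu g" using a g by (simp add: m_assoc)
    also have "\<dots> = (g \<otimes> tu a) \<otimes> tu g" by (simp only: a(2))
    also have "\<dots> = g \<otimes> tu (a \<otimes> g)" using a(1) g by (simp add: m_assoc tau_mult)
    also have "\<dots> = g \<otimes> tu (g \<otimes> tu a)" by (simp only: a(2))
    also have "\<dots> = ?k \<otimes> a" using a(1) g by (simp add: m_assoc tau_mult tau_tau)
    finally show "a \<in> cent ?k" using a(1) by (simp add: cent_def)
  qed
  have kT: "?k \<in> twisted_fix g" using g by (simp add: twisted_fix_def tau_mult tau_tau m_assoc)
  obtain s :: "gen word set \<Rightarrow> int"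
    where s: "\<And>a b. a \<in> cent ?k \<Longrightarrow> b \<in> cent ?k \<Longrightarrow> s (a \<otimes> b) = s a + s b"
      "\<And>a. a \<in> cent ?k \<Longrightarrow> s a = 0 \<longleftrightarrow> len a = 0"
    using cent_hyp_hom[OF hyp] by metis
  have "s (a \<otimes> b) = s a + s b" if "a \<in> twisted_fix g" "b \<in> twisted_fix g" for a b
    using that sub s(1) by blast
  then obtain c where c: "c \<in> twisted_fix g" "\<And>i::int. s (c [^] i) = i * s c" "\<And>a. a \<in> twisted_fix g \<Longrightarrow> s c dvd s a"
    using subgroup_int_hom_generator[of "twisted_fix g" s, OF T] by blast
  have cc: "c \<in> carrier G" using c by (simp add: twisted_fix_def)
  have gen: "\<exists>i::int. a = c [^] i" if a: "a \<in> twisted_fix g" for a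
  proof -
    obtain i where i: "s a = s c * i" using c(3)[OF a] by (rule dvdE)
    have ci: "c [^] (- i) \<in> twisted_fix g" using subgroup_int_pow_closed[OF T c(1)] .
    have ca: "c [^] (- i) \<otimes> a \<in> twisted_fix g" using subgroup.m_closed[OF T ci a] .
    have "s (c [^] (- i) \<otimes> a) = 0" using s(1)[of "c [^] (- i)" a] sub ci a c(2)[of "-i"] i by auto
    then have "len (c [^] (- i) \<otimes> a) = 0" using s(2) sub ca by auto
    then have "c [^] (- i) \<otimes> a = \<one>" using ca g by (intro twisted_fix_len_0[of g])
    moreover have "a \<in> carrier G" using a by (simp add: twisted_fix_def)
    ultimately have "a = c [^] i" using cc
      by (metis cancel_left(2) int_pow_closed int_pow_neg r_one)
    then show ?thesis by blast
  qed
  have eq: "twisted_fix g = generate G {c}"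
  proof
    show "generate G {c} \<subseteq> twisted_fix g" using c(1) by (intro generate_subgroup_incl T) simp
    show "twisted_fix g \<subseteq> generate G {c}" using gen cc by (auto simp: generate_pow)
  qed
  have inf: "n = 0" if "c [^] n = \<one>" for n :: int
  proof -
    obtain i :: int where "?k = c [^] i" using gen[OF kT] by blast
    then have "?k [^] n = \<one>" using \<open>c [^] n = \<one>\<close> cc by (metis int_pow_one int_pow_pow mult.commute)
    then show ?thesis using hyp hyp_int_pow_eq_one by blast
  qed
  have "max_cyclic G ?k = generate G {c}"
  proof (rule max_cyclic_eqI[OF cc])
    show "?k \<in> generate G {c}" using kT eq by simp
    fix e and n :: int assume e: "e \<in> carrier G" "?k = e [^] n"
    have "n \<noteq> 0" using hyp_len[OF hyp] e len_zpow[of 0] by auto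
    have ee: "e \<in> cent ?k" using e by (simp add: cent_def commute_int_pow)
    let ?e = "g \<otimes> tu e \<otimes> inv g"
    have pow: "?e = conj_by (inv g) (tu e)" using e g by (simp add: conj_by_def)
    have "?e [^] n = conj_by (inv g) (tu (e [^] n))"
      using e g pow by (simp add: conj_by_int_pow tau_int_pow)
    also have "\<dots> = conj_by (inv g) (tu ?k)" using e(2) by simp
    also have "\<dots> = ?k" using g by (simp add: conj_by_def tau_mult tau_tau m_assoc)
    finally have en: "?e [^] n = ?k" .
    then have "?e \<in> cent ?k" using e g commute_int_pow[of ?e ?e n] by (simp add: cent_def)
    then have "?e = e"
      using cent_hyp_root_unique[OF hyp _ ee _ \<open>n \<noteq> 0\<close>] en e(2) by simp
    then have "?e \<otimes> g = e \<otimes> g" by simp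
    then have "e \<in> twisted_fix g" using e g by (simp add: twisted_fix_def m_assoc)
    then show "e \<in> generate G {c}" using eq by simp
  qed
  then show ?thesis using that cc eq inf by blast
qed

text \<open>
  Such an element is conjugate to a non-central power of a generator, whose centralizer consists of
  the powers of that generator.\<close>

lemma cent_elliptic:
  assumes "g \<in> carrier G" "len g \<noteq> 0" "\<not> hyp g"
  obtains c where "c \<in> carrier G" "cent g = generate G {c}" "\<And>n::int. c [^] n = \<one> \<Longrightarrow> n = 0"
    "max_cyclic G g = generate G {c}"
proof -
  obtain u where u: "u \<in> carrier G" "len (conj_by u g) \<le> 1"
    using ex_short_conjugate[OF assms(1,3)] .
  have ug: "conj_by u g \<in> carrier G" using u assms by simp
  obtain t and k :: int where k: "conj_by u g = gn t [^] k"
    using len_le_1_imp_gn_pow[OF ug u(2)] by metis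
  have "len (gn t [^] k) \<noteq> 0" using k assms u len_conj_by_eq_0_iff by metis
  define c where "c = conj_by (inv u) (gn t)"
  have c: "c \<in> carrier G" using u by (simp add: c_def)
  have "a \<in> cent g \<longleftrightarrow> conj_by u a \<in> generate G {gn t}" if a: "a \<in> carrier G" for a
  proof -
    have "a \<in> cent g \<longleftrightarrow> conj_by u a \<otimes> gn t [^] k = gn t [^] k \<otimes> conj_by u a"
      using a u assms by (simp add: cent_def conj_by_commute_iff flip: k)
    also have "\<dots> \<longleftrightarrow> (\<exists>j::int. conj_by u a = gn t [^] j)"
      using cent_gn_pow[OF _ \<open>len (gn t [^] k) \<noteq> 0\<close>, of "conj_by u a"] a u
      by (auto simp: add.commute simp flip: int_pow_mult)
    also have "\<dots> \<longleftrightarrow> conj_by u a \<in> generate G {gn t}" by (auto simp: generate_pow)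
    finally show ?thesis .
  qed
  then have "cent g = {a \<in> carrier G. conj_by u a \<in> generate G {gn t}}" by (auto simp: cent_def)
  then have eq: "cent g = generate G {c}" using u by (simp add: conj_by_vimage_generate c_def)
  have "deg c = deg (gn t)" using u by (simp add: c_def conj_by_def deg_mult deg_inv)
  then have inf: "n = 0" if "c [^] n = \<one>" for n :: int
    using arg_cong[OF that, of deg] c deg_gn_pos[of t] by (simp add: deg_int_pow deg_one)
  have "max_cyclic G g = generate G {c}"
  proof (rule max_cyclic_eqI[OF c])
    show "g \<in> generate G {c}" using assms by (simp add: cent_def flip: eq)
    show "e \<in> generate G {c}" if "e \<in> carrier G" "g = e [^] n" for e and n :: int
      using that by (simp add: cent_def commute_int_pow flip: eq)
  qed
  then show ?thesis using that c eq inf by blast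
qed

lemma cent_acts_directly:
  assumes "acts_directly p q g"
  shows "internal_direct_product G (max_cyclic G g) (generate G {z}) (cent g)"
    "G\<lparr>carrier := cent g\<rparr> \<cong> integer_group \<times>\<times> integer_group"
proof -
  obtain c and k :: int where c: "hyp c" "k \<noteq> 0" "g = c [^] k" "hyp g"
    "\<And>a. a \<in> cent g \<Longrightarrow> \<exists>(i::int) (m::int). a = c [^] i \<otimes> z [^] m"
    using acts_directly_cent[OF assms] by metis
  have cc: "c \<in> carrier G" and gc: "g \<in> carrier G" using c by (simp_all add: hyp_def)
  have comm: "c [^] i \<otimes> z [^] m = z [^] m \<otimes> c [^] i" for i m :: int
    using zpow_commute[of "c [^] i" m] cc by simp
  have indep: "i = 0 \<and> m = 0" if "c [^] i \<otimes> z [^] m = \<one>" for i m :: int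
  proof -
    have "len (c [^] i) = 0"
      using len_mult_cong(4)[of "c [^] i" m] that cc len_zpow[of 0] by simp
    then have "i = 0" using hyp_len[OF hyp_int_pow[OF c(1)]] by blast
    then show ?thesis using that zpow_eq_iff[of m 0] by simp
  qed
  have cent: "cent g = {c [^] i \<otimes> z [^] m | (i::int) (m::int). True}"
  proof -
    have "c [^] i \<otimes> z [^] m \<in> cent g" for i m :: int
    proof -
      have "c \<in> cent g" using cc c(3) by (simp add: cent_def commute_int_pow)
      moreover have "z \<in> cent g" using gc by (simp add: cent_def z_commute)
      ultimately show ?thesis
        using subgroup_cent[OF gc] subgroup_int_pow_closed subgroup.m_closed by metis
    qed
    then show ?thesis using c(5) by blast
  qed
  have mult: "(c [^] i \<otimes> z [^] m) \<otimes> (c [^] j \<otimes> z [^] n) = c [^] (i + j) \<otimes> z [^] (m + n)"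
    for i j m n :: int
  proof -
    have "(c [^] i \<otimes> z [^] m) \<otimes> (c [^] j \<otimes> z [^] n) = c [^] i \<otimes> (c [^] j \<otimes> (z [^] m \<otimes> z [^] n))"
      using cc by (simp add: m_assoc zpow_left_commute)
    then show ?thesis using cc by (simp add: int_pow_mult m_assoc)
  qed
  have max: "max_cyclic G g = generate G {c}"
  proof (rule max_cyclic_eqI[OF cc])
    show "g \<in> generate G {c}" using c(3) cc by (auto simp: generate_pow)
    fix e and n :: int assume e: "e \<in> carrier G" "g = e [^] n"
    then have "e \<in> cent g" by (simp add: cent_def commute_int_pow)
    then obtain i m :: int where im: "e = c [^] i \<otimes> z [^] m" using c(5) by blast
    have "e [^] n = c [^] (i * n) \<otimes> z [^] (m * n)"
      unfolding im using cc comm by (subst int_pow_mult_distrib) (simp_all add: int_pow_pow)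
    then have "c [^] (- k) \<otimes> (c [^] (i * n) \<otimes> z [^] (m * n)) = \<one>"
      using e(2) c(3) cc by (simp add: int_pow_neg)
    then have "c [^] (- k + i * n) \<otimes> z [^] (m * n) = \<one>"
      using mult[of "-k" 0 "i * n" "m * n"] cc by simp
    then have "m * n = 0" using indep by blast
    moreover have "n \<noteq> 0" using hyp_len[OF c(4)] e len_zpow[of 0] by auto
    ultimately have "e = c [^] i" using im cc by simp
    then show "e \<in> generate G {c}" using cc by (auto simp: generate_pow)
  qed
  show "internal_direct_product G (max_cyclic G g) (generate G {z}) (cent g)"
    unfolding internal_direct_product_def max
  proof (intro conjI)
    show "subgroup (generate G {c}) G" "subgroup (generate G {z}) G"
      using cc by (simp_all add: generate_is_subgroup)
    show "\<forall>h\<in>generate G {c}. \<forall>k\<in>generate G {z}. h \<otimes> k = k \<otimes> h"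
      using cc comm by (auto simp: generate_pow)
    have "c [^] i = \<one>" if "c [^] i = z [^] m" for i m :: int
    proof -
      have "c [^] i \<otimes> z [^] (- m) = \<one>" using that by (simp add: int_pow_neg)
      then show ?thesis using indep by fastforce
    qed
    moreover have "\<one> = c [^] (0::int)" "\<one> = z [^] (0::int)" by simp_all
    ultimately show "generate G {c} \<inter> generate G {z} = {\<one>}"
      unfolding generate_pow[OF cc] generate_pow[OF z_closed] by blast
    show "cent g = generate G {c} <#> generate G {z}"
      unfolding cent set_mult_def generate_pow[OF cc] generate_pow[OF z_closed] by blast
  qed
  have "(\<lambda>(i, m). c [^] i \<otimes> z [^] m) \<in> iso (integer_group \<times>\<times> integer_group) (G\<lparr>carrier := cent g\<rparr>)"
  proof -
    have "i = j \<and> m = n" if eq: "c [^] i \<otimes> z [^] m = c [^] j \<otimes> z [^] n" for i j m n :: int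
    proof -
      have "(c [^] i \<otimes> z [^] m) \<otimes> (c [^] (- j) \<otimes> z [^] (- n)) = \<one>"
        unfolding eq mult by simp
      then show ?thesis using indep[of "i + - j" "m + - n"] unfolding mult by simp
    qed
    then have "inj_on (\<lambda>(i, m). c [^] i \<otimes> z [^] m) (UNIV \<times> UNIV :: (int \<times> int) set)" by (auto simp: inj_on_def)
    moreover have "(\<lambda>(i, m). c [^] i \<otimes> z [^] m) ` (UNIV \<times> UNIV :: (int \<times> int) set) = cent g"
      unfolding cent by auto
    ultimately show ?thesis using mult by (auto simp: iso_def hom_def bij_betw_def)
  qed
  then have "integer_group \<times>\<times> integer_group \<cong> G\<lparr>carrier := cent g\<rparr>" by (auto simp: is_iso_def)
  then show "G\<lparr>carrier := cent g\<rparr> \<cong> integer_group \<times>\<times> integer_group"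
    by (rule group.iso_sym[OF DirProd_group[OF group_integer_group group_integer_group]])
qed

end

section \<open>Inner automorphisms and finite order\<close>

lemma (in group) has_finite_order_square:
  assumes "a \<in> carrier G"
  shows "has_finite_order G (a \<otimes> a) \<longleftrightarrow> has_finite_order G a"
proof
  assume "has_finite_order G (a \<otimes> a)"
  then obtain n :: nat where n: "0 < n" "(a \<otimes> a) [^] n = \<one>" by (auto simp: has_finite_order_def)
  have "a [^] (2 * n) = (a [^] (2::nat)) [^] n" using assms by (simp add: nat_pow_pow)
  also have "a [^] (2::nat) = a \<otimes> a" using assms by (simp add: numeral_2_eq_2)
  finally have "a [^] (2 * n) = \<one>" using n by simp
  then show "has_finite_order G a" unfolding has_finite_order_def using n
    by (intro exI[of _ "2 * n"]) simp
next
  assume "has_finite_order G a"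
  then obtain n :: nat where n: "0 < n" "a [^] n = \<one>" by (auto simp: has_finite_order_def)
  have "(a \<otimes> a) [^] n = a [^] n \<otimes> a [^] n" using assms by (intro pow_mult_distrib) simp_all
  then show "has_finite_order G (a \<otimes> a)" unfolding has_finite_order_def using n by auto
qed

context group
begin

lemma AutoGroup_simps:
  "carrier (AutoGroup G) = auto G" "\<one>\<^bsub>AutoGroup G\<^esub> = (\<lambda>a\<in>carrier G. a)"
  "f \<in> auto G \<Longrightarrow> f' \<in> auto G \<Longrightarrow> f \<otimes>\<^bsub>AutoGroup G\<^esub> f' = compose (carrier G) f f'"
  by (simp_all add: AutoGroup_def BijGroup_def auto_def)

lemma conj_aut_in_auto: "g \<in> carrier G \<Longrightarrow> conj_aut G g \<in> auto G"
proof -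
  assume g: "g \<in> carrier G"
  have "bij_betw (conj_aut G g) (carrier G) (carrier G)"
    by (rule bij_betwI[of _ _ _ "conj_aut G (inv g)"]) (use g in \<open>auto simp: conj_aut_def m_assoc\<close>)
  then show ?thesis using g by (auto simp: auto_def Bij_def hom_def conj_aut_def m_assoc)
qed

lemma conj_aut_mult:
  assumes "g \<in> carrier G" "h \<in> carrier G"
  shows "conj_aut G g \<otimes>\<^bsub>AutoGroup G\<^esub> conj_aut G h = conj_aut G (g \<otimes> h)"
  unfolding AutoGroup_simps(3)[OF conj_aut_in_auto[OF assms(1)] conj_aut_in_auto[OF assms(2)]]
  using assms by (auto simp: compose_def conj_aut_def m_assoc inv_mult_group restrict_def)

lemma conj_aut_one: "conj_aut G \<one> = \<one>\<^bsub>AutoGroup G\<^esub>"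
  by (auto simp: conj_aut_def AutoGroup_simps restrict_def)

lemma conj_aut_nat_pow:
  "g \<in> carrier G \<Longrightarrow> conj_aut G g [^]\<^bsub>AutoGroup G\<^esub> (n::nat) = conj_aut G (g [^] n)"
  by (induction n) (simp_all add: conj_aut_one conj_aut_mult)

lemma mult_inv_eq_iff:
  assumes "a \<in> carrier G" "g \<in> carrier G" "b \<in> carrier G"
  shows "a \<otimes> inv g = b \<longleftrightarrow> a = b \<otimes> g"
proof
  assume "a \<otimes> inv g = b"
  then have "b \<otimes> g = a \<otimes> inv g \<otimes> g" by simp
  then show "a = b \<otimes> g" using assms by (simp add: m_assoc)
qed (use assms in \<open>simp add: m_assoc\<close>)

lemma conj_aut_eq_one_iff:
  assumes "g \<in> carrier G"
  shows "conj_aut G g = \<one>\<^bsub>AutoGroup G\<^esub> \<longleftrightarrow> (\<forall>h\<in>carrier G. g \<otimes> h = h \<otimes> g)"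
proof -
  have "conj_aut G g = \<one>\<^bsub>AutoGroup G\<^esub> \<longleftrightarrow> (\<forall>h\<in>carrier G. g \<otimes> h \<otimes> inv g = h)"
    unfolding conj_aut_def AutoGroup_simps by (auto simp: fun_eq_iff restrict_def)
  also have "\<dots> \<longleftrightarrow> (\<forall>h\<in>carrier G. g \<otimes> h = h \<otimes> g)"
    using assms by (intro ball_cong HOL.refl mult_inv_eq_iff) simp_all
  finally show ?thesis .
qed

lemma Fix_conj_aut: "g \<in> carrier G \<Longrightarrow> Fix G (conj_aut G g) = cent g"
  by (auto simp: Fix_def conj_aut_def cent_def mult_inv_eq_iff)

lemma outer_class_eq:
  assumes "\<phi> \<in> auto G"
  shows "outer_class G \<phi> = {compose (carrier G) (conj_aut G g) \<phi> | g. g \<in> carrier G}"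
  using assms conj_aut_in_auto by (auto simp: outer_class_def Inn_def r_coset_def AutoGroup_simps)

lemma outer_class_one: "outer_class G \<one>\<^bsub>AutoGroup G\<^esub> = {conj_aut G g | g. g \<in> carrier G}"
proof -
  have "compose (carrier G) (conj_aut G g) (\<lambda>a\<in>carrier G. a) = conj_aut G g" if "g \<in> carrier G" for g
    using that by (auto simp: compose_def conj_aut_def restrict_def)
  then show ?thesis
    unfolding AutoGroup_simps(2) outer_class_eq[OF id_in_auto] by (intro Collect_cong) metis
qed

end

context knot_group
begin

lemma conj_aut_eq_one_iff_len: "g \<in> carrier G \<Longrightarrow> conj_aut G g = \<one>\<^bsub>AutoGroup G\<^esub> \<longleftrightarrow> len g = 0"
  by (simp add: conj_aut_eq_one_iff central_iff)

lemma finite_order_conj_aut_iff: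
  assumes "g \<in> carrier G"
  shows "has_finite_order (AutoGroup G) (conj_aut G g) \<longleftrightarrow> \<not> hyp g"
  using assms by (auto simp: has_finite_order_def conj_aut_nat_pow conj_aut_eq_one_iff_len hyp_iff)

abbreviation conj_tau :: "gen word set \<Rightarrow> gen word set \<Rightarrow> gen word set" where
  "conj_tau g \<equiv> compose (carrier G) (conj_aut G g) tu"

text \<open>
  The square of the automorphism is conjugation by \<open>g \<otimes> tu g\<close>.\<close>

lemma finite_order_conj_tau_iff:
  assumes g: "g \<in> carrier G"
  shows "has_finite_order (AutoGroup G) (conj_tau g) \<longleftrightarrow> \<not> hyp (g \<otimes> tu g)"
proof -
  interpret A: group "AutoGroup G" by (rule AutoGroup)
  have eq: "conj_tau g = conj_aut G g \<otimes>\<^bsub>AutoGroup G\<^esub> tu"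
    using conj_aut_in_auto[OF g] tau_auto by (simp add: AutoGroup_simps)
  have mem: "conj_tau g \<in> auto G"
    using A.m_closed[of "conj_aut G g" tu] conj_aut_in_auto[OF g] tau_auto
    by (simp add: eq AutoGroup_simps(1))
  have "conj_tau g \<otimes>\<^bsub>AutoGroup G\<^esub> conj_tau g = conj_aut G (g \<otimes> tu g)"
    unfolding AutoGroup_simps(3)[OF mem mem] unfolding compose_def conj_aut_def
    by (rule restrict_ext) (use g in \<open>simp add: tau_mult tau_inv tau_tau m_assoc inv_mult_group\<close>)
  then show ?thesis
    using A.has_finite_order_square[of "conj_tau g"] mem g finite_order_conj_aut_iff[of "g \<otimes> tu g"]
    by (simp add: AutoGroup_simps(1))
qed

lemma Fix_conj_tau: "g \<in> carrier G \<Longrightarrow> Fix G (conj_tau g) = twisted_fix g"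
  by (auto simp: Fix_def compose_def conj_aut_def twisted_fix_def mult_inv_eq_iff)

text \<open>
  An even power is a twisted conjugate of the identity: \<open>w ^ r = w ^ (r / 2) \<otimes> inv (\<tau> (w ^ (r / 2)))\<close>.\<close>

lemma twisted_fix_even:
  assumes "h \<in> carrier G" "even r" "even p" "even q"
  obtains c where "c \<in> carrier G"
    "c = h \<otimes> gn t [^] (r div 2) \<otimes> gn Gen_x [^] (int p div 2)
      \<otimes> gn Gen_y [^] (- (int q div 2)) \<otimes> gn t [^] (- (r div 2)) \<otimes> inv h"
    "twisted_fix (h \<otimes> gn t [^] (r::int) \<otimes> inv (tu h)) = generate G {c}"
    "\<And>n::int. c [^] n = \<one> \<Longrightarrow> n = 0"
proof -
  let ?w = "gn t [^] (r div 2)"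
  define u where "u = h \<otimes> ?w"
  have u: "u \<in> carrier G" using assms by (simp add: u_def)
  note hq = half_quotient[OF assms(3,4)]
  have hqc: "half_quotient \<in> carrier G" using hq(2) cyc_redD by blast
  define c where "c = conj_by (inv u) half_quotient"
  have r: "gn t [^] r = ?w \<otimes> ?w" using assms(2) by (simp flip: int_pow_mult)
  have "h \<otimes> gn t [^] r \<otimes> inv (tu h) = u \<otimes> \<one> \<otimes> inv (tu u)"
    using assms(1) by (simp add: u_def r tau_mult tau_gn_pow inv_mult_group int_pow_neg m_assoc)
  then have "twisted_fix (h \<otimes> gn t [^] r \<otimes> inv (tu h)) = {a \<in> carrier G. conj_by u a \<in> twisted_fix \<one>}"
    using twisted_fix_twisted_conjugate[OF u one_closed] by simp
  also have "\<dots> = generate G {c}"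
    unfolding twisted_fix_one_generate[OF assms(3,4)] c_def using u hqc by (rule conj_by_vimage_generate)
  finally have eq: "twisted_fix (h \<otimes> gn t [^] r \<otimes> inv (tu h)) = generate G {c}" .
  have "c = h \<otimes> ?w \<otimes> gn Gen_x [^] (int p div 2)
      \<otimes> gn Gen_y [^] (- (int q div 2)) \<otimes> gn t [^] (- (r div 2)) \<otimes> inv h"
    using assms(1) by (simp add: c_def conj_by_def u_def half_quotient_def inv_mult_group int_pow_neg m_assoc)
  moreover have "n = 0" if "c [^] n = \<one>" for n :: int
  proof -
    have "conj_by u (c [^] n) = half_quotient [^] n"
      using u hqc by (simp add: c_def conj_by_int_pow conj_by_conj_by)
    then have "half_quotient [^] n = \<one>" using that u by (simp add: conj_by_def)
    then show ?thesis using hq(2) int_pow_eq_one_cyc_red by blast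
  qed
  moreover have "c \<in> carrier G" using u hqc by (simp add: c_def)
  ultimately show ?thesis using eq that by blast
qed

text \<open>
  If \<open>r\<close> is odd and the period of \<open>gn t\<close> is odd, replacing \<open>r\<close> by \<open>r + period t\<close> makes the exponent even at
  the cost of a power of \<open>z\<close>, which does not affect the conjugation.\<close>

lemma twisted_fix_not_even:
  assumes "h \<in> carrier G" "\<not> (even p \<and> even q \<and> even r)"
  shows "twisted_fix (h \<otimes> gn t [^] (r::int) \<otimes> inv (tu h)) = {\<one>}"
proof -
  have conj: "{a \<in> carrier G. conj_by u a \<in> {\<one>}} = {\<one>}" if "u \<in> carrier G" for u
  proof -
    have "a = \<one>" if a: "a \<in> carrier G" "conj_by u a = \<one>" for a
    proof -
      have "a = conj_by (inv u) (conj_by u a)" using a(1) \<open>u \<in> carrier G\<close> by (simp add: conj_by_conj_by)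
      also have "\<dots> = \<one>" unfolding a(2) using \<open>u \<in> carrier G\<close> by (simp add: conj_by_def)
      finally show ?thesis .
    qed
    then show ?thesis using that by (auto simp: conj_by_def)
  qed
  have even_case: "twisted_fix (h \<otimes> gn t [^] e \<otimes> inv (tu h)) = {\<one>}" if "even e" "odd (period s)" for e :: int and s
  proof -
    define u where "u = h \<otimes> gn t [^] (e div 2)"
    have u: "u \<in> carrier G" using assms by (simp add: u_def)
    have r: "gn t [^] e = gn t [^] (e div 2) \<otimes> gn t [^] (e div 2)"
      using \<open>even e\<close> by (simp flip: int_pow_mult)
    have "h \<otimes> gn t [^] e \<otimes> inv (tu h) = u \<otimes> \<one> \<otimes> inv (tu u)"
      using assms(1) by (simp add: u_def r tau_mult tau_gn_pow inv_mult_group int_pow_neg m_assoc)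
    then show ?thesis
      using twisted_fix_twisted_conjugate[OF u one_closed] twisted_fix_one_trivial[OF \<open>odd (period s)\<close>] conj[OF u] by simp
  qed
  show ?thesis
  proof (cases "even r")
    case True
    then obtain s where "odd (period s)"
      using assms(2) that[of Gen_x] that[of Gen_y] by (auto simp: period_def)
    then show ?thesis using even_case True by blast
  next
    case False
    show ?thesis
    proof (cases "even (period t)")
      case True
      then show ?thesis
        using twisted_fix_twisted_conjugate[OF assms(1), of "gn t [^] r"] twisted_fix_odd_power_trivial[OF False True]
          conj[OF assms(1)] by simp
    next
      case odd: False
      have "gn t [^] r = gn t [^] (r + period t) \<otimes> z [^] (-1::int)"
        by (simp add: int_pow_mult gn_pow_period int_pow_neg m_assoc)
      then have "h \<otimes> gn t [^] r \<otimes> inv (tu h)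
          = (h \<otimes> gn t [^] (r + period t) \<otimes> inv (tu h)) \<otimes> z [^] (-1::int)"
        using assms(1) zpow_commute[of "inv (tu h)" "-1"] by (simp add: m_assoc)
      then show ?thesis
        using twisted_fix_zpow[of "h \<otimes> gn t [^] (r + period t) \<otimes> inv (tu h)" "-1"]
          even_case[of "r + period t" t] odd False assms(1) by simp
    qed
  qed
qed

end

theorem theorem1p1:
  fixes p q :: nat
    and G (structure)
    and x y :: "gen word set"
    and \<tau> :: "gen word set \<Rightarrow> gen word set"
    and \<iota> :: "gen word set \<Rightarrow> gen word set \<Rightarrow> gen word set"
  assumes "p \<ge> 2" and "q \<ge> 2"
    and "G = Gpq p q" and "x = Gpq_x p q" and "y = Gpq_y p q"
    and "\<tau> = tau p q" and "\<iota> = conj_aut G"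
  shows
    "(outer_class G \<one>\<^bsub>AutoGroup G\<^esub> = {\<iota> g | g. g \<in> carrier G} \<and>
     (\<forall>g\<in>carrier G. \<iota> g \<noteq> \<one>\<^bsub>AutoGroup G\<^esub> \<longrightarrow>
        (has_finite_order (AutoGroup G) (\<iota> g) \<longrightarrow>
           Fix G (\<iota> g) = max_cyclic G g \<and>
           G\<lparr>carrier := Fix G (\<iota> g)\<rparr> \<cong> integer_group) \<and>
        (\<not> has_finite_order (AutoGroup G) (\<iota> g) \<longrightarrow>
           (\<exists>g'\<in>carrier G. acts_directly p q g' \<and> \<iota> g' = \<iota> g) \<and>
           (acts_directly p q g \<longrightarrow>
              internal_direct_product G (max_cyclic G g) (generate G {x [^] p}) (Fix G (\<iota> g)) \<and>
              G\<lparr>carrier := Fix G (\<iota> g)\<rparr> \<cong> integer_group \<times>\<times> integer_group)))) \<and>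
     (outer_class G \<tau> = {compose (carrier G) (\<iota> g) \<tau> | g. g \<in> carrier G} \<and>
     (\<forall>g\<in>carrier G. let \<phi> = compose (carrier G) (\<iota> g) \<tau> in
        (has_finite_order (AutoGroup G) \<phi> \<longrightarrow>
           (\<exists>h\<in>carrier G. \<exists>r::int. \<exists>w\<in>{x, y}. g = h \<otimes> w [^] r \<otimes> inv (\<tau> h)) \<and>
           (\<forall>h\<in>carrier G. \<forall>r::int. \<forall>w\<in>{x, y}. g = h \<otimes> w [^] r \<otimes> inv (\<tau> h) \<longrightarrow>
              (even p \<and> even q \<and> even r \<longrightarrow>
                 Fix G \<phi> = generate G
                   {h \<otimes> w [^] (r div 2) \<otimes> x [^] (int p div 2) \<otimes> y [^] (- (int q div 2))
                      \<otimes> w [^] (- (r div 2)) \<otimes> inv h} \<and>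
                 G\<lparr>carrier := Fix G \<phi>\<rparr> \<cong> integer_group) \<and>
              (\<not> (even p \<and> even q \<and> even r) \<longrightarrow> Fix G \<phi> = {\<one>}))) \<and>
        (\<not> has_finite_order (AutoGroup G) \<phi> \<longrightarrow>
           Fix G \<phi> = max_cyclic G (g \<otimes> \<tau> g) \<and>
           G\<lparr>carrier := Fix G \<phi>\<rparr> \<cong> integer_group)))"
proof -
  interpret knot_group p q G using assms(1-3) by unfold_locales
  have x: "x = gn Gen_x" and y: "y = gn Gen_y"
    using assms(4,5) by (simp_all add: gn_def Gpq_x_def Gpq_y_def)
  have w: "w \<in> {x, y} \<longleftrightarrow> (\<exists>t. w = gn t)" for w
  proof
    assume "\<exists>t. w = gn t"
    then obtain t where "w = gn t" by blast
    then show "w \<in> {x, y}" by (cases t) (simp_all add: x y)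
  qed (auto simp: x y)
  have xp: "x [^] p = z" by (simp add: x z_def period_def int_pow_int)
  note [simp] = assms(6,7)
  have A1: "Fix G (\<iota> g) = max_cyclic G g \<and> G\<lparr>carrier := Fix G (\<iota> g)\<rparr> \<cong> integer_group"
    if g: "g \<in> carrier G" and ne: "\<iota> g \<noteq> \<one>\<^bsub>AutoGroup G\<^esub>"
      and fin: "has_finite_order (AutoGroup G) (\<iota> g)" for g
  proof -
    have "len g \<noteq> 0" "\<not> hyp g"
      using ne fin g by (simp_all add: conj_aut_eq_one_iff_len finite_order_conj_aut_iff)
    then obtain c where "c \<in> carrier G" "cent g = generate G {c}" "\<And>n::int. c [^] n = \<one> \<Longrightarrow> n = 0"
      "max_cyclic G g = generate G {c}"
      using cent_elliptic[OF g] by metis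
    then show ?thesis using generate_iso_integer_group[of c] g by (simp add: Fix_conj_aut)
  qed
  have A2: "\<exists>g'\<in>carrier G. acts_directly p q g' \<and> \<iota> g' = \<iota> g"
    if g: "g \<in> carrier G" and inf: "\<not> has_finite_order (AutoGroup G) (\<iota> g)" for g
  proof -
    have "hyp g" using inf g by (simp add: finite_order_conj_aut_iff)
    then obtain g' and m :: int where g': "acts_directly p q g'" "g' \<in> carrier G" "g = g' \<otimes> z [^] m"
      by (rule ex_acts_directly)
    have "conj_aut G (z [^] m) = \<one>\<^bsub>AutoGroup G\<^esub>" by (simp add: conj_aut_eq_one_iff_len)
    then have "\<iota> g = conj_aut G g' \<otimes>\<^bsub>AutoGroup G\<^esub> \<one>\<^bsub>AutoGroup G\<^esub>"
      using g' by (simp flip: conj_aut_mult)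
    also have "\<dots> = \<iota> g'"
      using monoid.r_one[OF group.is_monoid[OF AutoGroup], of "conj_aut G g'"] conj_aut_in_auto[OF g'(2)]
      by (simp add: AutoGroup_simps(1))
    finally show ?thesis using g' by metis
  qed
  have A3: "internal_direct_product G (max_cyclic G g) (generate G {x [^] p}) (Fix G (\<iota> g)) \<and>
      G\<lparr>carrier := Fix G (\<iota> g)\<rparr> \<cong> integer_group \<times>\<times> integer_group"
    if "g \<in> carrier G" "acts_directly p q g" for g
    using cent_acts_directly[OF that(2)] that(1) by (simp add: Fix_conj_aut xp)
  have B1: "\<exists>h\<in>carrier G. \<exists>r::int. \<exists>w\<in>{x, y}. g = h \<otimes> w [^] r \<otimes> inv (\<tau> h)"
    if g: "g \<in> carrier G" and fin: "has_finite_order (AutoGroup G) (conj_tau g)" for g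
  proof -
    have "\<not> hyp (g \<otimes> tu g)" using fin g finite_order_conj_tau_iff by blast
    then obtain h t and r :: int where "h \<in> carrier G" "g = h \<otimes> gn t [^] r \<otimes> inv (tu h)"
      using elliptic_twisted_form[OF g] by metis
    moreover have "gn t \<in> {x, y}" using w by blast
    ultimately show ?thesis by auto
  qed
  have B1a: "Fix G (conj_tau g) = generate G
         {h \<otimes> w [^] (r div 2) \<otimes> x [^] (int p div 2) \<otimes> y [^] (- (int q div 2))
            \<otimes> w [^] (- (r div 2)) \<otimes> inv h} \<and>
       G\<lparr>carrier := Fix G (conj_tau g)\<rparr> \<cong> integer_group"
    if a: "g \<in> carrier G" "h \<in> carrier G" "w \<in> {x, y}" "g = h \<otimes> w [^] r \<otimes> inv (\<tau> h)"
      "even p \<and> even q \<and> even r" for g h w and r :: int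
  proof -
    obtain t where t: "w = gn t" using a(3) w by blast
    obtain c where c: "c \<in> carrier G"
      "c = h \<otimes> gn t [^] (r div 2) \<otimes> gn Gen_x [^] (int p div 2)
        \<otimes> gn Gen_y [^] (- (int q div 2)) \<otimes> gn t [^] (- (r div 2)) \<otimes> inv h"
      "twisted_fix (h \<otimes> gn t [^] r \<otimes> inv (tu h)) = generate G {c}"
      "\<And>n::int. c [^] n = \<one> \<Longrightarrow> n = 0"
      using twisted_fix_even[OF a(2), of r t] a(5) by blast
    have "Fix G (conj_tau g) = generate G {c}"
      unfolding Fix_conj_tau[OF a(1)] unfolding c(3)[symmetric] a(4) t assms(6) ..
    then show ?thesis
      using generate_iso_integer_group[OF c(1,4)] unfolding t x y c(2)[symmetric] by simp
  qed
  have B1b: "Fix G (conj_tau g) = {\<one>}"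
    if a: "g \<in> carrier G" "h \<in> carrier G" "w \<in> {x, y}" "g = h \<otimes> w [^] r \<otimes> inv (\<tau> h)"
      "\<not> (even p \<and> even q \<and> even r)" for g h w and r :: int
  proof -
    obtain t where t: "w = gn t" using a(3) w by blast
    show ?thesis
      unfolding Fix_conj_tau[OF a(1)] using twisted_fix_not_even[OF a(2,5), of t] a(4) t by simp
  qed
  have B2: "Fix G (conj_tau g) = max_cyclic G (g \<otimes> \<tau> g) \<and> G\<lparr>carrier := Fix G (conj_tau g)\<rparr> \<cong> integer_group"
    if g: "g \<in> carrier G" and inf: "\<not> has_finite_order (AutoGroup G) (conj_tau g)" for g
  proof -
    have "hyp (g \<otimes> tu g)" using inf g finite_order_conj_tau_iff by blast
    then obtain c where "c \<in> carrier G" "twisted_fix g = generate G {c}" "\<And>n::int. c [^] n = \<one> \<Longrightarrow> n = 0"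
      "max_cyclic G (g \<otimes> tu g) = generate G {c}"
      using twisted_fix_hyp[OF g] by metis
    then show ?thesis using generate_iso_integer_group[of c] by (simp add: Fix_conj_tau[OF g])
  qed
  show ?thesis
    unfolding Let_def assms(6,7)
  proof (intro conjI ballI impI allI, goal_cases)
    case 1
    show ?case by (rule outer_class_one)
  next
    case (2 g)
    then show ?case using A1[of g, unfolded assms(7)] by blast
  next
    case (3 g)
    then show ?case using A1[of g, unfolded assms(7)] by blast
  next
    case (4 g)
    then show ?case using A2[of g, unfolded assms(7)] by blast
  next
    case (5 g)
    then show ?case using A3[of g, unfolded assms(7)] by blast
  next
    case (6 g)
    then show ?case using A3[of g, unfolded assms(7)] by blast
  next
    case 7
    show ?case using tau_auto by (rule outer_class_eq)
  next
    case (8 g)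
    then show ?case by (rule B1[unfolded assms(6)])
  next
    case (9 g h r w)
    then show ?case using B1a[of g h w r, unfolded assms(6)] by blast
  next
    case (10 g h r w)
    then show ?case using B1a[of g h w r, unfolded assms(6)] by blast
  next
    case (11 g h r w)
    then show ?case using B1b[of g h w r, unfolded assms(6)] by blast
  next
    case (12 g)
    then show ?case using B2[of g, unfolded assms(6)] by blast
  next
    case (13 g)
    then show ?case using B2[of g, unfolded assms(6)] by blast
  qed
qed

end
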